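(* (a) Let $k$ be a field, $R=k[[X_1,\dots,X_6]]$ a power series ring in six indeterminates, $\Delta_1:=X_2X_6-X_3X_5$, $\Delta_2:=X_1X_6-X_3X_4$, $\Delta_3:=X_1X_5-X_2X_4$ (the $2\times 2$-minors of the matrix $\begin{pmatrix} X_1 & X_2 & X_3\\ X_4 & X_5 & X_6\end{pmatrix}$), and let $I$ be the ideal $(\Delta_1,\Delta_2,\Delta_3)\subseteq R$. Then $\operatorname{Supp}_R(H^3_I(R))\subseteq\{(X_1,\dots,X_6)\}$ and consequently $\operatorname{Ass}_R(H^3_I(R))$ is finite. (b) Let $R$ be a local equicharacteristic Cohen-Macaulay ring and let $x_1,\dots,x_6\in R$ be a regular sequence. Let $\delta_1:=x_2x_6-x_3x_5$, $\delta_2:=x_1x_6-x_3x_4$, $\delta_3:=x_1x_5-x_2x_4$ and let $I$ be the ideal $(\delta_1,\delta_2,\delta_3)\subseteq R$. Then $\operatorname{Ass}_R(H^3_I(R))$ is finite.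
   Context: Local rings are commutative and noetherian. A local ring is equicharacteristic if it has the same characteristic as its residue field. $H^j_I(R)$ denotes the $j$-th local cohomology module of $R$ with support in the ideal $I$, i.e. the $j$-th right derived functor of $\Gamma_I(M)=\{m\in M : I^n m=0 \text{ for some } n\}$, evaluated at $M=R$. $\operatorname{Ass}_R$ and $\operatorname{Supp}_R$ denote the set of associated primes and the support of an $R$-module. *)

theory Defs
  imports "HOL-Algebra.Algebra" "HOL-Library.Extended_Nat"
begin

section \<open>Commutative algebra\<close>

definition noetherian_local_ring :: "('a, 'b) ring_scheme \<Rightarrow> 'a set \<Rightarrow> bool" where
  "noetherian_local_ring R \<mm> \<longleftrightarrow>
     cring R \<and> noetherian_ring R \<and> (\<forall>J. maximalideal J R \<longleftrightarrow> J = \<mm>)"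

text \<open>The additive order of the unit; \<^const>\<open>group.ord\<close> is \<open>0\<close> on elements of infinite order.\<close>

definition ring_characteristic :: "('a, 'b) ring_scheme \<Rightarrow> nat" where
  "ring_characteristic R = group.ord (add_monoid R) \<one>\<^bsub>R\<^esub>"

definition equicharacteristic :: "('a, 'b) ring_scheme \<Rightarrow> 'a set \<Rightarrow> bool" where
  "equicharacteristic R \<mm> \<longleftrightarrow> ring_characteristic R = ring_characteristic (R Quot \<mm>)"

text \<open>Each \<open>x\<^sub>i\<close> is a nonzerodivisor on \<open>R/(x\<^sub>1,\<dots>,x\<^sub>i\<^sub>-\<^sub>1)\<close>, and \<open>R/(x\<^sub>1,\<dots>,x\<^sub>n) \<noteq> 0\<close>.\<close>

definition regular_sequence :: "('a, 'b) ring_scheme \<Rightarrow> 'a list \<Rightarrow> bool" where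
  "regular_sequence R xs \<longleftrightarrow>
     set xs \<subseteq> carrier R \<and>
     (\<forall>i<length xs. \<forall>r\<in>carrier R.
        xs ! i \<otimes>\<^bsub>R\<^esub> r \<in> genideal R (set (take i xs)) \<longrightarrow> r \<in> genideal R (set (take i xs))) \<and>
     genideal R (set xs) \<noteq> carrier R"

definition krull_dim :: "('a, 'b) ring_scheme \<Rightarrow> enat" where
  "krull_dim R =
     Sup {enat n | n. \<exists>P. (\<forall>i\<le>n. primeideal (P i) R) \<and> (\<forall>i<n. P i \<subset> P (Suc i))}"

definition depth :: "('a, 'b) ring_scheme \<Rightarrow> 'a set \<Rightarrow> enat" where
  "depth R \<mm> = Sup {enat (length xs) | xs. set xs \<subseteq> \<mm> \<and> regular_sequence R xs}"

definition cohen_macaulay :: "('a, 'b) ring_scheme \<Rightarrow> 'a set \<Rightarrow> bool" where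
  "cohen_macaulay R \<mm> \<longleftrightarrow> depth R \<mm> = krull_dim R"

text \<open>
  The ring of formal power series with coefficients in \<open>K\<close> and indeterminates indexed by the
  finite set \<open>V\<close>. As in \<^theory>\<open>HOL-Algebra.Indexed_Polynomials\<close>, monomials are multisets of
  indices; the \<open>i\<close>-th indeterminate is \<open>ring.indexed_var K i\<close>.
\<close>

definition powser_ring :: "('k, 'b) ring_scheme \<Rightarrow> 'c set \<Rightarrow> ('c multiset \<Rightarrow> 'k) ring" where
  "powser_ring K V =
     \<lparr> carrier = {f. (\<forall>m. f m \<in> carrier K) \<and> (\<forall>m. \<not> set_mset m \<subseteq> V \<longrightarrow> f m = \<zero>\<^bsub>K\<^esub>)},
       monoid.mult = (\<lambda>f g m. \<Oplus>\<^bsub>K\<^esub>a \<in> {a. a \<subseteq># m}. f a \<otimes>\<^bsub>K\<^esub> g (m - a)),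
       one = ring.indexed_const K \<one>\<^bsub>K\<^esub>,
       ring.zero = ring.indexed_const K \<zero>\<^bsub>K\<^esub>,
       add = ring.indexed_padd K \<rparr>"

text \<open>The \<open>2 \<times> 2\<close>-minors of the matrix with rows \<open>x\<^sub>1, x\<^sub>2, x\<^sub>3\<close> and \<open>x\<^sub>4, x\<^sub>5, x\<^sub>6\<close>.\<close>

definition minors_ideal :: "('a, 'b) ring_scheme \<Rightarrow> (nat \<Rightarrow> 'a) \<Rightarrow> 'a set" where
  "minors_ideal R x = genideal R
     {x 2 \<otimes>\<^bsub>R\<^esub> x 6 \<ominus>\<^bsub>R\<^esub> x 3 \<otimes>\<^bsub>R\<^esub> x 5,
      x 1 \<otimes>\<^bsub>R\<^esub> x 6 \<ominus>\<^bsub>R\<^esub> x 3 \<otimes>\<^bsub>R\<^esub> x 4,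
      x 1 \<otimes>\<^bsub>R\<^esub> x 5 \<ominus>\<^bsub>R\<^esub> x 2 \<otimes>\<^bsub>R\<^esub> x 4}"


section \<open>Modules\<close>

definition ring_as_module :: "('a, 'b) ring_scheme \<Rightarrow> ('a, 'a) module" where
  "ring_as_module R =
     \<lparr> carrier = carrier R, monoid.mult = monoid.mult R, one = \<one>\<^bsub>R\<^esub>, ring.zero = \<zero>\<^bsub>R\<^esub>, add = add R,
       smult = monoid.mult R \<rparr>"

definition module_hom ::
  "('a, 'b) ring_scheme \<Rightarrow> ('a, 'm) module \<Rightarrow> ('a, 'n) module \<Rightarrow> ('m \<Rightarrow> 'n) set" where
  "module_hom R M N =
     {f \<in> carrier M \<rightarrow> carrier N.
        (\<forall>x\<in>carrier M. \<forall>y\<in>carrier M. f (x \<oplus>\<^bsub>M\<^esub> y) = f x \<oplus>\<^bsub>N\<^esub> f y) \<and>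
        (\<forall>a\<in>carrier R. \<forall>x\<in>carrier M. f (a \<odot>\<^bsub>M\<^esub> x) = a \<odot>\<^bsub>N\<^esub> f x)}"

text \<open>The multiplication and unit fields of a module record carry no meaning.\<close>

definition quotient_module :: "('a, 'm) module \<Rightarrow> 'm set \<Rightarrow> ('a, 'm set) module" where
  "quotient_module M N =
     \<lparr> carrier = a_rcosets\<^bsub>M\<^esub> N, monoid.mult = undefined, one = undefined, ring.zero = N,
       add = set_add M, smult = (\<lambda>a C. \<Union>x\<in>C. N +>\<^bsub>M\<^esub> (a \<odot>\<^bsub>M\<^esub> x)) \<rparr>"

definition associated_primes :: "('a, 'b) ring_scheme \<Rightarrow> ('a, 'm) module \<Rightarrow> 'a set set" where
  "associated_primes R M =
     {P. primeideal P R \<and> (\<exists>x\<in>carrier M. P = {a \<in> carrier R. a \<odot>\<^bsub>M\<^esub> x = \<zero>\<^bsub>M\<^esub>})}"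

text \<open>
  Equality of fractions in the localization \<open>M\<^sub>P\<close>; the pair \<open>(x, s)\<close> stands for \<open>x/s\<close>, and
  \<open>x/s = y/t\<close> iff \<open>u t x = u s y\<close> for some \<open>u \<notin> P\<close>.
\<close>

definition fraction_rel ::
  "('a, 'b) ring_scheme \<Rightarrow> ('a, 'm) module \<Rightarrow> 'a set \<Rightarrow> (('m \<times> 'a) \<times> ('m \<times> 'a)) set" where
  "fraction_rel R M P =
     {((x, s), (y, t)). x \<in> carrier M \<and> y \<in> carrier M \<and> s \<in> carrier R - P \<and> t \<in> carrier R - P \<and>
        (\<exists>u\<in>carrier R - P. (u \<otimes>\<^bsub>R\<^esub> t) \<odot>\<^bsub>M\<^esub> x = (u \<otimes>\<^bsub>R\<^esub> s) \<odot>\<^bsub>M\<^esub> y)}"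

definition localization ::
  "('a, 'b) ring_scheme \<Rightarrow> ('a, 'm) module \<Rightarrow> 'a set \<Rightarrow> ('m \<times> 'a) set set" where
  "localization R M P = (carrier M \<times> (carrier R - P)) // fraction_rel R M P"

definition localization_zero ::
  "('a, 'b) ring_scheme \<Rightarrow> ('a, 'm) module \<Rightarrow> 'a set \<Rightarrow> ('m \<times> 'a) set" where
  "localization_zero R M P = fraction_rel R M P `` {(\<zero>\<^bsub>M\<^esub>, \<one>\<^bsub>R\<^esub>)}"

definition module_support :: "('a, 'b) ring_scheme \<Rightarrow> ('a, 'm) module \<Rightarrow> 'a set set" where
  "module_support R M =
     {P. primeideal P R \<and> localization R M P \<noteq> {localization_zero R M P}}"


section \<open>Local cohomology\<close>

text \<open>
  HOL cannot quantify over all modules of all types, so the test modules \<open>M\<close> are those carried by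
  \<open>'a + 'm\<close>. This loses nothing: the type contains a copy of \<open>R\<close> itself, so by Baer's criterion
  a module that passes this test has the extension property for test modules of every type.
\<close>

definition injective_module :: "('a, 'b) ring_scheme \<Rightarrow> ('a, 'm) module \<Rightarrow> bool" where
  "injective_module R E \<longleftrightarrow>
     module R E \<and>
     (\<forall>(M :: ('a, 'a + 'm) module) N f.
        module R M \<and> submodule N R M \<and> f \<in> module_hom R (M\<lparr>carrier := N\<rparr>) E \<longrightarrow>
        (\<exists>g\<in>module_hom R M E. \<forall>x\<in>N. g x = f x))"

text \<open>Exactness of \<open>0 \<rightarrow> M \<rightarrow> E\<^sub>0 \<rightarrow> E\<^sub>1 \<rightarrow> \<dots>\<close> with augmentation \<open>\<epsilon>\<close>, differentials \<open>d\<close>, \<open>E\<^sub>i\<close> injective.\<close>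

definition injective_resolution ::
  "('a, 'b) ring_scheme \<Rightarrow> ('a, 'n) module \<Rightarrow> (nat \<Rightarrow> ('a, 'm) module) \<Rightarrow> (nat \<Rightarrow> 'm \<Rightarrow> 'm) \<Rightarrow>
   ('n \<Rightarrow> 'm) \<Rightarrow> bool" where
  "injective_resolution R M E d \<epsilon> \<longleftrightarrow>
     (\<forall>i. injective_module R (E i)) \<and>
     (\<forall>i. d i \<in> module_hom R (E i) (E (Suc i))) \<and>
     \<epsilon> \<in> module_hom R M (E 0) \<and>
     inj_on \<epsilon> (carrier M) \<and>
     \<epsilon> ` carrier M = a_kernel (E 0) (E 1) (d 0) \<and>
     (\<forall>i. d i ` carrier (E i) = a_kernel (E (Suc i)) (E (Suc (Suc i))) (d (Suc i)))"

text \<open>The functor \<open>\<Gamma>\<^sub>I\<close>; powers of \<open>I\<close> are taken in the monoid of ideals, so \<open>I\<^sup>0 = R\<close>.\<close>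

definition torsion_module ::
  "('a, 'b) ring_scheme \<Rightarrow> 'a set \<Rightarrow> ('a, 'm) module \<Rightarrow> ('a, 'm) module" where
  "torsion_module R I M =
     M\<lparr>carrier :=
         {x \<in> carrier M. \<exists>n::nat. \<forall>a \<in> I [^]\<^bsub>ideals_set R\<^esub> n. a \<odot>\<^bsub>M\<^esub> x = \<zero>\<^bsub>M\<^esub>}\<rparr>"

fun coboundaries :: "(nat \<Rightarrow> ('a, 'm) module) \<Rightarrow> (nat \<Rightarrow> 'm \<Rightarrow> 'm) \<Rightarrow> nat \<Rightarrow> 'm set" where
  "coboundaries C d 0 = {\<zero>\<^bsub>C 0\<^esub>}"
| "coboundaries C d (Suc j) = d j ` carrier (C j)"

definition cohomology ::
  "(nat \<Rightarrow> ('a, 'm) module) \<Rightarrow> (nat \<Rightarrow> 'm \<Rightarrow> 'm) \<Rightarrow> nat \<Rightarrow> ('a, 'm set) module" where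
  "cohomology C d j =
     quotient_module ((C j)\<lparr>carrier := a_kernel (C j) (C (Suc j)) (d j)\<rparr>) (coboundaries C d j)"

text \<open>
  The \<open>j\<close>-th right derived functor of \<open>\<Gamma>\<^sub>I\<close>, computed from the injective resolution \<open>(E, d)\<close> of
  the module in question. Up to isomorphism it does not depend on the resolution.
\<close>

definition local_cohomology ::
  "('a, 'b) ring_scheme \<Rightarrow> 'a set \<Rightarrow> (nat \<Rightarrow> ('a, 'm) module) \<Rightarrow> (nat \<Rightarrow> 'm \<Rightarrow> 'm) \<Rightarrow> nat \<Rightarrow>
   ('a, 'm set) module" where
  "local_cohomology R I E d j = cohomology (\<lambda>i. torsion_module R I (E i)) d j"

end

theory Submission
  imports Defs "HOL-Library.Multiset_Order"
begin

text \<open>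
  Let \<open>\<Delta>\<^sub>1, \<Delta>\<^sub>2, \<Delta>\<^sub>3\<close> be the minors, \<open>I\<close> the ideal they generate, \<open>q\<close> the ideal of the six entries
  and \<open>H\<close> the third local cohomology module of the ring with support in \<open>I\<close>.

  A \<open>3 \<times> 3\<close> determinant with a repeated row vanishes, so every entry multiplies one of the minors
  into the ideal of the other two (\<open>minor_relations\<close>). An ideal with two generators has no local
  cohomology in degree 3 (\<open>torsion_acyclic\<close>). Hence each element of \<open>H\<close> is killed by a power of
  each entry (\<open>killed_by_entries\<close>), and a prime in the support of \<open>H\<close>, or associated to \<open>H\<close>,
  contains \<open>q\<close>. In the power series ring \<open>q\<close> is maximal, which gives (a).

  For (b), the elements of \<open>H\<close> are the elements of the direct limit of the modules
  \<open>R/(\<Delta>\<^sub>1^N, \<Delta>\<^sub>2^N, \<Delta>\<^sub>3^N)\<close> along multiplication by \<open>\<Delta>\<^sub>1 \<Delta>\<^sub>2 \<Delta>\<^sub>3\<close> (\<open>coboundary_iff\<close>). Since \<open>R\<close>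
  is noetherian, an associated prime \<open>P\<close> of \<open>H\<close> is already the annihilator of an element of \<open>R/J\<close>
  for one \<open>J = (\<Delta>\<^sub>1^N, \<Delta>\<^sub>2^N, \<Delta>\<^sub>3^N)\<close>, and that element is killed by \<open>q\<close>.
  The generators of \<open>J\<close> are forms in the entries with integral coefficients. Because \<open>R\<close> is
  equicharacteristic, the integral multiples of 1 are zero or units, and because the entries form a
  regular sequence, \<open>R\<close> behaves like a flat algebra over the polynomial ring: solutions in \<open>R\<close> of
  a linear system with form coefficients are approximated \<open>q\<close>-adically by combinations of solutions
  in forms (\<open>graded_approximation\<close>). With Krull's intersection theorem it follows that
  \<open>(J : q)\<close> is generated by the forms it contains (\<open>socle_generated_by_forms\<close>), and that forms
  in \<open>(J : q)\<close> that are linearly independent modulo \<open>J\<close> over the integral multiples of 1 are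
  linearly independent modulo \<open>J\<close> over \<open>R/q\<close> (\<open>independent_socle_coeffs\<close>). So \<open>(J : q)/J\<close> is a
  direct sum of copies of \<open>R/q\<close>, and \<open>P\<close> is an associated prime of \<open>R/q\<close>; there are only finitely
  many of these (\<open>finite_ass_quot\<close>).

  Injectivity of the modules in the resolution enters through one statement: up to torsion, they
  are divisible by every ring element (\<open>divide_by_power\<close>).
\<close>


section \<open>Ideals of commutative rings\<close>

context cring
begin

lemma eq_by_minus: "x \<ominus> y = \<zero> \<Longrightarrow> x \<in> carrier R \<Longrightarrow> y \<in> carrier R \<Longrightarrow> x = y"
  by (metis a_minus_def add.inv_closed add.l_cancel_one add.m_comm r_neg1 minus_equality minus_minus)

lemma ideal_facts:
  assumes "ideal I R"
  shows ideal_carr: "a \<in> I \<Longrightarrow> a \<in> carrier R"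
    and ideal_zero: "\<zero> \<in> I"
    and ideal_add: "a \<in> I \<Longrightarrow> b \<in> I \<Longrightarrow> a \<oplus> b \<in> I"
    and ideal_neg: "a \<in> I \<Longrightarrow> \<ominus> a \<in> I"
    and ideal_minus: "a \<in> I \<Longrightarrow> b \<in> I \<Longrightarrow> a \<ominus> b \<in> I"
    and ideal_lmult: "a \<in> I \<Longrightarrow> r \<in> carrier R \<Longrightarrow> r \<otimes> a \<in> I"
    and ideal_rmult: "a \<in> I \<Longrightarrow> r \<in> carrier R \<Longrightarrow> a \<otimes> r \<in> I"
proof -
  interpret ideal I R by fact
  show "a \<in> I \<Longrightarrow> a \<in> carrier R" "\<zero> \<in> I" "a \<in> I \<Longrightarrow> b \<in> I \<Longrightarrow> a \<oplus> b \<in> I" "a \<in> I \<Longrightarrow> \<ominus> a \<in> I"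
    "a \<in> I \<Longrightarrow> b \<in> I \<Longrightarrow> a \<ominus> b \<in> I"
    "a \<in> I \<Longrightarrow> r \<in> carrier R \<Longrightarrow> r \<otimes> a \<in> I" "a \<in> I \<Longrightarrow> r \<in> carrier R \<Longrightarrow> a \<otimes> r \<in> I"
    by (auto simp: a_minus_def I_l_closed I_r_closed)
qed

lemma ideal_subset: "ideal I R \<Longrightarrow> I \<subseteq> carrier R"
  using ideal_carr by blast

lemma ideal_add_cancel:
  assumes "ideal I R" "a \<oplus> b \<in> I" "b \<in> I" "a \<in> carrier R" shows "a \<in> I"
proof -
  have "b \<in> carrier R" using assms ideal_carr by blast
  then have "a = (a \<oplus> b) \<ominus> b" using assms(4) by algebra
  then show ?thesis using ideal_minus[OF assms(1-3)] by simp
qed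

lemma idealI_closed:
  assumes "I \<subseteq> carrier R" "\<zero> \<in> I"
    and add: "\<And>a b. a \<in> I \<Longrightarrow> b \<in> I \<Longrightarrow> a \<oplus> b \<in> I"
    and mult: "\<And>a r. a \<in> I \<Longrightarrow> r \<in> carrier R \<Longrightarrow> r \<otimes> a \<in> I"
  shows "ideal I R"
proof (rule idealI)
  show "ring R" by (rule ring_axioms)
  have neg: "\<ominus> a \<in> I" if "a \<in> I" for a
  proof -
    have "a \<in> carrier R" using that assms(1) by auto
    then have "\<ominus> a = (\<ominus> \<one>) \<otimes> a" by algebra
    then show ?thesis using mult[OF that, of "\<ominus> \<one>"] by simp
  qed
  show "subgroup I (add_monoid R)"
    using assms(1,2) add neg by (auto intro!: add.subgroupI simp: a_inv_def)
  show "x \<otimes> a \<in> I" if "a \<in> I" "x \<in> carrier R" for a x using mult that by auto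
  then show "a \<otimes> x \<in> I" if "a \<in> I" "x \<in> carrier R" for a x
    using that m_comm[of a x] assms(1) by auto
qed

lemma Idl_mono: "A \<subseteq> B \<Longrightarrow> Idl A \<subseteq> Idl B"
  unfolding genideal_def by auto

lemma Idl_self: "A \<subseteq> carrier R \<Longrightarrow> a \<in> A \<Longrightarrow> a \<in> Idl A"
  using genideal_self by blast

lemma Idl_least: "ideal I R \<Longrightarrow> A \<subseteq> I \<Longrightarrow> Idl A \<subseteq> I"
  by (rule genideal_minimal)

lemma Idl_empty: "Idl {} = {\<zero>}"
proof
  show "Idl {} \<subseteq> {\<zero>}" by (rule Idl_least[OF zeroideal]) simp
  show "{\<zero>} \<subseteq> Idl {}" using ideal_zero[OF genideal_ideal[of "{}"]] by simp
qed

lemma ideal_insert: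
  assumes "ideal J R" "a \<in> carrier R"
  shows "ideal {s \<otimes> a \<oplus> j | s j. s \<in> carrier R \<and> j \<in> J} R" (is "ideal ?K R")
proof (rule idealI_closed)
  show "?K \<subseteq> carrier R" using assms ideal_carr by auto
  have "\<zero> = \<zero> \<otimes> a \<oplus> \<zero>" using assms by simp
  then show "\<zero> \<in> ?K" using ideal_zero[OF assms(1)] by blast
  show "u \<oplus> v \<in> ?K" if "u \<in> ?K" "v \<in> ?K" for u v
  proof -
    from that obtain s j s' j' where *: "s \<in> carrier R" "j \<in> J" "u = s \<otimes> a \<oplus> j"
      "s' \<in> carrier R" "j' \<in> J" "v = s' \<otimes> a \<oplus> j'" by auto
    then have "j \<in> carrier R" "j' \<in> carrier R" using assms ideal_carr by auto
    then have "u \<oplus> v = (s \<oplus> s') \<otimes> a \<oplus> (j \<oplus> j')" using * assms(2) by algebra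
    then show ?thesis using * ideal_add[OF assms(1)] by blast
  qed
  show "r \<otimes> u \<in> ?K" if "u \<in> ?K" "r \<in> carrier R" for u r
  proof -
    from that obtain s j where *: "s \<in> carrier R" "j \<in> J" "u = s \<otimes> a \<oplus> j" by auto
    then have "j \<in> carrier R" using assms ideal_carr by auto
    then have "r \<otimes> u = (r \<otimes> s) \<otimes> a \<oplus> (r \<otimes> j)" using * assms(2) that by algebra
    then show ?thesis using * ideal_lmult[OF assms(1)] that by blast
  qed
qed

lemma Idl_insert:
  assumes "A \<subseteq> carrier R" "a \<in> carrier R"
  shows "Idl (insert a A) = {s \<otimes> a \<oplus> j | s j. s \<in> carrier R \<and> j \<in> Idl A}" (is "_ = ?K")
proof
  have J: "ideal (Idl A) R" using assms by (simp add: genideal_ideal)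
  have "a = \<one> \<otimes> a \<oplus> \<zero>" using assms by simp
  then have "a \<in> ?K" using ideal_zero[OF J] by blast
  moreover have "A \<subseteq> ?K"
  proof
    fix b assume "b \<in> A"
    then have "b \<in> Idl A" "b = \<zero> \<otimes> a \<oplus> b" using assms Idl_self by auto
    then show "b \<in> ?K" by blast
  qed
  ultimately show "Idl (insert a A) \<subseteq> ?K"
    by (intro Idl_least ideal_insert[OF J assms(2)]) auto
  have I: "ideal (Idl (insert a A)) R" using assms by (simp add: genideal_ideal)
  have "s \<otimes> a \<in> Idl (insert a A)" if "s \<in> carrier R" for s
    using that assms Idl_self[of "insert a A" a] ideal_lmult[OF I] by auto
  then show "?K \<subseteq> Idl (insert a A)" using Idl_mono[of A "insert a A"] ideal_add[OF I] by blast
qed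

lemma Idl_singleton_iff:
  assumes "a \<in> carrier R" shows "r \<in> Idl {a} \<longleftrightarrow> (\<exists>s\<in>carrier R. r = s \<otimes> a)"
  unfolding Idl_insert[OF empty_subsetI assms] Idl_empty using assms
  by (force intro: exI[of _ "\<zero>"])

lemma ideal_colon: "ideal I R \<Longrightarrow> c \<in> carrier R \<Longrightarrow> ideal {s \<in> carrier R. s \<otimes> c \<in> I} R"
  by (rule idealI_closed)
     (auto simp: ideal_zero l_distr ideal_add m_assoc ideal_lmult)

lemma pow_diff: "a \<in> carrier R \<Longrightarrow> n \<le> m \<Longrightarrow> a [^] (m::nat) = a [^] (m - n) \<otimes> a [^] n"
  by (simp add: nat_pow_mult)

lemma ideal_pow_mono:
  assumes "ideal I R" "a \<in> carrier R" "a [^] n \<in> I" "n \<le> (m::nat)" shows "a [^] m \<in> I"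
  using pow_diff[OF assms(2,4)] ideal_lmult[OF assms(1,3)] assms(2) by simp

end

lemma noetherian_ring_maximal_ideal:
  assumes "noetherian_ring R" "\<A> \<noteq> {}" "\<And>I. I \<in> \<A> \<Longrightarrow> ideal I R"
  obtains M where "M \<in> \<A>" "\<And>Z. Z \<in> \<A> \<Longrightarrow> M \<subseteq> Z \<Longrightarrow> Z = M"
proof -
  have "\<exists>M\<in>\<A>. \<forall>Z\<in>\<A>. M \<subseteq> Z \<longrightarrow> Z = M"
  proof (rule subset_Zorn_nonempty[OF assms(2)])
  fix \<C> assume C: "\<C> \<noteq> {}" "subset.chain \<A> \<C>"
  then have "subset.chain {I. ideal I R} \<C>"
    using assms(3) unfolding subset.chain_def by auto
  then have "\<Union>\<C> \<in> \<C>" using noetherian_ring.ideal_chain_is_trivial[OF assms(1) C(1)] by auto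
  then show "\<Union>\<C> \<in> \<A>" using C(2) unfolding subset.chain_def by auto
  qed
  then show ?thesis using that by blast
qed

lemma noetherian_ring_chain_stable:
  assumes "noetherian_ring R" "\<And>n::nat. ideal (K n) R" "\<And>n. K n \<subseteq> K (Suc n)"
  shows "\<exists>N. \<forall>n\<ge>N. K n = K N"
proof -
  obtain M where M: "M \<in> range K" "\<And>Z. Z \<in> range K \<Longrightarrow> M \<subseteq> Z \<Longrightarrow> Z = M"
    by (rule noetherian_ring_maximal_ideal[OF assms(1), of "range K"]) (use assms(2) in auto)
  obtain N where N: "M = K N" using M by auto
  have "K N \<subseteq> K n" if "N \<le> n" for n
    by (rule lift_Suc_mono_le[of K, OF assms(3) that])
  then have "K n = K N" if "N \<le> n" for n using M(2)[of "K n"] N that by auto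
  then show ?thesis by blast
qed

locale noeth_cring = cring R + noetherian_ring R for R (structure)
begin

lemmas maximal_ideal_exists = noetherian_ring_maximal_ideal[OF noetherian_ring_axioms]
lemmas chain_stable = noetherian_ring_chain_stable[OF noetherian_ring_axioms]

text \<open>
  The ideals \<open>I : c^n\<close> ascend with \<open>n\<close>. Divisibility of injective modules up to torsion rests on this.
\<close>

lemma colon_power_stable:
  assumes I: "ideal I R" and c: "c \<in> carrier R"
  shows "\<exists>N. \<forall>n s. s \<in> carrier R \<longrightarrow> s \<otimes> c [^] (N + n :: nat) \<in> I \<longrightarrow> s \<otimes> c [^] N \<in> I"
proof -
  define K where "K n = {s \<in> carrier R. s \<otimes> c [^] n \<in> I}" for n :: nat
  have "ideal (K n) R" for n unfolding K_def using I c by (intro ideal_colon) auto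
  moreover have "K n \<subseteq> K (Suc n)" for n
    unfolding K_def using ideal_rmult[OF I _ c] c by (auto simp flip: m_assoc)
  ultimately obtain N where "\<forall>n\<ge>N. K n = K N" using chain_stable by meson
  then have "K (N + n) = K N" for n using le_add1 by blast
  then show ?thesis unfolding K_def by blast
qed

text \<open>
  The associated primes of the module \<open>R/q\<close>, expressed without forming the quotient.
\<close>

definition ass_quot :: "'a set \<Rightarrow> 'a set set" where
  "ass_quot q = {P. primeideal P R \<and> (\<exists>c\<in>carrier R. P = {p \<in> carrier R. p \<otimes> c \<in> q})}"

text \<open>
  The submodule of \<open>R/q\<close> generated by \<open>c\<close> is a copy of \<open>R/P\<close>, in which all nonzero elements have
  annihilator \<open>P\<close>. So if some multiple of \<open>c'\<close> is nonzero and lies in this submodule, then the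
  annihilator of \<open>c'\<close> is \<open>P\<close>; otherwise it does not change when \<open>c\<close> is added to \<open>q\<close>.
\<close>

lemma ass_quot_insert:
  assumes q: "ideal q R" and c: "c \<in> carrier R" and P: "primeideal P R" "P = {p \<in> carrier R. p \<otimes> c \<in> q}"
  shows "ass_quot q \<subseteq> insert P (ass_quot (Idl (insert c q)))"
proof
  fix P' assume "P' \<in> ass_quot q"
  then obtain c' where P': "primeideal P' R" and c': "c' \<in> carrier R"
    and eq: "P' = {p \<in> carrier R. p \<otimes> c' \<in> q}" unfolding ass_quot_def by auto
  have Iq: "Idl q = q" using q Idl_least[OF q] Idl_self[of q] ideal_subset[OF q] by blast
  have Ii: "Idl (insert c q) = {s \<otimes> c \<oplus> j |s j. s \<in> carrier R \<and> j \<in> q}"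
    using Idl_insert[OF ideal_subset[OF q] c] unfolding Iq .
  show "P' \<in> insert P (ass_quot (Idl (insert c q)))"
  proof (cases "\<exists>s\<in>carrier R. s \<notin> P' \<and> s \<otimes> c' \<in> Idl (insert c q)")
    case False
    have "q \<subseteq> Idl (insert c q)" using Idl_self[of "insert c q"] c ideal_subset[OF q] by blast
    then have "P' = {p \<in> carrier R. p \<otimes> c' \<in> Idl (insert c q)}"
      using False eq by blast
    then show ?thesis using P' c' unfolding ass_quot_def by blast
  next
    case True
    then obtain s u y where s: "s \<in> carrier R" "s \<notin> P'" and u: "u \<in> carrier R" and y: "y \<in> q"
      and e: "s \<otimes> c' = u \<otimes> c \<oplus> y" unfolding Ii by auto
    have yc: "y \<in> carrier R" using y q ideal_carr by blast
    have iff: "p \<otimes> (s \<otimes> c') \<in> q \<longleftrightarrow> p \<otimes> (u \<otimes> c) \<in> q" if p: "p \<in> carrier R" for p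
    proof -
      have "p \<otimes> (s \<otimes> c') = p \<otimes> (u \<otimes> c) \<oplus> p \<otimes> y" using p s u c c' yc e by algebra
      moreover have "p \<otimes> y \<in> q" using q y p ideal_lmult by blast
      ultimately show ?thesis using ideal_add_cancel[OF q, of "p \<otimes> (u \<otimes> c)" "p \<otimes> y"]
        ideal_add[OF q] p u c by auto
    qed
    have mem': "p \<in> P' \<longleftrightarrow> p \<otimes> (s \<otimes> c') \<in> q" if p: "p \<in> carrier R" for p
    proof -
      have "p \<otimes> (s \<otimes> c') \<in> q \<longleftrightarrow> p \<otimes> s \<in> P'" using eq p s c' by (auto simp: m_assoc)
      also have "\<dots> \<longleftrightarrow> p \<in> P'"
        using primeideal.I_prime[OF P' p s(1)] s(2) P' p s(1) ideal_rmult[of P' p s]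
          primeideal.axioms(1)[OF P'] by blast
      finally show ?thesis by simp
    qed
    have "u \<notin> P"
    proof
      assume "u \<in> P"
      then have "\<one> \<otimes> (u \<otimes> c) \<in> q" using P u c by auto
      then have "\<one> \<in> P'" using iff mem' by simp
      then show False
        using primeideal.I_notcarr[OF P'] ideal.one_imp_carrier[OF primeideal.axioms(1)[OF P']] by simp
    qed
    have mem: "p \<in> P \<longleftrightarrow> p \<otimes> (u \<otimes> c) \<in> q" if p: "p \<in> carrier R" for p
    proof -
      have "p \<otimes> (u \<otimes> c) \<in> q \<longleftrightarrow> p \<otimes> u \<in> P" using P p u c by (auto simp: m_assoc)
      also have "\<dots> \<longleftrightarrow> p \<in> P"
        using primeideal.I_prime[OF P(1) p u] \<open>u \<notin> P\<close> P p u ideal_rmult[of P p u]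
          primeideal.axioms(1)[OF P(1)] by blast
      finally show ?thesis by simp
    qed
    have "P \<subseteq> carrier R" "P' \<subseteq> carrier R" using P(2) eq by auto
    then have "P' = P" using mem mem' iff by blast
    then show ?thesis by simp
  qed
qed

lemma finite_ass_quot:
  assumes "ideal q R" shows "finite (ass_quot q)"
proof (rule ccontr)
  define \<A> where "\<A> = {q. ideal q R \<and> infinite (ass_quot q)}"
  assume "infinite (ass_quot q)"
  then have "\<A> \<noteq> {}" using assms unfolding \<A>_def by auto
  then obtain M where M: "M \<in> \<A>" "\<And>Z. Z \<in> \<A> \<Longrightarrow> M \<subseteq> Z \<Longrightarrow> Z = M"
    by (rule maximal_ideal_exists) (simp add: \<A>_def, blast)
  have I: "ideal M R" and inf: "infinite (ass_quot M)" using M unfolding \<A>_def by auto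
  obtain P where "P \<in> ass_quot M" using inf by fastforce
  then obtain c where P: "primeideal P R" "c \<in> carrier R" "P = {p \<in> carrier R. p \<otimes> c \<in> M}"
    unfolding ass_quot_def by auto
  have "c \<notin> M"
  proof
    assume "c \<in> M"
    then have "\<one> \<in> P" using P by auto
    then show False
      using primeideal.I_notcarr[OF P(1)] ideal.one_imp_carrier[OF primeideal.axioms(1)[OF P(1)]] by simp
  qed
  moreover have sub: "insert c M \<subseteq> Idl (insert c M)"
    using genideal_self[of "insert c M"] ideal_subset[OF I] P(2) by blast
  ultimately have "Idl (insert c M) \<noteq> M" by blast
  moreover have "ideal (Idl (insert c M)) R" using ideal_subset[OF I] P(2) by (simp add: genideal_ideal)
  ultimately have "finite (ass_quot (Idl (insert c M)))"
    using M(2) sub unfolding \<A>_def by blast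
  then show False using ass_quot_insert[OF I P(2,1,3)] inf finite_subset by blast
qed

lemma proper_ideal_in_maximal:
  assumes "ideal J R" "J \<noteq> carrier R"
  shows "\<exists>M. maximalideal M R \<and> J \<subseteq> M"
proof -
  define \<A> where "\<A> = {I. ideal I R \<and> J \<subseteq> I \<and> I \<noteq> carrier R}"
  have "\<A> \<noteq> {}" using assms unfolding \<A>_def by auto
  then obtain M where M: "M \<in> \<A>" "\<And>Z. Z \<in> \<A> \<Longrightarrow> M \<subseteq> Z \<Longrightarrow> Z = M"
    by (rule maximal_ideal_exists) (simp add: \<A>_def, blast)
  have "maximalideal M R"
  proof (rule maximalidealI)
    show "ideal M R" "carrier R \<noteq> M" using M(1) unfolding \<A>_def by auto
    show "Z = M \<or> Z = carrier R" if "ideal Z R" "M \<subseteq> Z" for Z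
      using M(1) M(2)[of Z] that unfolding \<A>_def by blast
  qed
  then show ?thesis using M unfolding \<A>_def by auto
qed

end

section \<open>Local rings: Nakayama and Krull\<close>

locale local_noeth = noeth_cring R for R (structure) +
  fixes \<mm> :: "'a set"
  assumes max_iff: "maximalideal J R \<longleftrightarrow> J = \<mm>"
begin

lemma max_m: "maximalideal \<mm> R" by (simp add: max_iff)
lemma ideal_m: "ideal \<mm> R" using max_m maximalideal.axioms(1) by blast

lemma proper_ideal_le_m: "ideal J R \<Longrightarrow> J \<noteq> carrier R \<Longrightarrow> J \<subseteq> \<mm>"
  using proper_ideal_in_maximal max_iff by blast

lemma one_notin_m: "\<one> \<notin> \<mm>"
  using max_m maximalideal.I_notcarr ideal.one_imp_carrier[OF ideal_m] by blast

lemma unit_if_notin_m: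
  assumes "u \<in> carrier R" "u \<notin> \<mm>" shows "u \<in> Units R"
proof (rule ccontr)
  assume "u \<notin> Units R"
  then have "PIdl u \<noteq> carrier R" using ideal_eq_carrier_iff[OF assms(1)] by auto
  then have "PIdl u \<subseteq> \<mm>" using proper_ideal_le_m cgenideal_ideal[OF assms(1)] by blast
  then show False using cgenideal_self[OF assms(1)] assms by blast
qed

lemma one_minus_unit:
  assumes "y \<in> \<mm>" shows "\<one> \<ominus> y \<in> Units R"
proof (rule unit_if_notin_m)
  have y: "y \<in> carrier R" using assms ideal_m ideal_carr by blast
  then show "\<one> \<ominus> y \<in> carrier R" by simp
  show "\<one> \<ominus> y \<notin> \<mm>"
  proof
    assume "\<one> \<ominus> y \<in> \<mm>"
    then have "(\<one> \<ominus> y) \<oplus> y \<in> \<mm>" using assms ideal_m ideal_add by blast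
    moreover have "(\<one> \<ominus> y) \<oplus> y = \<one>" using y by algebra
    ultimately show False using one_notin_m by simp
  qed
qed

text \<open>
  If \<open>N \<noteq> L\<close>, an ideal \<open>M\<close> with \<open>L \<subseteq> M \<subset> N\<close> that is maximal among these satisfies
  \<open>N = M + R v\<close> for any \<open>v\<close> in \<open>N\<close> outside \<open>M\<close>. The hypothesis then puts \<open>(1 - \<mu>) v\<close> into \<open>M\<close> for
  some \<open>\<mu>\<close> in the maximal ideal, and \<open>1 - \<mu>\<close> is a unit.
\<close>

lemma nakayama:
  assumes N: "ideal N R" and L: "ideal L R" and LN: "L \<subseteq> N"
    and sub: "N \<subseteq> Idl (L \<union> {y \<otimes> n | y n. y \<in> \<mm> \<and> n \<in> N})"
  shows "N = L"
proof (rule ccontr)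
  assume "N \<noteq> L"
  define \<A> where "\<A> = {I. ideal I R \<and> L \<subseteq> I \<and> I \<subset> N}"
  have "\<A> \<noteq> {}" using L LN \<open>N \<noteq> L\<close> unfolding \<A>_def by auto
  then obtain M where M: "M \<in> \<A>" "\<And>Z. Z \<in> \<A> \<Longrightarrow> M \<subseteq> Z \<Longrightarrow> Z = M"
    by (rule maximal_ideal_exists) (simp add: \<A>_def, blast)
  have Mi: "ideal M R" "L \<subseteq> M" "M \<subset> N" using M unfolding \<A>_def by auto
  obtain v where v: "v \<in> N" "v \<notin> M" using Mi by auto
  have vc: "v \<in> carrier R" using v N ideal_carr by blast
  have Mc: "M \<subseteq> carrier R" using ideal_subset Mi by blast
  have IM: "Idl M = M" using Mi Idl_least[OF Mi(1)] Idl_self[OF Mc] by blast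
  have vM: "insert v M \<subseteq> Idl (insert v M)" using genideal_self[of "insert v M"] vc Mc by blast
  have "Idl (insert v M) \<subseteq> N" using N v Mi by (intro Idl_least) auto
  moreover have "ideal (Idl (insert v M)) R" using vc Mc by (simp add: genideal_ideal)
  ultimately have NM: "N = Idl (insert v M)"
    using M(2) vM v Mi(2) unfolding \<A>_def by blast
  define W where "W = {\<mu> \<otimes> v \<oplus> l | \<mu> l. \<mu> \<in> \<mm> \<and> l \<in> M}"
  have W: "ideal W R"
  proof (rule idealI_closed)
    show "W \<subseteq> carrier R" unfolding W_def using ideal_carr[OF ideal_m] Mc vc by auto
    have "\<zero> = \<zero> \<otimes> v \<oplus> \<zero>" using vc by simp
    then show "\<zero> \<in> W" unfolding W_def using ideal_zero[OF ideal_m] ideal_zero[OF Mi(1)] by blast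
    show "a \<oplus> b \<in> W" if ab: "a \<in> W" "b \<in> W" for a b
    proof -
      from ab obtain s j s' j' where *: "s \<in> \<mm>" "j \<in> M" "a = s \<otimes> v \<oplus> j"
        "s' \<in> \<mm>" "j' \<in> M" "b = s' \<otimes> v \<oplus> j'" unfolding W_def by auto
      have c: "s \<in> carrier R" "s' \<in> carrier R" "j \<in> carrier R" "j' \<in> carrier R"
        using * ideal_carr[OF ideal_m] Mc by auto
      have "a \<oplus> b = (s \<oplus> s') \<otimes> v \<oplus> (j \<oplus> j')" using * c vc by algebra
      then show ?thesis unfolding W_def using * ideal_add[OF ideal_m] ideal_add[OF Mi(1)] by blast
    qed
    show "r \<otimes> a \<in> W" if ar: "a \<in> W" "r \<in> carrier R" for a r
    proof -
      from ar obtain s j where *: "s \<in> \<mm>" "j \<in> M" "a = s \<otimes> v \<oplus> j" unfolding W_def by auto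
      have c: "s \<in> carrier R" "j \<in> carrier R" using * ideal_carr[OF ideal_m] Mc by auto
      have "r \<otimes> a = (r \<otimes> s) \<otimes> v \<oplus> (r \<otimes> j)" using * c vc ar by algebra
      then show ?thesis unfolding W_def using * ar ideal_lmult[OF ideal_m] ideal_lmult[OF Mi(1)] by blast
    qed
  qed
  have MW: "M \<subseteq> W"
  proof
    fix l assume l: "l \<in> M"
    then have "l = \<zero> \<otimes> v \<oplus> l" using vc Mc by auto
    then show "l \<in> W" unfolding W_def using ideal_zero[OF ideal_m] l by blast
  qed
  have "{y \<otimes> n | y n. y \<in> \<mm> \<and> n \<in> N} \<subseteq> W"
  proof
    fix w assume "w \<in> {y \<otimes> n | y n. y \<in> \<mm> \<and> n \<in> N}"
    then obtain y s l where *: "y \<in> \<mm>" "s \<in> carrier R" "l \<in> M" "w = y \<otimes> (s \<otimes> v \<oplus> l)"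
      unfolding NM Idl_insert[OF Mc vc] IM by auto
    have c: "y \<in> carrier R" "l \<in> carrier R" using * ideal_carr[OF ideal_m] Mc by auto
    have "w = (y \<otimes> s) \<otimes> v \<oplus> (y \<otimes> l)" using * c vc by algebra
    then show "w \<in> W" unfolding W_def using * c ideal_rmult[OF ideal_m] ideal_lmult[OF Mi(1)] by blast
  qed
  then have "N \<subseteq> W" using sub Idl_least[OF W] MW Mi(2) by blast
  then obtain \<mu> l where *: "\<mu> \<in> \<mm>" "l \<in> M" "v = \<mu> \<otimes> v \<oplus> l" using v unfolding W_def by blast
  have c: "\<mu> \<in> carrier R" "l \<in> carrier R" using * ideal_carr[OF ideal_m] Mc by auto
  have u: "\<one> \<ominus> \<mu> \<in> Units R" using one_minus_unit[OF *(1)] .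
  have "(\<one> \<ominus> \<mu>) \<otimes> v = v \<ominus> \<mu> \<otimes> v" using c vc by algebra
  also have "\<dots> = (\<mu> \<otimes> v \<oplus> l) \<ominus> \<mu> \<otimes> v" using *(3) by simp
  also have "\<dots> = l" using c vc by algebra
  finally have "(\<one> \<ominus> \<mu>) \<otimes> v \<in> M" using * by simp
  then have "inv (\<one> \<ominus> \<mu>) \<otimes> ((\<one> \<ominus> \<mu>) \<otimes> v) \<in> M" using ideal_lmult[OF Mi(1)] u by blast
  then have "v \<in> M" using u vc c by (simp add: m_assoc[symmetric])
  then show False using v by simp
qed

text \<open>
  Put \<open>B = L + \<mm> N\<close> and let \<open>K \<supseteq> B\<close> be maximal with \<open>K \<inter> N \<subseteq> B\<close>. For \<open>y\<close> in \<open>Y\<close> the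
  ideals \<open>K : y^i\<close> stabilise at some \<open>i\<close>, and then \<open>K + y^i R\<close> still meets \<open>N\<close> inside \<open>B\<close>, because
  \<open>y N \<subseteq> B\<close>. By maximality \<open>y^i\<close> is in \<open>K\<close>. So \<open>K\<close> contains high powers of all of \<open>Y\<close>, hence \<open>N\<close>,
  which gives \<open>N = B\<close>, and Nakayama's lemma applies.
\<close>

lemma krull_intersection:
  assumes N: "ideal N R" and L: "ideal L R" and LN: "L \<subseteq> N"
    and Y: "finite Y" "Y \<subseteq> \<mm>"
    and sub: "\<And>n::nat. N \<subseteq> Idl (L \<union> (\<lambda>y. y [^] n) ` Y)"
  shows "N = L"
proof (rule nakayama[OF N L LN])
  define B where "B = Idl (L \<union> {y \<otimes> n | y n. y \<in> \<mm> \<and> n \<in> N})"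
  have gc: "L \<union> {y \<otimes> n | y n. y \<in> \<mm> \<and> n \<in> N} \<subseteq> N"
    using LN ideal_lmult[OF N] ideal_carr[OF ideal_m] by blast
  have Bi: "ideal B R" unfolding B_def by (rule genideal_ideal) (use gc ideal_subset[OF N] in blast)
  have BN: "B \<subseteq> N" unfolding B_def by (rule Idl_least[OF N gc])
  have LB: "L \<subseteq> B" and mB: "\<And>y n. y \<in> \<mm> \<Longrightarrow> n \<in> N \<Longrightarrow> y \<otimes> n \<in> B"
    using genideal_self[of "L \<union> {y \<otimes> n | y n. y \<in> \<mm> \<and> n \<in> N}"] gc ideal_subset[OF N]
    unfolding B_def by blast+
  define \<A> where "\<A> = {K. ideal K R \<and> B \<subseteq> K \<and> K \<inter> N \<subseteq> B}"
  have "\<A> \<noteq> {}" using Bi unfolding \<A>_def by auto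
  then obtain K where K: "K \<in> \<A>" "\<And>Z. Z \<in> \<A> \<Longrightarrow> K \<subseteq> Z \<Longrightarrow> Z = K"
    by (rule maximal_ideal_exists) (simp add: \<A>_def, blast)
  have Ki: "ideal K R" "B \<subseteq> K" "K \<inter> N \<subseteq> B" using K unfolding \<A>_def by auto
  have Kc: "K \<subseteq> carrier R" using ideal_subset Ki by blast
  have IK: "Idl K = K" using Ki Idl_least[OF Ki(1)] Idl_self[OF Kc] by blast
  have pow: "\<exists>i::nat. y [^] i \<in> K" if y: "y \<in> Y" for y
  proof -
    have ym: "y \<in> \<mm>" and yc: "y \<in> carrier R" using y Y ideal_carr[OF ideal_m] by auto
    obtain i where i: "\<And>n s. s \<in> carrier R \<Longrightarrow> s \<otimes> y [^] (i + n :: nat) \<in> K \<Longrightarrow> s \<otimes> y [^] i \<in> K"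
      using colon_power_stable[OF Ki(1) yc] by blast
    have pc: "y [^] i \<in> carrier R" using yc by simp
    define Z where "Z = Idl (insert (y [^] i) K)"
    have Xi: "ideal Z R" unfolding Z_def using pc Kc by (intro genideal_ideal) auto
    have KX: "insert (y [^] i) K \<subseteq> Z" unfolding Z_def by (rule genideal_self) (use pc Kc in blast)
    have "Z \<inter> N \<subseteq> B"
    proof
      fix v assume v: "v \<in> Z \<inter> N"
      then obtain s k where *: "s \<in> carrier R" "k \<in> K" "v = s \<otimes> y [^] i \<oplus> k"
        unfolding Z_def Idl_insert[OF Kc pc] IK by auto
      have kc: "k \<in> carrier R" using * Kc by auto
      have "y \<otimes> v \<in> K" using mB[OF ym] v Ki by blast
      moreover have "y \<otimes> v = s \<otimes> y [^] (i + 1) \<oplus> y \<otimes> k"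
        using * kc yc by (simp add: r_distr m_ac)
      moreover have "y \<otimes> k \<in> K" using ideal_lmult[OF Ki(1)] * yc by blast
      ultimately have "s \<otimes> y [^] (i + 1) \<in> K"
        using ideal_add_cancel[OF Ki(1)] * yc by simp
      then have "s \<otimes> y [^] i \<in> K" using i *(1) by blast
      then have "v \<in> K" using ideal_add[OF Ki(1)] * by simp
      then show "v \<in> B" using v Ki by blast
    qed
    then have "Z \<in> \<A>" using Xi KX Ki unfolding \<A>_def by auto
    then show ?thesis using K(2) KX by auto
  qed
  then obtain e :: "'a \<Rightarrow> nat" where e: "\<And>y. y \<in> Y \<Longrightarrow> y [^] e y \<in> K" by metis
  have "y [^] (Max (e ` Y)) \<in> K" if "y \<in> Y" for y
    using that e[OF that] ideal_pow_mono[OF Ki(1), of y "e y"] Y ideal_carr[OF ideal_m] by auto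
  then have "L \<union> (\<lambda>y. y [^] (Max (e ` Y))) ` Y \<subseteq> K" using LB Ki(2) by blast
  then have "N \<subseteq> K" using sub[of "Max (e ` Y)"] Idl_least[OF Ki(1)] order_trans by metis
  then have "N \<subseteq> B" using Ki(3) by blast
  then show "N \<subseteq> Idl (L \<union> {y \<otimes> n | y n. y \<in> \<mm> \<and> n \<in> N})" unfolding B_def .
qed

end


section \<open>Injective modules\<close>

text \<open>
  The left summand of the carrier type holds a copy of \<open>R\<close>, which is the test module here; the
  extension of \<open>f\<close> to it is multiplication by the image of 1.
\<close>

lemma injective_module_ideal_extension:
  fixes R :: "('a, 'b) ring_scheme" and M :: "('a, 'm) module"
  assumes inj: "injective_module R M" and K: "ideal K R"
    and f: "\<And>k. k \<in> K \<Longrightarrow> f k \<in> carrier M"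
    and f_add: "\<And>k l. k \<in> K \<Longrightarrow> l \<in> K \<Longrightarrow> f (k \<oplus>\<^bsub>R\<^esub> l) = f k \<oplus>\<^bsub>M\<^esub> f l"
    and f_smult: "\<And>r k. r \<in> carrier R \<Longrightarrow> k \<in> K \<Longrightarrow> f (r \<otimes>\<^bsub>R\<^esub> k) = r \<odot>\<^bsub>M\<^esub> f k"
  shows "\<exists>v\<in>carrier M. \<forall>k\<in>K. f k = k \<odot>\<^bsub>M\<^esub> v"
proof -
  interpret module R M using inj unfolding injective_module_def by simp
  define T :: "('a, 'a + 'm) module" where
    "T = \<lparr> carrier = Inl ` carrier R, monoid.mult = undefined, one = undefined, ring.zero = Inl \<zero>\<^bsub>R\<^esub>,
       add = (\<lambda>u v. Inl (projl u \<oplus>\<^bsub>R\<^esub> projl v)), smult = (\<lambda>a u. Inl (a \<otimes>\<^bsub>R\<^esub> projl u)) \<rparr>"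
  have T: "carrier T = Inl ` carrier R" "\<zero>\<^bsub>T\<^esub> = Inl \<zero>\<^bsub>R\<^esub>"
    "\<And>u v. u \<oplus>\<^bsub>T\<^esub> v = Inl (projl u \<oplus>\<^bsub>R\<^esub> projl v)" "\<And>a u. a \<odot>\<^bsub>T\<^esub> u = Inl (a \<otimes>\<^bsub>R\<^esub> projl u)"
    unfolding T_def by simp_all
  have modT: "module R T"
  proof (rule moduleI)
    show "abelian_group T"
    proof (rule abelian_groupI)
      show "\<exists>y\<in>carrier T. y \<oplus>\<^bsub>T\<^esub> x = \<zero>\<^bsub>T\<^esub>" if "x \<in> carrier T" for x
        using that R.l_neg by (auto simp: T)
    qed (auto simp: T R.add.m_ac)
  qed (auto simp: T R.l_distr R.r_distr R.m_assoc R.is_cring)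
  interpret T: module R T by (rule modT)
  have sub: "submodule (Inl ` K) R T"
  proof (rule T.submoduleI)
    have neg: "\<ominus>\<^bsub>T\<^esub> Inl k = Inl (\<ominus>\<^bsub>R\<^esub> k)" if "k \<in> carrier R" for k
      using that R.l_neg by (intro T.minus_equality) (auto simp: T)
    show "\<ominus>\<^bsub>T\<^esub> a \<in> Inl ` K" if "a \<in> Inl ` K" for a
      using that neg R.ideal_neg[OF K] R.ideal_carr[OF K] by auto
  qed (use R.ideal_carr[OF K] R.ideal_zero[OF K] R.ideal_add[OF K] R.ideal_lmult[OF K] in \<open>auto simp: T\<close>)
  have "(\<lambda>u. f (projl u)) \<in> module_hom R (T\<lparr>carrier := Inl ` K\<rparr>) M"
    unfolding module_hom_def using f f_add f_smult by (auto simp: T)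
  then obtain g where g: "g \<in> module_hom R T M" "\<forall>x\<in>Inl ` K. g x = f (projl x)"
    using inj modT sub unfolding injective_module_def by blast
  have "Inl \<one>\<^bsub>R\<^esub> \<in> carrier T" by (simp add: T)
  have "f k = k \<odot>\<^bsub>M\<^esub> g (Inl \<one>\<^bsub>R\<^esub>)" if k: "k \<in> K" for k
  proof -
    have kc: "k \<in> carrier R" using k R.ideal_carr[OF K] by simp
    have "f k = g (Inl k)" using g(2) k by auto
    also have "Inl k = k \<odot>\<^bsub>T\<^esub> Inl \<one>\<^bsub>R\<^esub>" using kc by (simp add: T)
    also have "g \<dots> = k \<odot>\<^bsub>M\<^esub> g (Inl \<one>\<^bsub>R\<^esub>)"
      using g(1) kc T.smult_closed[of k] \<open>Inl \<one>\<^bsub>R\<^esub> \<in> carrier T\<close> unfolding module_hom_def by blast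
    finally show ?thesis .
  qed
  moreover have "g (Inl \<one>\<^bsub>R\<^esub>) \<in> carrier M" using g(1) unfolding module_hom_def by (auto simp: T)
  ultimately show ?thesis by blast
qed

context module
begin

lemma smult_minus: "a \<in> carrier R \<Longrightarrow> x \<in> carrier M \<Longrightarrow> y \<in> carrier M \<Longrightarrow>
    a \<odot>\<^bsub>M\<^esub> (x \<ominus>\<^bsub>M\<^esub> y) = a \<odot>\<^bsub>M\<^esub> x \<ominus>\<^bsub>M\<^esub> a \<odot>\<^bsub>M\<^esub> y"
  by (simp add: M.minus_eq smult_r_distr smult_r_minus)

lemma annihilator_ideal: "x \<in> carrier M \<Longrightarrow> ideal {r \<in> carrier R. r \<odot>\<^bsub>M\<^esub> x = \<zero>\<^bsub>M\<^esub>} R"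
  by (rule R.idealI_closed) (auto simp: smult_l_distr smult_assoc1)

lemma smult_diff_zero:
  assumes "a \<in> carrier R" "b \<in> carrier R" "x \<in> carrier M" "(a \<ominus>\<^bsub>R\<^esub> b) \<odot>\<^bsub>M\<^esub> x = \<zero>\<^bsub>M\<^esub>"
  shows "a \<odot>\<^bsub>M\<^esub> x = b \<odot>\<^bsub>M\<^esub> x"
proof -
  have "a = (a \<ominus>\<^bsub>R\<^esub> b) \<oplus>\<^bsub>R\<^esub> b" using assms by algebra
  then have "a \<odot>\<^bsub>M\<^esub> x = (a \<ominus>\<^bsub>R\<^esub> b) \<odot>\<^bsub>M\<^esub> x \<oplus>\<^bsub>M\<^esub> b \<odot>\<^bsub>M\<^esub> x"
    using assms smult_l_distr[of "a \<ominus>\<^bsub>R\<^esub> b" b x] by simp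
  then show ?thesis using assms by simp
qed

lemma smult_pow_pow: "a \<in> carrier R \<Longrightarrow> x \<in> carrier M \<Longrightarrow>
    a [^]\<^bsub>R\<^esub> (n::nat) \<odot>\<^bsub>M\<^esub> (a [^]\<^bsub>R\<^esub> (m::nat) \<odot>\<^bsub>M\<^esub> x) = a [^]\<^bsub>R\<^esub> (n + m) \<odot>\<^bsub>M\<^esub> x"
  by (simp add: smult_assoc1[symmetric] R.nat_pow_mult)

lemma pow_smult_zero_mono:
  "a \<in> carrier R \<Longrightarrow> x \<in> carrier M \<Longrightarrow> a [^]\<^bsub>R\<^esub> (n::nat) \<odot>\<^bsub>M\<^esub> x = \<zero>\<^bsub>M\<^esub> \<Longrightarrow> n \<le> m \<Longrightarrow>
    a [^]\<^bsub>R\<^esub> m \<odot>\<^bsub>M\<^esub> x = \<zero>\<^bsub>M\<^esub>"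
  using smult_pow_pow[of a x "m - n" n] by simp

end

section \<open>Powers of generators\<close>

context cring
begin

definition power_ideal :: "'a list \<Rightarrow> nat \<Rightarrow> 'a set" where
  "power_ideal as m = Idl ((\<lambda>a. a [^] m) ` set as)"

lemma ideal_power_ideal: "set as \<subseteq> carrier R \<Longrightarrow> ideal (power_ideal as m) R"
  unfolding power_ideal_def by (rule genideal_ideal) auto

lemma power_ideal_Nil: "power_ideal [] m = {\<zero>}"
  unfolding power_ideal_def by (simp add: Idl_empty)

lemma power_ideal_Cons:
  assumes "set as \<subseteq> carrier R" "c \<in> carrier R"
  shows "power_ideal (c # as) m = {s \<otimes> c [^] m \<oplus> j | s j. s \<in> carrier R \<and> j \<in> power_ideal as m}"
  unfolding power_ideal_def list.set image_insert by (rule Idl_insert) (use assms in auto)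

definition prodl :: "'a list \<Rightarrow> 'a" where
  "prodl as = foldr (\<otimes>) as \<one>"

lemma prodl_simps [simp]: "prodl [] = \<one>" "prodl (c # as) = c \<otimes> prodl as"
  by (simp_all add: prodl_def)

lemma prodl_closed [simp]: "set as \<subseteq> carrier R \<Longrightarrow> prodl as \<in> carrier R"
  by (induction as) auto

text \<open>
  Multiplication by the product of the list is the transition map of the direct system
  \<open>R/(a^m : a \<in> as)\<close>, whose limit is the top local cohomology of \<open>R\<close>.
\<close>

lemma power_ideal_shift:
  assumes "set as \<subseteq> carrier R" "j \<in> power_ideal as m"
  shows "j \<otimes> prodl as [^] k \<in> power_ideal as (m + k)"
  using assms
proof (induction as arbitrary: j)
  case Nil
  then show ?case by (simp add: power_ideal_Nil)
next
  case (Cons c as)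
  then have c: "c \<in> carrier R" "set as \<subseteq> carrier R" by auto
  obtain s j' where j: "s \<in> carrier R" "j' \<in> power_ideal as m" "j = s \<otimes> c [^] m \<oplus> j'"
    using Cons.prems unfolding power_ideal_Cons[OF c(2,1)] by auto
  have j'c: "j' \<in> carrier R" using j ideal_power_ideal[OF c(2)] ideal_carr by blast
  define p where "p = prodl as [^] k"
  have p: "p \<in> carrier R" unfolding p_def using c by simp
  have "j \<otimes> prodl (c # as) [^] k = (s \<otimes> c [^] m \<oplus> j') \<otimes> (c [^] k \<otimes> p)"
    using j c by (simp add: pow_mult_distrib m_comm p_def)
  also have "\<dots> = (s \<otimes> p) \<otimes> (c [^] m \<otimes> c [^] k) \<oplus> c [^] k \<otimes> (j' \<otimes> p)"
    using j(1) j'c p nat_pow_closed[OF c(1), of m] nat_pow_closed[OF c(1), of k] by algebra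
  also have "\<dots> = (s \<otimes> p) \<otimes> c [^] (m + k) \<oplus> c [^] k \<otimes> (j' \<otimes> p)"
    using c by (simp add: nat_pow_mult)
  finally have e: "j \<otimes> prodl (c # as) [^] k = (s \<otimes> p) \<otimes> c [^] (m + k) \<oplus> c [^] k \<otimes> (j' \<otimes> p)" .
  have "j' \<otimes> p \<in> power_ideal as (m + k)" unfolding p_def using Cons.IH c j by blast
  then have "c [^] k \<otimes> (j' \<otimes> p) \<in> power_ideal as (m + k)"
    using ideal_lmult[OF ideal_power_ideal[OF c(2)]] c by simp
  then show ?case unfolding e power_ideal_Cons[OF c(2,1)] using j p by blast
qed

text \<open>
  A weak form of regularity of \<open>c\<close> modulo the powers of the elements of \<open>as\<close>. It holds for all
  elements of noetherian rings, and with \<open>N = 0\<close> for regular sequences.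
\<close>

definition colon_stable :: "'a list \<Rightarrow> 'a \<Rightarrow> bool" where
  "colon_stable as c \<longleftrightarrow> (\<forall>m. \<exists>N. \<forall>n s. s \<in> carrier R \<longrightarrow> s \<otimes> c [^] (N + n :: nat) \<in> power_ideal as m \<longrightarrow>
      s \<otimes> c [^] N \<in> power_ideal as m)"

text \<open>
  The head of the list counts as the element adjoined last: it is tested modulo the tail.
\<close>

fun stable_seq :: "'a list \<Rightarrow> bool" where
  "stable_seq [] = True"
| "stable_seq (c # as) = (c \<in> carrier R \<and> colon_stable as c \<and> stable_seq as)"

lemma stable_seq_carr: "stable_seq as \<Longrightarrow> set as \<subseteq> carrier R"
  by (induction as) auto

end

lemma (in noeth_cring) stable_seq_if_noetherian: "set as \<subseteq> carrier R \<Longrightarrow> stable_seq as"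
  by (induction as) (auto simp: colon_stable_def intro!: colon_power_stable ideal_power_ideal)

section \<open>Torsion in an injective resolution\<close>

locale inj_res = cring R for R :: "('a, 'b) ring_scheme" (structure) +
  fixes E :: "nat \<Rightarrow> ('a, 'm) module" and d :: "nat \<Rightarrow> 'm \<Rightarrow> 'm" and \<epsilon> :: "'a \<Rightarrow> 'm"
  assumes res: "injective_resolution R (ring_as_module R) E d \<epsilon>"
begin

lemma E_inj: "injective_module R (E i)"
  using res unfolding injective_resolution_def by blast

lemma E_mod: "module R (E i)"
  using E_inj unfolding injective_module_def by blast

sublocale E: module R "E i" for i
  by (rule E_mod)

abbreviation sm :: "nat \<Rightarrow> 'a \<Rightarrow> 'm \<Rightarrow> 'm" where "sm i a x \<equiv> a \<odot>\<^bsub>E i\<^esub> x"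
abbreviation Z0 :: "nat \<Rightarrow> 'm" where "Z0 i \<equiv> \<zero>\<^bsub>E i\<^esub>"

lemma d_hom: "d i \<in> module_hom R (E i) (E (Suc i))"
  using res unfolding injective_resolution_def by blast

lemma d_closed [simp]: "x \<in> carrier (E i) \<Longrightarrow> d i x \<in> carrier (E (Suc i))"
  using d_hom[of i] unfolding module_hom_def by blast

lemma d_add: "x \<in> carrier (E i) \<Longrightarrow> y \<in> carrier (E i) \<Longrightarrow> d i (x \<oplus>\<^bsub>E i\<^esub> y) = d i x \<oplus>\<^bsub>E (Suc i)\<^esub> d i y"
  using d_hom[of i] unfolding module_hom_def by blast

lemma d_smult: "a \<in> carrier R \<Longrightarrow> x \<in> carrier (E i) \<Longrightarrow> d i (sm i a x) = sm (Suc i) a (d i x)"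
  using d_hom[of i] unfolding module_hom_def by blast

lemma d_zero [simp]: "d i (Z0 i) = Z0 (Suc i)"
  using d_smult[of \<zero> "Z0 i" i] by simp

lemma d_minus: "x \<in> carrier (E i) \<Longrightarrow> y \<in> carrier (E i) \<Longrightarrow>
    d i (x \<ominus>\<^bsub>E i\<^esub> y) = d i x \<ominus>\<^bsub>E (Suc i)\<^esub> d i y"
proof -
  assume x: "x \<in> carrier (E i)" and y: "y \<in> carrier (E i)"
  have neg: "\<ominus>\<^bsub>E j\<^esub> u = sm j (\<ominus> \<one>) u" if "u \<in> carrier (E j)" for u j
    using that E.smult_l_minus[of \<one> u j] by simp
  show ?thesis using x y by (simp add: E.M.minus_eq neg d_add d_smult)
qed

lemma minus_zero [simp]: "x \<in> carrier (E i) \<Longrightarrow> x \<ominus>\<^bsub>E i\<^esub> Z0 i = x"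
  by (simp add: E.M.minus_eq)

lemma minus_self [simp]: "x \<in> carrier (E i) \<Longrightarrow> x \<ominus>\<^bsub>E i\<^esub> x = Z0 i"
  by (simp add: E.M.minus_eq E.M.r_neg)

lemma image_kernel: "d i ` carrier (E i) = {x \<in> carrier (E (Suc i)). d (Suc i) x = Z0 (Suc (Suc i))}"
  using res unfolding injective_resolution_def a_kernel_def kernel_def by auto

lemma d_d [simp]: "x \<in> carrier (E i) \<Longrightarrow> d (Suc i) (d i x) = Z0 (Suc (Suc i))"
  using image_kernel[of i] by blast

lemma exact: "x \<in> carrier (E (Suc i)) \<Longrightarrow> d (Suc i) x = Z0 (Suc (Suc i)) \<Longrightarrow> \<exists>y\<in>carrier (E i). d i y = x"
proof -
  assume "x \<in> carrier (E (Suc i))" "d (Suc i) x = Z0 (Suc (Suc i))"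
  then have "x \<in> d i ` carrier (E i)" unfolding image_kernel by simp
  then show ?thesis by blast
qed

lemma eps_hom: "\<epsilon> \<in> module_hom R (ring_as_module R) (E 0)"
  using res unfolding injective_resolution_def by blast

lemma eps_closed [simp]: "r \<in> carrier R \<Longrightarrow> \<epsilon> r \<in> carrier (E 0)"
  using eps_hom unfolding module_hom_def ring_as_module_def by auto

lemma eps_add: "r \<in> carrier R \<Longrightarrow> s \<in> carrier R \<Longrightarrow> \<epsilon> (r \<oplus> s) = \<epsilon> r \<oplus>\<^bsub>E 0\<^esub> \<epsilon> s"
  using eps_hom unfolding module_hom_def ring_as_module_def by auto

lemma eps_smult: "r \<in> carrier R \<Longrightarrow> s \<in> carrier R \<Longrightarrow> \<epsilon> (r \<otimes> s) = sm 0 r (\<epsilon> s)"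
  using eps_hom unfolding module_hom_def ring_as_module_def by auto

lemma eps_zero [simp]: "\<epsilon> \<zero> = Z0 0"
  using eps_smult[of \<zero> \<zero>] by simp

lemma eps_minus: "r \<in> carrier R \<Longrightarrow> s \<in> carrier R \<Longrightarrow> \<epsilon> (r \<ominus> s) = \<epsilon> r \<ominus>\<^bsub>E 0\<^esub> \<epsilon> s"
proof -
  assume r: "r \<in> carrier R" and s: "s \<in> carrier R"
  have e: "\<ominus> s = (\<ominus> \<one>) \<otimes> s" using s by algebra
  have "sm 0 (\<ominus> \<one>) (\<epsilon> s) = \<ominus>\<^bsub>E 0\<^esub> \<epsilon> s" using s E.smult_l_minus[of \<one> "\<epsilon> s" 0] by simp
  then show ?thesis unfolding minus_eq E.M.minus_eq
    using r s eps_add[of r "\<ominus> s"] eps_smult[of "\<ominus> \<one>" s] e by simp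
qed

lemma eps_inj: "r \<in> carrier R \<Longrightarrow> s \<in> carrier R \<Longrightarrow> \<epsilon> r = \<epsilon> s \<Longrightarrow> r = s"
  using res unfolding injective_resolution_def ring_as_module_def by (auto dest: inj_onD)

lemma eps_image: "\<epsilon> ` carrier R = {x \<in> carrier (E 0). d 0 x = Z0 (Suc 0)}"
  using res unfolding injective_resolution_def a_kernel_def kernel_def ring_as_module_def by auto

lemma d_eps [simp]: "r \<in> carrier R \<Longrightarrow> d 0 (\<epsilon> r) = Z0 (Suc 0)"
  using eps_image by blast

lemma exact0: "x \<in> carrier (E 0) \<Longrightarrow> d 0 x = Z0 (Suc 0) \<Longrightarrow> \<exists>r\<in>carrier R. x = \<epsilon> r"
proof -
  assume "x \<in> carrier (E 0)" "d 0 x = Z0 (Suc 0)"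
  then have "x \<in> \<epsilon> ` carrier R" unfolding eps_image by simp
  then show ?thesis by blast
qed

text \<open>
  For the ideal \<open>I\<close> generated by the list this is \<open>\<Gamma>\<^sub>I\<close> of the \<open>i\<close>-th module of the resolution, see
  \<open>tors_iff_ideal_power\<close>. Lists make induction on the number of generators possible.
\<close>

definition tors :: "'a list \<Rightarrow> nat \<Rightarrow> 'm set" where
  "tors as i = {x \<in> carrier (E i). \<forall>a\<in>set as. \<exists>n::nat. sm i (a [^] n) x = Z0 i}"

lemma tors_carr: "x \<in> tors as i \<Longrightarrow> x \<in> carrier (E i)"
  by (simp add: tors_def)

lemma tors_Nil: "tors [] i = carrier (E i)"
  by (simp add: tors_def)

lemma tors_Cons: "x \<in> tors (c # as) i \<longleftrightarrow> x \<in> tors as i \<and> (\<exists>n::nat. sm i (c [^] n) x = Z0 i)"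
  by (auto simp: tors_def)

lemma tors_zero: "set as \<subseteq> carrier R \<Longrightarrow> Z0 i \<in> tors as i"
  unfolding tors_def by auto

lemma tors_smult: "set as \<subseteq> carrier R \<Longrightarrow> r \<in> carrier R \<Longrightarrow> x \<in> tors as i \<Longrightarrow> sm i r x \<in> tors as i"
proof -
  assume *: "set as \<subseteq> carrier R" "r \<in> carrier R" "x \<in> tors as i"
  have "\<exists>n::nat. sm i (a [^] n) (sm i r x) = Z0 i" if a: "a \<in> set as" for a
  proof -
    obtain n :: nat where n: "sm i (a [^] n) x = Z0 i" using * a unfolding tors_def by blast
    have ac: "a [^] n \<in> carrier R" using * a by auto
    have "sm i (a [^] n) (sm i r x) = sm i (r \<otimes> a [^] n) x"
      using * ac tors_carr[OF *(3)] by (simp add: E.smult_assoc1[symmetric] m_comm)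
    also have "\<dots> = Z0 i" using * ac n tors_carr[OF *(3)] by (simp add: E.smult_assoc1)
    finally show ?thesis by blast
  qed
  then show ?thesis using * tors_carr[OF *(3)] unfolding tors_def by auto
qed

lemma tors_minus:
  assumes as: "set as \<subseteq> carrier R" and x: "x \<in> tors as i" and y: "y \<in> tors as i"
  shows "x \<ominus>\<^bsub>E i\<^esub> y \<in> tors as i"
proof -
  have "\<exists>n::nat. sm i (a [^] n) (x \<ominus>\<^bsub>E i\<^esub> y) = Z0 i" if a: "a \<in> set as" for a
  proof -
    have ac: "a \<in> carrier R" using as a by auto
    obtain n m :: nat where n: "sm i (a [^] n) x = Z0 i" "sm i (a [^] m) y = Z0 i"
      using x y a unfolding tors_def by blast
    have "sm i (a [^] (n + m)) x = Z0 i" "sm i (a [^] (n + m)) y = Z0 i"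
      using n ac tors_carr[OF x] tors_carr[OF y]
      by (auto intro: E.pow_smult_zero_mono[of _ _ _ n] E.pow_smult_zero_mono[of _ _ _ m])
    then have "sm i (a [^] (n + m)) (x \<ominus>\<^bsub>E i\<^esub> y) = Z0 i"
      using ac tors_carr[OF x] tors_carr[OF y] by (simp add: E.smult_minus)
    then show ?thesis by blast
  qed
  then show ?thesis using tors_carr[OF x] tors_carr[OF y] unfolding tors_def by auto
qed

lemma tors_d: "set as \<subseteq> carrier R \<Longrightarrow> x \<in> tors as i \<Longrightarrow> d i x \<in> tors as (Suc i)"
proof -
  assume *: "set as \<subseteq> carrier R" "x \<in> tors as i"
  have "\<exists>n::nat. sm (Suc i) (a [^] n) (d i x) = Z0 (Suc i)" if a: "a \<in> set as" for a
  proof -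
    obtain n :: nat where n: "sm i (a [^] n) x = Z0 i" using * a unfolding tors_def by blast
    have "sm (Suc i) (a [^] n) (d i x) = d i (sm i (a [^] n) x)"
      using d_smult[of "a [^] n" x i] a * tors_carr by auto
    then show ?thesis using n by auto
  qed
  then show ?thesis using tors_carr[OF *(2)] unfolding tors_def by auto
qed

lemma tors_uniform:
  assumes "set as \<subseteq> carrier R" "x \<in> tors as i"
  shows "\<exists>m. \<forall>j\<in>power_ideal as m. sm i j x = Z0 i"
proof -
  obtain e :: "'a \<Rightarrow> nat" where e: "\<And>a. a \<in> set as \<Longrightarrow> sm i (a [^] e a) x = Z0 i"
    using assms(2) unfolding tors_def mem_Collect_eq by metis
  have x: "x \<in> carrier (E i)" using tors_carr assms by blast
  define m where "m = Max (e ` set as)"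
  have "sm i (a [^] m) x = Z0 i" if "a \<in> set as" for a
    by (rule E.pow_smult_zero_mono[OF _ x e[OF that]]) (use that assms in \<open>auto simp: m_def\<close>)
  then have "power_ideal as m \<subseteq> {r \<in> carrier R. sm i r x = Z0 i}"
    unfolding power_ideal_def using assms x by (intro Idl_least E.annihilator_ideal) auto
  then show ?thesis by blast
qed

text \<open>
  On the ideal generated by \<open>c^(N + n)\<close> and the powers \<open>a^m\<close>, where \<open>m\<close> is such that these powers
  kill \<open>u\<close>, the assignment \<open>s c^(N + n) + j \<mapsto> s c^N u\<close> is well defined once \<open>N\<close> is so large that
  the colon ideals by powers of \<open>c\<close> are stable. Its extension to \<open>R\<close> is multiplication by the
  desired \<open>v\<close>. In other words, inside the torsion of \<open>as\<close> the map to the localization at \<open>c\<close> is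
  onto.
\<close>

lemma divide_by_power:
  assumes st: "colon_stable as c" and as: "set as \<subseteq> carrier R" and c: "c \<in> carrier R" and u: "u \<in> tors as i"
  shows "\<exists>v\<in>tors as i. \<exists>N. sm i (c [^] (N + n :: nat)) v = sm i (c [^] (N::nat)) u"
proof -
  have uc: "u \<in> carrier (E i)" using u tors_carr by blast
  obtain m where m: "\<And>j. j \<in> power_ideal as m \<Longrightarrow> sm i j u = Z0 i" using tors_uniform[OF as u] by blast
  obtain N where N: "\<And>n s. s \<in> carrier R \<Longrightarrow> s \<otimes> c [^] (N + n :: nat) \<in> power_ideal as m \<Longrightarrow>
      s \<otimes> c [^] N \<in> power_ideal as m"
    using st unfolding colon_stable_def by blast
  define J where "J = power_ideal as m"
  have J: "ideal J R" unfolding J_def by (rule ideal_power_ideal[OF as])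
  define b where "b = c [^] (N + n)"
  have b: "b \<in> carrier R" and cN: "c [^] N \<in> carrier R" unfolding b_def using c by auto
  define K where "K = {s \<otimes> b \<oplus> j | s j. s \<in> carrier R \<and> j \<in> J}"
  have K: "ideal K R" unfolding K_def by (rule ideal_insert[OF J b])
  define f where "f k = sm i ((SOME s. s \<in> carrier R \<and> (\<exists>j\<in>J. k = s \<otimes> b \<oplus> j)) \<otimes> c [^] N) u" for k
  have f: "f (s \<otimes> b \<oplus> j) = sm i (s \<otimes> c [^] N) u" if s: "s \<in> carrier R" and j: "j \<in> J" for s j
  proof -
    define s' where "s' = (SOME s'. s' \<in> carrier R \<and> (\<exists>j'\<in>J. s \<otimes> b \<oplus> j = s' \<otimes> b \<oplus> j'))"
    have "s' \<in> carrier R \<and> (\<exists>j'\<in>J. s \<otimes> b \<oplus> j = s' \<otimes> b \<oplus> j')"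
      unfolding s'_def by (rule someI[of _ s]) (use s j in blast)
    then obtain j' where s': "s' \<in> carrier R" and j': "j' \<in> J" and e: "s \<otimes> b \<oplus> j = s' \<otimes> b \<oplus> j'"
      by blast
    have jc: "j \<in> carrier R" "j' \<in> carrier R" using j j' ideal_carr[OF J] by auto
    have "(s' \<ominus> s) \<otimes> b = (s' \<otimes> b \<oplus> j') \<ominus> (s \<otimes> b \<oplus> j) \<oplus> (j \<ominus> j')"
      using s s' jc b by algebra
    also have "\<dots> = j \<ominus> j'" unfolding e using s s' jc b by algebra
    finally have "(s' \<ominus> s) \<otimes> b \<in> J" using ideal_minus[OF J j j'] by simp
    then have "(s' \<ominus> s) \<otimes> c [^] N \<in> J" using N[of "s' \<ominus> s" n] s s' unfolding J_def b_def by simp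
    then have z: "sm i ((s' \<ominus> s) \<otimes> c [^] N) u = Z0 i" using m unfolding J_def by blast
    have "s' \<otimes> c [^] N \<ominus> s \<otimes> c [^] N = (s' \<ominus> s) \<otimes> c [^] N" using s s' cN by algebra
    then have "sm i (s' \<otimes> c [^] N) u = sm i (s \<otimes> c [^] N) u"
      using E.smult_diff_zero[of "s' \<otimes> c [^] N" "s \<otimes> c [^] N" u i] s s' cN uc z by simp
    then show ?thesis unfolding f_def s'_def .
  qed
  have ex: "\<exists>v\<in>carrier (E i). \<forall>k\<in>K. f k = sm i k v"
  proof (rule injective_module_ideal_extension[OF E_inj K])
    show "f k \<in> carrier (E i)" if "k \<in> K" for k
      using that f uc cN unfolding K_def by auto
    show "f (k \<oplus> l) = f k \<oplus>\<^bsub>E i\<^esub> f l" if kl: "k \<in> K" "l \<in> K" for k l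
    proof -
      from kl obtain s j s' j' where *: "s \<in> carrier R" "j \<in> J" "k = s \<otimes> b \<oplus> j"
        "s' \<in> carrier R" "j' \<in> J" "l = s' \<otimes> b \<oplus> j'" unfolding K_def by blast
      then have "j \<in> carrier R" "j' \<in> carrier R" using ideal_carr[OF J] by auto
      then have "k \<oplus> l = (s \<oplus> s') \<otimes> b \<oplus> (j \<oplus> j')" using * b by algebra
      then have "f (k \<oplus> l) = sm i ((s \<oplus> s') \<otimes> c [^] N) u" using f * ideal_add[OF J] by simp
      then show ?thesis using * f cN uc by (simp add: l_distr E.smult_l_distr)
    qed
    show "f (r \<otimes> k) = sm i r (f k)" if rk: "r \<in> carrier R" "k \<in> K" for r k
    proof -
      from rk obtain s j where *: "s \<in> carrier R" "j \<in> J" "k = s \<otimes> b \<oplus> j" unfolding K_def by blast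
      then have "j \<in> carrier R" using ideal_carr[OF J] by auto
      then have "r \<otimes> k = (r \<otimes> s) \<otimes> b \<oplus> (r \<otimes> j)" using * b rk by algebra
      then have "f (r \<otimes> k) = sm i ((r \<otimes> s) \<otimes> c [^] N) u" using f * rk ideal_lmult[OF J] by simp
      then show ?thesis using * rk f cN uc by (simp add: m_assoc E.smult_assoc1)
    qed
  qed
  then obtain v where v: "v \<in> carrier (E i)" "\<And>k. k \<in> K \<Longrightarrow> f k = sm i k v" by blast
  have fv: "sm i (s \<otimes> b \<oplus> j) v = sm i (s \<otimes> c [^] N) u" if "s \<in> carrier R" "j \<in> J" for s j
  proof -
    have "s \<otimes> b \<oplus> j \<in> K" unfolding K_def using that by blast
    then show ?thesis using f[OF that] v(2) by simp
  qed
  have "sm i (a [^] m) v = Z0 i" if "a \<in> set as" for a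
  proof -
    have "a [^] m \<in> J" unfolding J_def power_ideal_def using that as by (intro Idl_self) auto
    then show ?thesis using fv[of \<zero> "a [^] m"] as that b cN uc by auto
  qed
  then have "v \<in> tors as i" using v unfolding tors_def by blast
  moreover have "sm i (c [^] (N + n)) v = sm i (c [^] N) u"
    using fv[of \<one> \<zero>] ideal_zero[OF J] b cN unfolding b_def by simp
  ultimately show ?thesis by blast
qed

text \<open>
  Local cohomology vanishes above the number of generators. When \<open>c\<close> is adjoined, a primitive \<open>y\<close>
  of \<open>z\<close> has to be made \<open>c\<close>-torsion. As \<open>c^n z = 0\<close>, the element \<open>c^n y\<close> is a cocycle, say
  \<open>c^n y = d u\<close>; if \<open>v\<close> is \<open>u\<close> divided by \<open>c^n\<close> up to \<open>c\<close>-torsion, then \<open>y - d v\<close> is as desired.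
\<close>

lemma torsion_acyclic:
  assumes "stable_seq as" "z \<in> tors as (Suc i)" "d (Suc i) z = Z0 (Suc (Suc i))" "length as \<le> i"
  shows "\<exists>y\<in>tors as i. d i y = z"
  using assms
proof (induction as arbitrary: i z)
  case Nil
  then show ?case using exact by (simp add: tors_Nil)
next
  case (Cons c as)
  then obtain k where i: "i = Suc k" by (cases i) auto
  have as: "set as \<subseteq> carrier R" "stable_seq as" "colon_stable as c" "c \<in> carrier R" using Cons.prems stable_seq_carr by auto
  obtain n :: nat where z: "z \<in> tors as (Suc i)" and n: "sm (Suc i) (c [^] n) z = Z0 (Suc i)"
    using Cons.prems unfolding tors_Cons by blast
  obtain y where y: "y \<in> tors as i" "d i y = z" using Cons.IH[OF as(2) z] Cons.prems by auto
  have yc: "y \<in> carrier (E i)" using y tors_carr by blast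
  have cn: "c [^] k \<in> carrier R" for k :: nat using as by simp
  have "d i (sm i (c [^] n) y) = Z0 (Suc i)" using n y yc cn by (simp add: d_smult)
  then obtain u where u: "u \<in> tors as k" "d k u = sm i (c [^] n) y"
    using Cons.IH[of "sm i (c [^] n) y" k] as tors_smult[OF as(1) cn y(1)] Cons.prems i by auto
  have uc: "u \<in> carrier (E k)" using u tors_carr by blast
  obtain v N where v: "v \<in> tors as k" and N: "sm k (c [^] (N + n)) v = sm k (c [^] (N::nat)) u"
    using divide_by_power[OF as(3,1,4) u(1)] by blast
  have vc: "v \<in> carrier (E k)" using v tors_carr by blast
  define w where "w = y \<ominus>\<^bsub>E i\<^esub> d k v"
  have w: "w \<in> tors as i" unfolding w_def using y tors_d[OF as(1) v] tors_minus[OF as(1)] i by simp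
  have "sm i (c [^] (N + n)) w = sm i (c [^] (N + n)) y \<ominus>\<^bsub>E i\<^esub> d k (sm k (c [^] (N + n)) v)"
    unfolding w_def using yc vc cn i by (simp add: E.smult_minus d_smult)
  also have "\<dots> = Z0 i"
    unfolding N using u uc cn i yc E.smult_pow_pow[OF as(4) yc, of N n]
    by (simp add: d_smult )
  finally have "w \<in> tors (c # as) i" using w unfolding tors_Cons by blast
  moreover have "d i w = z" unfolding w_def using y yc vc i tors_carr[OF z] by (simp add: d_minus)
  ultimately show ?case by blast
qed

subsection \<open>Cocycles as classes of ring elements\<close>

text \<open>
  A zigzag through the resolution, one degree for each element of the list, from the cocycle \<open>z\<close>
  to the ring element \<open>r\<close>: the class of \<open>z\<close> in local cohomology corresponds to the class of \<open>r\<close> in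
  the \<open>n\<close>-th module \<open>R/(a^n : a \<in> as)\<close> of the direct system. The choices of primitives make this a
  relation and not a function.
\<close>

fun represents :: "'a list \<Rightarrow> nat \<Rightarrow> 'm \<Rightarrow> 'a \<Rightarrow> bool" where
  "represents [] n z r \<longleftrightarrow> r \<in> carrier R \<and> z = \<epsilon> r"
| "represents (c # as) n z r \<longleftrightarrow>
     (\<exists>y\<in>tors as (length as). z = d (length as) y \<and> represents as n (sm (length as) (c [^] n) y) r)"

lemma represents_cocycle:
  assumes "set as \<subseteq> carrier R" "represents as n z r"
  shows "z \<in> tors as (length as) \<and> d (length as) z = Z0 (Suc (length as)) \<and> r \<in> carrier R"
  using assms
proof (induction as arbitrary: z)
  case Nil
  then show ?case by (auto simp: tors_Nil)
next
  case (Cons c as)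
  then obtain y where y: "y \<in> tors as (length as)" "z = d (length as) y"
    "represents as n (sm (length as) (c [^] n) y) r" by auto
  have c: "c \<in> carrier R" "set as \<subseteq> carrier R" using Cons.prems by auto
  have yc: "y \<in> carrier (E (length as))" using y tors_carr by blast
  have "d (length as) (sm (length as) (c [^] n) y) = Z0 (Suc (length as))" "r \<in> carrier R"
    using Cons.IH[OF c(2) y(3)] by auto
  then have "sm (Suc (length as)) (c [^] n) z = Z0 (Suc (length as))"
    using y c yc by (simp add: d_smult)
  then show ?case using y yc tors_d[OF c(2) y(1)] \<open>r \<in> carrier R\<close> by (auto simp: tors_Cons)
qed

lemma represents_minus:
  assumes "set as \<subseteq> carrier R" "represents as n z r" "represents as n z' r'"
  shows "represents as n (z \<ominus>\<^bsub>E (length as)\<^esub> z') (r \<ominus> r')"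
  using assms
proof (induction as arbitrary: z z')
  case Nil
  then show ?case by (auto simp: eps_minus)
next
  case (Cons c as)
  then obtain y y' where y: "y \<in> tors as (length as)" "z = d (length as) y"
    "represents as n (sm (length as) (c [^] n) y) r"
    and y': "y' \<in> tors as (length as)" "z' = d (length as) y'"
    "represents as n (sm (length as) (c [^] n) y') r'" by auto
  have c: "c \<in> carrier R" "set as \<subseteq> carrier R" using Cons.prems by auto
  have yc: "y \<in> carrier (E (length as))" "y' \<in> carrier (E (length as))" using y y' tors_carr by auto
  show ?case
    unfolding represents.simps
  proof (rule bexI[of _ "y \<ominus>\<^bsub>E (length as)\<^esub> y'"], rule conjI)
    show "z \<ominus>\<^bsub>E (length (c # as))\<^esub> z' = d (length as) (y \<ominus>\<^bsub>E (length as)\<^esub> y')"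
      using y y' yc by (simp add: d_minus)
    show "represents as n (sm (length as) (c [^] n) (y \<ominus>\<^bsub>E (length as)\<^esub> y')) (r \<ominus> r')"
      using Cons.IH[OF c(2) y(3) y'(3)] yc c by (simp add: E.smult_minus)
    show "y \<ominus>\<^bsub>E (length as)\<^esub> y' \<in> tors as (length as)" by (rule tors_minus[OF c(2) y(1) y'(1)])
  qed
qed

lemma represents_smult:
  assumes "set as \<subseteq> carrier R" "represents as n z r" "s \<in> carrier R"
  shows "represents as n (sm (length as) s z) (s \<otimes> r)"
  using assms
proof (induction as arbitrary: z)
  case Nil
  then show ?case by (auto simp: eps_smult)
next
  case (Cons c as)
  then obtain y where y: "y \<in> tors as (length as)" "z = d (length as) y"
    "represents as n (sm (length as) (c [^] n) y) r" by auto
  have c: "c \<in> carrier R" "set as \<subseteq> carrier R" using Cons.prems by auto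
  have yc: "y \<in> carrier (E (length as))" using y tors_carr by blast
  have e: "sm (length as) (c [^] n) (sm (length as) s y) = sm (length as) s (sm (length as) (c [^] n) y)"
    using c yc Cons.prems by (simp add: E.smult_assoc1[symmetric] m_comm)
  show ?case
    unfolding represents.simps
  proof (rule bexI[of _ "sm (length as) s y"], rule conjI)
    show "sm (length (c # as)) s z = d (length as) (sm (length as) s y)"
      using y yc Cons.prems by (simp add: d_smult)
    show "represents as n (sm (length as) (c [^] n) (sm (length as) s y)) (s \<otimes> r)"
      using Cons.IH[OF c(2) y(3)] Cons.prems e by simp
    show "sm (length as) s y \<in> tors as (length as)" using tors_smult[OF c(2) _ y(1)] Cons.prems by simp
  qed
qed

lemma represents_shift:
  assumes "set as \<subseteq> carrier R" "represents as n z r"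
  shows "represents as (n + k) z (r \<otimes> prodl as [^] k)"
  using assms
proof (induction as arbitrary: z r)
  case Nil
  then show ?case by auto
next
  case (Cons c as)
  then obtain y where y: "y \<in> tors as (length as)" "z = d (length as) y"
    "represents as n (sm (length as) (c [^] n) y) r" by auto
  have c: "c \<in> carrier R" "set as \<subseteq> carrier R" using Cons.prems by auto
  have yc: "y \<in> carrier (E (length as))" using y tors_carr by blast
  have r: "r \<in> carrier R" using represents_cocycle[OF c(2) y(3)] by blast
  have "represents as n (sm (length as) (c [^] k) (sm (length as) (c [^] n) y)) (c [^] k \<otimes> r)"
    by (rule represents_smult[OF c(2) y(3)]) (use c in simp)
  then have "represents as (n + k) (sm (length as) (c [^] k) (sm (length as) (c [^] n) y))
      (c [^] k \<otimes> r \<otimes> prodl as [^] k)"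
    by (rule Cons.IH[OF c(2)])
  moreover have "c [^] k \<otimes> r \<otimes> prodl as [^] k = r \<otimes> prodl (c # as) [^] k"
    using c r by (simp add: pow_mult_distrib m_comm m_assoc m_lcomm)
  moreover have "sm (length as) (c [^] k) (sm (length as) (c [^] n) y) = sm (length as) (c [^] (n + k)) y"
    using E.smult_pow_pow[OF c(1) yc, of k n] by (simp add: add.commute)
  ultimately show ?case using y by auto
qed

lemma represents_exists:
  assumes "stable_seq as" "z \<in> tors as (length as)" "d (length as) z = Z0 (Suc (length as))"
  shows "\<exists>n r. represents as n z r"
  using assms
proof (induction as arbitrary: z)
  case Nil
  then show ?case using exact0[of z] by (auto simp: tors_Nil)
next
  case (Cons c as)
  define p where "p = length as"
  have as: "set as \<subseteq> carrier R" "stable_seq as" "c \<in> carrier R" using Cons.prems stable_seq_carr by auto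
  have cn: "c [^] k \<in> carrier R" for k :: nat using as by simp
  obtain n1 :: nat where z: "z \<in> tors as (Suc p)" and n1: "sm (Suc p) (c [^] n1) z = Z0 (Suc p)"
    using Cons.prems unfolding tors_Cons p_def by auto
  obtain y where y: "y \<in> tors as p" "d p y = z"
    using torsion_acyclic[OF as(2) z] Cons.prems by (auto simp: p_def)
  have yc: "y \<in> carrier (E p)" using y tors_carr by blast
  have "d p (sm p (c [^] n1) y) = Z0 (Suc p)" using n1 y yc cn by (simp add: d_smult)
  then obtain n2 r where r: "represents as n2 (sm p (c [^] n1) y) r"
    using Cons.IH[OF as(2)] tors_smult[OF as(1) cn y(1)] unfolding p_def by blast
  have "represents as n2 (sm p (c [^] n2) (sm p (c [^] n1) y)) (c [^] n2 \<otimes> r)"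
    unfolding p_def by (rule represents_smult[OF as(1)]) (use r cn p_def in auto)
  then have "represents as (n2 + n1) (sm p (c [^] n2) (sm p (c [^] n1) y)) (c [^] n2 \<otimes> r \<otimes> prodl as [^] n1)"
    by (rule represents_shift[OF as(1)])
  then have "represents (c # as) (n2 + n1) z (c [^] n2 \<otimes> r \<otimes> prodl as [^] n1)"
    using y E.smult_pow_pow[OF as(3) yc] unfolding p_def by auto
  then show ?case by blast
qed

text \<open>
  Division by \<open>c^m\<close> is possible up to \<open>c\<close>-torsion only, which is why \<open>r\<close> has to be moved to a later
  stage of the direct system.
\<close>

lemma represents_surj:
  assumes "stable_seq as" "r \<in> carrier R"
  shows "\<exists>N z. represents as (m + N) z (r \<otimes> prodl as [^] (N::nat))"
  using assms
proof (induction as)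
  case Nil
  then show ?case by auto
next
  case (Cons c as)
  define p where "p = length as"
  have as: "set as \<subseteq> carrier R" "stable_seq as" "colon_stable as c" "c \<in> carrier R" using Cons.prems stable_seq_carr by auto
  have cn: "c [^] k \<in> carrier R" for k :: nat using as by simp
  obtain N1 y1 where y1: "represents as (m + N1) y1 (r \<otimes> prodl as [^] (N1::nat))" using Cons as by blast
  have y1t: "y1 \<in> tors as p" using represents_cocycle[OF as(1) y1] by (simp add: p_def)
  have y1c: "y1 \<in> carrier (E p)" using y1t tors_carr by blast
  obtain y N2 where y: "y \<in> tors as p" and e: "sm p (c [^] (N2 + (m + N1))) y = sm p (c [^] (N2::nat)) y1"
    using divide_by_power[OF as(3,1,4) y1t] by blast
  have yc: "y \<in> carrier (E p)" using y tors_carr by blast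
  have "represents as (m + N1) (sm p (c [^] N2) y1) (c [^] N2 \<otimes> (r \<otimes> prodl as [^] N1))"
    unfolding p_def by (rule represents_smult[OF as(1) y1 cn])
  then have "represents as (m + N1 + N2) (sm p (c [^] N2) y1)
      (c [^] N2 \<otimes> (r \<otimes> prodl as [^] N1) \<otimes> prodl as [^] N2)"
    by (rule represents_shift[OF as(1)])
  then have "represents (c # as) (m + N1 + N2) (d p y) (c [^] N2 \<otimes> (r \<otimes> prodl as [^] N1) \<otimes> prodl as [^] N2)"
    using y e unfolding p_def[symmetric] represents.simps by (auto simp: add.commute)
  then have "represents (c # as) (m + N1 + N2) (sm (Suc p) (c [^] N1) (d p y))
     (c [^] N1 \<otimes> (c [^] N2 \<otimes> (r \<otimes> prodl as [^] N1) \<otimes> prodl as [^] N2))"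
    using represents_smult[of "c # as" _ _ _ "c [^] N1"] as cn by (simp add: p_def del: represents.simps)
  moreover have "c [^] N1 \<otimes> (c [^] N2 \<otimes> (r \<otimes> prodl as [^] N1) \<otimes> prodl as [^] N2) =
      r \<otimes> prodl (c # as) [^] (N1 + N2)"
    using as Cons.prems by (simp add: pow_mult_distrib m_comm m_ac nat_pow_mult[symmetric])
  ultimately show ?case unfolding add.assoc by metis
qed

text \<open>
  Coboundaries of the torsion complex in degree \<open>length as\<close>.
\<close>

fun coboundary :: "'a list \<Rightarrow> 'm \<Rightarrow> bool" where
  "coboundary [] z \<longleftrightarrow> z = Z0 0"
| "coboundary (c # as) z \<longleftrightarrow> (\<exists>w\<in>tors (c # as) (length as). d (length as) w = z)"

lemma coboundary_zero: "set as \<subseteq> carrier R \<Longrightarrow> coboundary as (Z0 (length as))"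
  by (cases as) (auto intro!: bexI[OF _ tors_zero])

lemma coboundary_iff_Nil: "r \<in> carrier R \<Longrightarrow> (\<epsilon> r = Z0 0) = (r = \<zero>)"
  using eps_inj[of r \<zero>] by auto

text \<open>
  A class vanishes iff its representative vanishes at some stage of the direct system. Let
  \<open>z = d y\<close> with \<open>c^n y\<close> represented by \<open>r\<close>.

  If \<open>z = d w\<close> with \<open>w\<close> torsion for \<open>c\<close> as well, then \<open>y - w\<close> is a cocycle, and after
  multiplication by a power of \<open>c\<close> it cannot be told from \<open>y\<close>; comparing the two representatives at
  a common stage shows that \<open>r\<close> is a multiple of a power of \<open>c\<close> modulo the powers of the other
  elements.

  Conversely, if \<open>r\<close> becomes \<open>s c^(n + N) + j\<close>, realize \<open>s\<close> by a cocycle \<open>y3\<close>. By induction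
  \<open>c^(n + N) (y - y3)\<close> is a coboundary, and dividing its primitive by \<open>c^(n + N)\<close> up to torsion
  yields a \<open>c\<close>-torsion primitive of \<open>z\<close>.
\<close>

lemma coboundary_iff:
  assumes "stable_seq as" "represents as n z r"
  shows "coboundary as z \<longleftrightarrow> (\<exists>N. r \<otimes> prodl as [^] N \<in> power_ideal as (n + N))"
  using assms
proof (induction as arbitrary: n z r)
  case Nil
  then show ?case by (auto simp: power_ideal_Nil coboundary_iff_Nil)
next
  case (Cons c as)
  define p where "p = length as"
  define q where "q = prodl as"
  have as: "set as \<subseteq> carrier R" "stable_seq as" "colon_stable as c" "c \<in> carrier R" using Cons.prems stable_seq_carr by auto
  have cn: "c [^] k \<in> carrier R" for k :: nat using as by simp
  have qc: "q \<in> carrier R" unfolding q_def using as by simp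
  have qn: "q [^] k \<in> carrier R" for k :: nat using qc by simp
  obtain y where y: "y \<in> tors as p" "z = d p y" "represents as n (sm p (c [^] n) y) r"
    using Cons.prems unfolding p_def by auto
  have yc: "y \<in> carrier (E p)" using y tors_carr by blast
  have r: "r \<in> carrier R" using represents_cocycle[OF as(1) y(3)] by simp
  show ?case
  proof
    assume "coboundary (c # as) z"
    then obtain w where w: "w \<in> tors (c # as) p" "d p w = z" unfolding p_def by auto
    then obtain M :: nat where wt: "w \<in> tors as p" and M: "sm p (c [^] M) w = Z0 p"
      unfolding tors_Cons by blast
    have wc: "w \<in> carrier (E p)" using w tors_carr by blast
    define u where "u = y \<ominus>\<^bsub>E p\<^esub> w"
    have u: "u \<in> tors as p" unfolding u_def using tors_minus[OF as(1) y(1) wt] .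
    have "d p u = Z0 (Suc p)" unfolding u_def using y w yc wc
      by (simp add: d_minus )
    then obtain n' r' where r': "represents as n' u r'"
      using represents_exists[OF as(2)] u unfolding p_def by blast
    have r'c: "r' \<in> carrier R" using represents_cocycle[OF as(1) r'] by simp
    have "sm p (c [^] (M + n)) w = Z0 p"
      by (rule E.pow_smult_zero_mono[OF as(4) wc M]) simp
    then have cu: "sm p (c [^] (M + n)) u = sm p (c [^] (M + n)) y"
      unfolding u_def using yc wc cn by (simp add: E.smult_minus)
    have 1: "represents as (n + n') (sm p (c [^] (M + n)) y) (c [^] (M + n) \<otimes> r' \<otimes> q [^] n)"
      using represents_shift[OF as(1) represents_smult[OF as(1) r' cn[of "M + n"]], of n] cu unfolding p_def q_def
      by (simp add: add.commute)
    have 2: "represents as (n + n') (sm p (c [^] (M + n)) y) (c [^] M \<otimes> r \<otimes> q [^] n')"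
      using represents_shift[OF as(1) represents_smult[OF as(1), of n _ r "c [^] M"], of "sm p (c [^] n) y" n'] y(3) cn
        E.smult_pow_pow[OF as(4) yc, of M n] unfolding p_def q_def by simp
    define t where "t = c [^] M \<otimes> r \<otimes> q [^] n' \<ominus> c [^] (M + n) \<otimes> r' \<otimes> q [^] n"
    have tc: "t \<in> carrier R" unfolding t_def using r r'c cn qn by simp
    have "represents as (n + n') (Z0 p) t"
      using represents_minus[OF as(1) 2 1] yc cn unfolding t_def p_def by simp
    then obtain N where N: "t \<otimes> q [^] N \<in> power_ideal as (n + n' + N)"
      using Cons.IH[OF as(2)] coboundary_zero[OF as(1)] unfolding p_def q_def by blast
    \<comment> \<open>at this stage the powers of \<open>c\<close> and of the other elements are both high enough\<close>
    define N' where "N' = M + n' + N"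
    have "c [^] (n' + N) \<otimes> (t \<otimes> q [^] N \<otimes> q [^] M) \<in> power_ideal as (n + N')"
      using power_ideal_shift[OF as(1) N, of M] ideal_lmult[OF ideal_power_ideal[OF as(1)]] cn
      unfolding N'_def q_def by (simp add: ac_simps)
    moreover have "r \<otimes> prodl (c # as) [^] N' =
        (r' \<otimes> q [^] n \<otimes> q [^] N \<otimes> q [^] M) \<otimes> c [^] (n + N') \<oplus> c [^] (n' + N) \<otimes> (t \<otimes> q [^] N \<otimes> q [^] M)"
    proof -
      have "r \<otimes> prodl (c # as) [^] N' = r \<otimes> (c [^] N' \<otimes> q [^] N')"
        using as qc by (simp add: q_def[symmetric] pow_mult_distrib m_comm)
      also have "\<dots> = r \<otimes> ((c [^] M \<otimes> c [^] n' \<otimes> c [^] N) \<otimes> (q [^] M \<otimes> q [^] n' \<otimes> q [^] N))"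
        unfolding N'_def using as qc by (simp add: nat_pow_mult)
      also have "\<dots> = (r' \<otimes> q [^] n \<otimes> q [^] N \<otimes> q [^] M) \<otimes> (c [^] n \<otimes> (c [^] M \<otimes> c [^] n' \<otimes> c [^] N))
          \<oplus> (c [^] n' \<otimes> c [^] N) \<otimes> ((c [^] M \<otimes> r \<otimes> q [^] n' \<ominus> (c [^] M \<otimes> c [^] n) \<otimes> r' \<otimes> q [^] n) \<otimes> q [^] N \<otimes> q [^] M)"
        using r r'c cn[of M] cn[of n] cn[of n'] cn[of N] qn[of M] qn[of n] qn[of n'] qn[of N] by algebra
      also have "\<dots> = (r' \<otimes> q [^] n \<otimes> q [^] N \<otimes> q [^] M) \<otimes> c [^] (n + N') \<oplus> c [^] (n' + N) \<otimes> (t \<otimes> q [^] N \<otimes> q [^] M)"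
        unfolding t_def N'_def using as by (simp add: nat_pow_mult add.assoc)
      finally show ?thesis .
    qed
    moreover have "r' \<otimes> q [^] n \<otimes> q [^] N \<otimes> q [^] M \<in> carrier R" using r'c qn by simp
    ultimately have "r \<otimes> prodl (c # as) [^] N' \<in> power_ideal (c # as) (n + N')"
      unfolding power_ideal_Cons[OF as(1,4)] by blast
    then show "\<exists>N. r \<otimes> prodl (c # as) [^] N \<in> power_ideal (c # as) (n + N)" by blast
  next
    assume "\<exists>N. r \<otimes> prodl (c # as) [^] N \<in> power_ideal (c # as) (n + N)"
    then obtain N where "r \<otimes> prodl (c # as) [^] N \<in> power_ideal (c # as) (n + N)" by blast
    then obtain s j where s: "s \<in> carrier R" and j: "j \<in> power_ideal as (n + N)"
      and e: "r \<otimes> prodl (c # as) [^] N = s \<otimes> c [^] (n + N) \<oplus> j"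
      unfolding power_ideal_Cons[OF as(1,4)] by blast
    have jc: "j \<in> carrier R" using j ideal_power_ideal[OF as(1)] ideal_carr by blast
    obtain K y3 where y3: "represents as (n + N + K) y3 (s \<otimes> q [^] (K::nat))"
      using represents_surj[OF as(2) s] unfolding q_def by blast
    have y3t: "y3 \<in> tors as p" and dy3: "d p y3 = Z0 (Suc p)"
      using represents_cocycle[OF as(1) y3] unfolding p_def by auto
    have y3c: "y3 \<in> carrier (E p)" using y3t tors_carr by blast
    have 1: "represents as (n + N + K) (sm p (c [^] (n + N)) y3) (c [^] (n + N) \<otimes> (s \<otimes> q [^] K))"
      using represents_smult[OF as(1) y3 cn] unfolding p_def .
    have 2: "represents as (n + (N + K)) (sm p (c [^] (n + N)) y) (c [^] N \<otimes> r \<otimes> q [^] (N + K))"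
      using represents_shift[OF as(1) represents_smult[OF as(1), of n _ r "c [^] N"], of "sm p (c [^] n) y" "N + K"] y(3) cn
        E.smult_pow_pow[OF as(4) yc, of N n] unfolding p_def q_def by (simp add: add.commute[of N n])
    define g where "g = sm p (c [^] (n + N)) (y \<ominus>\<^bsub>E p\<^esub> y3)"
    have "represents as (n + N + K) (sm p (c [^] (n + N)) y \<ominus>\<^bsub>E p\<^esub> sm p (c [^] (n + N)) y3)
       (c [^] N \<otimes> r \<otimes> q [^] (N + K) \<ominus> c [^] (n + N) \<otimes> (s \<otimes> q [^] K))"
      using represents_minus[OF as(1) _ 1] 2 unfolding p_def by (simp add: add.assoc)
    moreover have "c [^] N \<otimes> r \<otimes> q [^] (N + K) \<ominus> c [^] (n + N) \<otimes> (s \<otimes> q [^] K) = j \<otimes> q [^] K"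
    proof -
      have "c [^] N \<otimes> r \<otimes> q [^] (N + K) = (r \<otimes> prodl (c # as) [^] N) \<otimes> q [^] K"
        using as qc r by (simp add: q_def[symmetric] pow_mult_distrib m_comm m_ac nat_pow_mult[symmetric])
      also have "\<dots> = (s \<otimes> c [^] (n + N) \<oplus> j) \<otimes> q [^] K" unfolding e ..
      finally show ?thesis using s jc cn[of "n + N"] qn[of K] by algebra
    qed
    ultimately have "represents as (n + N + K) g (j \<otimes> q [^] K)"
      unfolding g_def using yc y3c cn by (simp add: E.smult_minus)
    moreover have "j \<otimes> q [^] K \<otimes> q [^] (0::nat) \<in> power_ideal as (n + N + K + 0)"
      using power_ideal_shift[OF as(1) j, of K] qn jc unfolding q_def[symmetric] by simp
    ultimately have coboundary: "coboundary as g" using Cons.IH[OF as(2)] unfolding q_def by blast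
    define w0 where "w0 = y \<ominus>\<^bsub>E p\<^esub> y3"
    have w0: "w0 \<in> tors as p" unfolding w0_def by (rule tors_minus[OF as(1) y(1) y3t])
    have w0c: "w0 \<in> carrier (E p)" using w0 tors_carr by blast
    have dw0: "d p w0 = z" unfolding w0_def using y yc y3c dy3 by (simp add: d_minus)
    show "coboundary (c # as) z"
    proof (cases as)
      case Nil
      have "sm p (c [^] (n + N)) w0 = Z0 p" using coboundary Nil unfolding g_def w0_def p_def by simp
      then have "w0 \<in> tors (c # as) p" using w0 unfolding tors_Cons by blast
      then show ?thesis using dw0 unfolding p_def by auto
    next
      case (Cons b as')
      define k where "k = length as'"
      have pk: "p = Suc k" unfolding p_def k_def Cons by simp
      obtain s' where s': "s' \<in> tors as k" "d k s' = g" using coboundary unfolding Cons k_def by auto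
      have s'c: "s' \<in> carrier (E k)" using s' tors_carr by blast
      obtain v N2 where v: "v \<in> tors as k" and N2: "sm k (c [^] (N2 + (n + N))) v = sm k (c [^] (N2::nat)) s'"
        using divide_by_power[OF as(3,1,4) s'(1)] by blast
      have vc: "v \<in> carrier (E k)" using v tors_carr by blast
      define w where "w = w0 \<ominus>\<^bsub>E p\<^esub> d k v"
      have w: "w \<in> tors as p" unfolding w_def using w0 tors_d[OF as(1) v] tors_minus[OF as(1)] pk by simp
      have "sm p (c [^] (N2 + (n + N))) w = sm p (c [^] (N2 + (n + N))) w0 \<ominus>\<^bsub>E p\<^esub> d k (sm k (c [^] (N2 + (n + N))) v)"
        unfolding w_def using w0c vc cn pk by (simp add: E.smult_minus d_smult)
      also have "\<dots> = sm p (c [^] (N2 + (n + N))) w0 \<ominus>\<^bsub>E p\<^esub> sm p (c [^] N2) g"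
        unfolding N2 using s'(2) s'c cn pk by (simp add: d_smult)
      also have "\<dots> = Z0 p"
        unfolding g_def w0_def[symmetric] using w0c cn E.smult_pow_pow[OF as(4) w0c, of N2 "n + N"]
        by simp
      finally have "w \<in> tors (c # as) p" using w unfolding tors_Cons by blast
      moreover have "d p w = z" unfolding w_def using dw0 w0c vc pk d_closed[of w0 p] by (simp add: d_minus)
      ultimately show ?thesis unfolding p_def by auto
    qed
  qed
qed


subsection \<open>Torsion with respect to an ideal\<close>

lemma ideals_set_simps [simp]: "\<one>\<^bsub>ideals_set R\<^esub> = carrier R" "I \<otimes>\<^bsub>ideals_set R\<^esub> J = ideal_prod R I J"
  by (simp_all add: ideals_set_def)

lemma ideals_pow_0: "I [^]\<^bsub>ideals_set R\<^esub> (0::nat) = carrier R"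
  by (simp add: nat_pow_def ideals_set_def)

lemma ideals_pow_Suc: "I [^]\<^bsub>ideals_set R\<^esub> (Suc n) = ideal_prod R (I [^]\<^bsub>ideals_set R\<^esub> n) I"
  by (simp add: nat_pow_def ideals_set_def)

lemma ideals_pow_ideal: "ideal I R \<Longrightarrow> ideal (I [^]\<^bsub>ideals_set R\<^esub> (n::nat)) R"
  by (induction n) (simp_all add: ideals_pow_0 ideals_pow_Suc oneideal ideal_prod_is_ideal)

text \<open>
  Multiplication by a generator \<open>a\<close> lowers the exponent of \<open>a\<close> by one, so the claim follows by
  induction on the sum of the exponents. The extra factor of the ideal covers the empty set of
  generators.
\<close>

lemma ideal_power_kills:
  assumes "finite A" "A \<subseteq> carrier R" "x \<in> carrier (E i)"
    "\<And>a. a \<in> A \<Longrightarrow> sm i (a [^] (e a :: nat)) x = Z0 i" "sum e A = k"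
  shows "\<forall>u\<in>(Idl A) [^]\<^bsub>ideals_set R\<^esub> (Suc k). sm i u x = Z0 i"
  using assms(3-)
proof (induction k arbitrary: e x rule: less_induct)
  case (less k)
  have I: "ideal (Idl A) R" by (rule genideal_ideal[OF assms(2)])
  define Ik where "Ik = (Idl A) [^]\<^bsub>ideals_set R\<^esub> k"
  have Ik: "ideal Ik R" unfolding Ik_def by (rule ideals_pow_ideal[OF I])
  define W where "W = {w \<in> carrier R. \<forall>v\<in>Ik. sm i (v \<otimes> w) x = Z0 i}"
  have W: "ideal W R"
    unfolding W_def using ideal_carr[OF Ik] less.prems(1)
    by (intro idealI_closed)
       (auto simp: r_distr E.smult_l_distr m_lcomm[of _ _ "_::'a"] E.smult_assoc1[of "_ :: 'a" "_ \<otimes> _"])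
  have "A \<subseteq> W"
  proof
    fix a assume a: "a \<in> A"
    then have ac: "a \<in> carrier R" using assms by auto
    have "sm i (v \<otimes> a) x = Z0 i" if v: "v \<in> Ik" for v
    proof (cases "e a")
      case 0
      then have "x = Z0 i" using less.prems(2)[OF a] less.prems(1) by simp
      then show ?thesis using v ac ideal_carr[OF Ik] by simp
    next
      case (Suc m)
      define e' where "e' = e(a := m)"
      have s: "sum e A = Suc (sum e' A)"
        unfolding e'_def using a assms(1) Suc sum.cong[of "A - {a}" "A - {a}" e "e(a := m)"]
        by (simp add: sum.remove[of A a])
      have k: "sum e' A < k" "k = Suc (sum e' A)" using s less.prems(3) by auto
      have "sm i (b [^] e' b) (sm i a x) = Z0 i" if b: "b \<in> A" for b
      proof (cases "b = a")
        case True
        then show ?thesis using less.prems(2)[OF a] Suc ac less.prems(1)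
          by (simp add: e'_def E.smult_assoc1[symmetric])
      next
        case False
        have bc: "b [^] e b \<in> carrier R" using b assms by auto
        have "sm i (b [^] e b) (sm i a x) = sm i a (sm i (b [^] e b) x)"
          using ac bc less.prems(1) by (simp add: E.smult_assoc1[symmetric] m_comm)
        then show ?thesis using less.prems(2)[OF b] ac False by (simp add: e'_def)
      qed
      then have "\<forall>u\<in>(Idl A) [^]\<^bsub>ideals_set R\<^esub> (Suc (sum e' A)). sm i u (sm i a x) = Z0 i"
        using less.IH[OF k(1), of "sm i a x" e'] ac less.prems(1) by simp
      then show ?thesis using v ac ideal_carr[OF Ik] less.prems(1) k(2)
        unfolding Ik_def by (simp add: E.smult_assoc1)
    qed
    then show "a \<in> W" unfolding W_def using ac by blast
  qed
  then have "Idl A \<subseteq> W" by (rule Idl_least[OF W])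
  have "sm i u x = Z0 i" if "u \<in> ideal_prod R Ik (Idl A)" for u
    using that
  proof (induction u rule: ideal_prod.induct)
    case (prod v w)
    then show ?case using \<open>Idl A \<subseteq> W\<close> unfolding W_def by blast
  next
    case (sum s1 s2)
    then have "s1 \<in> carrier R" "s2 \<in> carrier R" using ideal_prod_in_carrier[OF Ik I] by auto
    then show ?case using sum less.prems(1) by (simp add: E.smult_l_distr)
  qed
  then show ?case unfolding ideals_pow_Suc Ik_def by blast
qed

lemma tors_iff_ideal_power:
  assumes as: "set as \<subseteq> carrier R" and x: "x \<in> carrier (E i)"
  shows "x \<in> tors as i \<longleftrightarrow> (\<exists>n::nat. \<forall>u\<in>(Idl (set as)) [^]\<^bsub>ideals_set R\<^esub> n. sm i u x = Z0 i)"
proof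
  assume "x \<in> tors as i"
  then obtain e :: "'a \<Rightarrow> nat" where "\<And>a. a \<in> set as \<Longrightarrow> sm i (a [^] e a) x = Z0 i"
    unfolding tors_def mem_Collect_eq by metis
  then show "\<exists>n::nat. \<forall>u\<in>(Idl (set as)) [^]\<^bsub>ideals_set R\<^esub> n. sm i u x = Z0 i"
    using ideal_power_kills[OF _ as x, of e] by blast
next
  assume "\<exists>n::nat. \<forall>u\<in>(Idl (set as)) [^]\<^bsub>ideals_set R\<^esub> n. sm i u x = Z0 i"
  then obtain n :: nat where n: "\<And>u. u \<in> (Idl (set as)) [^]\<^bsub>ideals_set R\<^esub> n \<Longrightarrow> sm i u x = Z0 i" by blast
  have "a [^] m \<in> (Idl (set as)) [^]\<^bsub>ideals_set R\<^esub> m" if a: "a \<in> set as" for a and m :: nat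
    by (induction m) (use a as Idl_self[OF as a] in \<open>auto simp: ideals_pow_0 ideals_pow_Suc intro: ideal_prod.prod\<close>)
  then show "x \<in> tors as i" using n x unfolding tors_def by blast
qed

lemma torsion_module_eq:
  assumes "set as \<subseteq> carrier R"
  shows "torsion_module R (Idl (set as)) (E i) = (E i)\<lparr>carrier := tors as i\<rparr>"
  unfolding torsion_module_def using tors_iff_ideal_power[OF assms] tors_carr
  by (intro arg_cong[of _ _ "\<lambda>c. (E i)\<lparr>carrier := c\<rparr>"]) blast

lemma nilpotent_on_torsion:
  assumes as: "set as \<subseteq> carrier R" and x: "x \<in> tors as i" and w: "w \<in> Idl (set as)"
  shows "\<exists>n::nat. sm i (w [^] n) x = Z0 i"
proof -
  obtain n :: nat where n: "\<And>u. u \<in> (Idl (set as)) [^]\<^bsub>ideals_set R\<^esub> n \<Longrightarrow> sm i u x = Z0 i"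
    using x tors_iff_ideal_power[OF as tors_carr[OF x]] by blast
  have "w [^] m \<in> (Idl (set as)) [^]\<^bsub>ideals_set R\<^esub> m" for m :: nat
    by (induction m) (use w in \<open>auto simp: ideals_pow_0 ideals_pow_Suc intro: ideal_prod.prod\<close>)
  then show ?thesis using n by blast
qed

subsection \<open>Elements of local cohomology\<close>

definition coboundary_set :: "'a list \<Rightarrow> nat \<Rightarrow> 'm set" where
  "coboundary_set as j = d j ` tors as j"

definition cocycle_class :: "'a list \<Rightarrow> nat \<Rightarrow> 'm \<Rightarrow> 'm set" where
  "cocycle_class as j z = {h \<oplus>\<^bsub>E (Suc j)\<^esub> z | h. h \<in> coboundary_set as j}"

context
  fixes as :: "'a list"
  assumes as: "set as \<subseteq> carrier R"
begin

abbreviation "H \<equiv> \<lambda>j. local_cohomology R (Idl (set as)) E d (Suc j)"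

lemma H_carrier:
  "carrier (H j) = cocycle_class as j ` {z \<in> tors as (Suc j). d (Suc j) z = Z0 (Suc (Suc j))}"
  unfolding local_cohomology_def cohomology_def quotient_module_def torsion_module_eq[OF as]
  by (auto simp: A_RCOSETS_def RCOSETS_def r_coset_def a_kernel_def kernel_def cocycle_class_def coboundary_set_def)

lemma H_zero: "\<zero>\<^bsub>H j\<^esub> = coboundary_set as j"
  unfolding local_cohomology_def cohomology_def quotient_module_def torsion_module_eq[OF as]
  by (simp add: coboundary_set_def)

lemma H_smult: "s \<odot>\<^bsub>H j\<^esub> C = (\<Union>x\<in>C. cocycle_class as j (sm (Suc j) s x))"
  unfolding local_cohomology_def cohomology_def quotient_module_def torsion_module_eq[OF as]
  by (auto simp: a_r_coset_def r_coset_def cocycle_class_def coboundary_set_def)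

lemma coboundary_set_zero: "Z0 (Suc j) \<in> coboundary_set as j"
  unfolding coboundary_set_def using tors_zero[OF as, of j] by (auto intro!: image_eqI[of _ _ "Z0 j"])

lemma coboundary_set_carr: "x \<in> coboundary_set as j \<Longrightarrow> x \<in> carrier (E (Suc j))"
  unfolding coboundary_set_def using tors_carr by auto

lemma coboundary_set_smult: "r \<in> carrier R \<Longrightarrow> x \<in> coboundary_set as j \<Longrightarrow> sm (Suc j) r x \<in> coboundary_set as j"
  unfolding coboundary_set_def using tors_smult[OF as] tors_carr by (auto simp: d_smult[symmetric])

lemma coboundary_set_minus: "x \<in> coboundary_set as j \<Longrightarrow> y \<in> coboundary_set as j \<Longrightarrow> x \<ominus>\<^bsub>E (Suc j)\<^esub> y \<in> coboundary_set as j"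
  unfolding coboundary_set_def using tors_minus[OF as] tors_carr by (auto simp: d_minus[symmetric])

lemma coboundary_set_add: "x \<in> coboundary_set as j \<Longrightarrow> y \<in> coboundary_set as j \<Longrightarrow> x \<oplus>\<^bsub>E (Suc j)\<^esub> y \<in> coboundary_set as j"
proof -
  assume x: "x \<in> coboundary_set as j" and y: "y \<in> coboundary_set as j"
  have "Z0 (Suc j) \<ominus>\<^bsub>E (Suc j)\<^esub> y \<in> coboundary_set as j" by (rule coboundary_set_minus[OF coboundary_set_zero y])
  from coboundary_set_minus[OF x this] show ?thesis using coboundary_set_carr[OF x] coboundary_set_carr[OF y]
    by (simp add: E.M.minus_eq)
qed

lemma cocycle_class_eq_cobs: "z \<in> coboundary_set as j \<Longrightarrow> cocycle_class as j z = coboundary_set as j"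
proof
  assume z: "z \<in> coboundary_set as j"
  show "cocycle_class as j z \<subseteq> coboundary_set as j" unfolding cocycle_class_def using coboundary_set_add z by auto
  show "coboundary_set as j \<subseteq> cocycle_class as j z"
  proof
    fix x assume x: "x \<in> coboundary_set as j"
    then have "x = (x \<ominus>\<^bsub>E (Suc j)\<^esub> z) \<oplus>\<^bsub>E (Suc j)\<^esub> z" using coboundary_set_carr[OF x] coboundary_set_carr[OF z]
      by (simp add: E.M.minus_eq E.M.a_assoc E.M.l_neg)
    then show "x \<in> cocycle_class as j z" unfolding cocycle_class_def using coboundary_set_minus[OF x z] by blast
  qed
qed

lemma H_smult_zero_iff:
  assumes s: "s \<in> carrier R" and z: "z \<in> carrier (E (Suc j))"
  shows "s \<odot>\<^bsub>H j\<^esub> cocycle_class as j z = \<zero>\<^bsub>H j\<^esub> \<longleftrightarrow> sm (Suc j) s z \<in> coboundary_set as j"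
proof
  assume *: "s \<odot>\<^bsub>H j\<^esub> cocycle_class as j z = \<zero>\<^bsub>H j\<^esub>"
  have "z \<in> cocycle_class as j z" unfolding cocycle_class_def using coboundary_set_zero z by (auto intro!: exI[of _ "Z0 (Suc j)"])
  moreover have "sm (Suc j) s z \<in> cocycle_class as j (sm (Suc j) s z)"
    unfolding cocycle_class_def using coboundary_set_zero s z by (auto intro!: exI[of _ "Z0 (Suc j)"])
  ultimately show "sm (Suc j) s z \<in> coboundary_set as j" using * unfolding H_smult H_zero by blast
next
  assume *: "sm (Suc j) s z \<in> coboundary_set as j"
  have "cocycle_class as j (sm (Suc j) s x) = coboundary_set as j" if x: "x \<in> cocycle_class as j z" for x
  proof -
    from x obtain h where h: "h \<in> coboundary_set as j" "x = h \<oplus>\<^bsub>E (Suc j)\<^esub> z" unfolding cocycle_class_def by blast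
    then have "sm (Suc j) s x = sm (Suc j) s h \<oplus>\<^bsub>E (Suc j)\<^esub> sm (Suc j) s z"
      using coboundary_set_carr[OF h(1)] s z by (simp add: E.smult_r_distr)
    then show ?thesis using cocycle_class_eq_cobs coboundary_set_add coboundary_set_smult h s * by simp
  qed
  moreover have "cocycle_class as j z \<noteq> {}" unfolding cocycle_class_def using coboundary_set_zero by auto
  ultimately show "s \<odot>\<^bsub>H j\<^esub> cocycle_class as j z = \<zero>\<^bsub>H j\<^esub>" unfolding H_smult H_zero by auto
qed

lemma associated_prime_cocycle:
  assumes "P \<in> associated_primes R (H j)"
  shows "primeideal P R \<and> (\<exists>z\<in>tors as (Suc j). d (Suc j) z = Z0 (Suc (Suc j)) \<and>
     P = {s \<in> carrier R. sm (Suc j) s z \<in> coboundary_set as j})"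
proof -
  obtain C where P: "primeideal P R" "C \<in> carrier (H j)" "P = {s \<in> carrier R. s \<odot>\<^bsub>H j\<^esub> C = \<zero>\<^bsub>H j\<^esub>}"
    using assms unfolding associated_primes_def by blast
  then obtain z where z: "z \<in> tors as (Suc j)" "d (Suc j) z = Z0 (Suc (Suc j))" "C = cocycle_class as j z"
    unfolding H_carrier by blast
  then have "P = {s \<in> carrier R. sm (Suc j) s z \<in> coboundary_set as j}"
    using P(3) H_smult_zero_iff[OF _ tors_carr[OF z(1)]] by blast
  then show ?thesis using P z by blast
qed

text \<open>
  If \<open>y\<close> is outside \<open>P\<close>, its powers are admissible denominators, and they make all fractions equal.
\<close>

lemma module_support_mem:
  assumes y: "y \<in> carrier R" and P: "P \<in> module_support R (H j)"
    and nil: "\<And>z. z \<in> tors as (Suc j) \<Longrightarrow> d (Suc j) z = Z0 (Suc (Suc j)) \<Longrightarrow>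
      \<exists>n::nat. sm (Suc j) (y [^] n) z \<in> coboundary_set as j"
  shows "y \<in> P"
proof (rule ccontr)
  assume yP: "y \<notin> P"
  have pr: "primeideal P R" using P unfolding module_support_def by blast
  have Pi: "ideal P R" using primeideal.axioms(1)[OF pr] .
  have one: "\<one> \<notin> P" using primeideal.I_notcarr[OF pr] ideal.one_imp_carrier[OF Pi] by auto
  have powP: "y [^] n \<in> carrier R - P" for n :: nat
  proof (induction n)
    case (Suc n)
    then show ?case using primeideal.I_prime[OF pr, of "y [^] n" y] y yP by auto
  qed (use one in auto)
  have multP: "u \<otimes> v \<in> carrier R - P" if "u \<in> carrier R - P" "v \<in> carrier R - P" for u v
    using primeideal.I_prime[OF pr, of u v] that by auto
  have kill: "\<exists>n::nat. \<forall>t\<in>carrier R. (y [^] n \<otimes> t) \<odot>\<^bsub>H j\<^esub> C = \<zero>\<^bsub>H j\<^esub>" if C: "C \<in> carrier (H j)" for C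
  proof -
    obtain z where z: "z \<in> tors as (Suc j)" "d (Suc j) z = Z0 (Suc (Suc j))" "C = cocycle_class as j z"
      using C unfolding H_carrier by blast
    obtain n :: nat where n: "sm (Suc j) (y [^] n) z \<in> coboundary_set as j" using nil[OF z(1,2)] by blast
    have zc: "z \<in> carrier (E (Suc j))" using tors_carr[OF z(1)] .
    have "sm (Suc j) (y [^] n \<otimes> t) z \<in> coboundary_set as j" if t: "t \<in> carrier R" for t
      using coboundary_set_smult[OF t n] y t zc by (simp add: E.smult_assoc1[symmetric] m_comm)
    then show ?thesis using H_smult_zero_iff[OF _ zc] y z(3) by (intro exI[of _ n]) auto
  qed
  define D where "D = carrier (H j) \<times> (carrier R - P)"
  have rel: "fraction_rel R (H j) P = D \<times> D"
  proof
    show "fraction_rel R (H j) P \<subseteq> D \<times> D" unfolding fraction_rel_def D_def by auto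
    show "D \<times> D \<subseteq> fraction_rel R (H j) P"
    proof
      fix e assume "e \<in> D \<times> D"
      then obtain C s C' t where e: "e = ((C, s), (C', t))" and *: "C \<in> carrier (H j)" "s \<in> carrier R - P"
        "C' \<in> carrier (H j)" "t \<in> carrier R - P" unfolding D_def by auto
      obtain n m :: nat where n: "\<And>t. t \<in> carrier R \<Longrightarrow> (y [^] n \<otimes> t) \<odot>\<^bsub>H j\<^esub> C = \<zero>\<^bsub>H j\<^esub>"
        and m: "\<And>t. t \<in> carrier R \<Longrightarrow> (y [^] m \<otimes> t) \<odot>\<^bsub>H j\<^esub> C' = \<zero>\<^bsub>H j\<^esub>"
        using kill[OF *(1)] kill[OF *(3)] by blast
      define u where "u = y [^] n \<otimes> y [^] m"
      have u: "u \<in> carrier R - P" unfolding u_def by (rule multP[OF powP powP])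
      have "u \<otimes> t = y [^] n \<otimes> (y [^] m \<otimes> t)" "u \<otimes> s = y [^] m \<otimes> (y [^] n \<otimes> s)"
        unfolding u_def using y * by (auto simp: m_ac)
      then have "(u \<otimes> t) \<odot>\<^bsub>H j\<^esub> C = (u \<otimes> s) \<odot>\<^bsub>H j\<^esub> C'"
        using n[of "y [^] m \<otimes> t"] m[of "y [^] n \<otimes> s"] y * by simp
      then show "e \<in> fraction_rel R (H j) P" unfolding e fraction_rel_def using u * by blast
    qed
  qed
  have zD: "(\<zero>\<^bsub>H j\<^esub>, \<one>) \<in> D"
  proof -
    have "cocycle_class as j (Z0 (Suc j)) \<in> carrier (H j)"
      unfolding H_carrier using tors_zero[OF as] by auto
    then show ?thesis unfolding D_def H_zero using one cocycle_class_eq_cobs[OF coboundary_set_zero] by auto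
  qed
  then have "localization_zero R (H j) P = D" "localization R (H j) P = {D}"
    unfolding localization_zero_def localization_def rel D_def[symmetric] quotient_def by auto
  then show False using P unfolding module_support_def by auto
qed

end

end


section \<open>Finite sums\<close>

context cring
begin

text \<open>
  The rules for \<open>finsum\<close>, with pointwise hypotheses on the summands.
\<close>

lemma fs_closed [simp]: "(\<And>i. i \<in> A \<Longrightarrow> f i \<in> carrier R) \<Longrightarrow> finsum R f A \<in> carrier R"
  by (rule finsum_closed) auto

lemma fs_insert: "finite A \<Longrightarrow> a \<notin> A \<Longrightarrow> (\<And>i. i \<in> insert a A \<Longrightarrow> f i \<in> carrier R) \<Longrightarrow>
    finsum R f (insert a A) = f a \<oplus> finsum R f A"
  by (rule finsum_insert) auto

lemma fs_cong: "(\<And>i. i \<in> A \<Longrightarrow> g i \<in> carrier R) \<Longrightarrow> (\<And>i. i \<in> A \<Longrightarrow> f i = g i) \<Longrightarrow>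
    finsum R f A = finsum R g A"
  by (rule finsum_cong') auto

lemma fs_add: "(\<And>i. i \<in> A \<Longrightarrow> f i \<in> carrier R) \<Longrightarrow> (\<And>i. i \<in> A \<Longrightarrow> g i \<in> carrier R) \<Longrightarrow>
    finsum R (\<lambda>i. f i \<oplus> g i) A = finsum R f A \<oplus> finsum R g A"
  by (rule finsum_addf) auto

lemma fs_lmult: "finite A \<Longrightarrow> a \<in> carrier R \<Longrightarrow> (\<And>i. i \<in> A \<Longrightarrow> f i \<in> carrier R) \<Longrightarrow>
    a \<otimes> finsum R f A = finsum R (\<lambda>i. a \<otimes> f i) A"
  by (rule finsum_rdistr) auto

lemma fs_rmult: "finite A \<Longrightarrow> a \<in> carrier R \<Longrightarrow> (\<And>i. i \<in> A \<Longrightarrow> f i \<in> carrier R) \<Longrightarrow>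
    finsum R f A \<otimes> a = finsum R (\<lambda>i. f i \<otimes> a) A"
  by (rule finsum_ldistr) auto

lemma fs_zero: "(\<And>i. i \<in> A \<Longrightarrow> f i = \<zero>) \<Longrightarrow> finsum R f A = \<zero>"
  by (rule trans[OF fs_cong[of A "\<lambda>_. \<zero>"] finsum_zero]) simp_all

lemma fs_diff:
  assumes "finite A" "\<And>i. i \<in> A \<Longrightarrow> f i \<in> carrier R" "\<And>i. i \<in> A \<Longrightarrow> g i \<in> carrier R"
  shows "finsum R (\<lambda>i. f i \<ominus> g i) A = finsum R f A \<ominus> finsum R g A"
proof -
  have neg: "\<ominus> a = (\<ominus> \<one>) \<otimes> a" if "a \<in> carrier R" for a using that by algebra
  have "finsum R (\<lambda>i. f i \<ominus> g i) A = finsum R (\<lambda>i. f i \<oplus> (\<ominus> \<one>) \<otimes> g i) A"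
  proof (rule fs_cong)
    show "f i \<ominus> g i = f i \<oplus> (\<ominus> \<one>) \<otimes> g i" if "i \<in> A" for i
      using neg[OF assms(3)[OF that]] by (simp add: minus_eq)
  qed (use assms in auto)
  also have "\<dots> = finsum R f A \<oplus> (\<ominus> \<one>) \<otimes> finsum R g A"
    using assms by (simp add: fs_add fs_lmult)
  also have "\<dots> = finsum R f A \<ominus> finsum R g A"
    using neg[of "finsum R g A"] assms by (simp add: minus_eq)
  finally show ?thesis .
qed

lemma fs_ideal: "ideal I R \<Longrightarrow> finite A \<Longrightarrow> (\<And>i. i \<in> A \<Longrightarrow> f i \<in> I) \<Longrightarrow> finsum R f A \<in> I"
proof (rotate_tac 1, induction A rule: finite_induct)
  case empty
  then show ?case using ideal_zero by simp
next
  case (insert a A)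
  then have "finsum R f (insert a A) = f a \<oplus> finsum R f A"
    by (intro fs_insert) (auto dest: ideal_carr)
  then show ?case using insert ideal_add by simp
qed

lemma fs_remove:
  assumes "finite A" "a \<in> A" "\<And>i. i \<in> A \<Longrightarrow> f i \<in> carrier R"
  shows "finsum R f A = f a \<oplus> finsum R f (A - {a})"
  using fs_insert[of "A - {a}" a f] assms by (simp add: insert_absorb)

lemma fs_single:
  assumes "finite A" "a \<in> A" "f a \<in> carrier R" "\<And>i. i \<in> A \<Longrightarrow> i \<noteq> a \<Longrightarrow> f i = \<zero>"
  shows "finsum R f A = f a"
proof -
  have "finsum R f A = f a \<oplus> finsum R f (A - {a})"
    by (rule fs_remove) (use assms in \<open>auto, metis zero_closed\<close>)
  moreover have "finsum R f (A - {a}) = \<zero>" by (rule fs_zero) (use assms in auto)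
  ultimately show ?thesis using assms by simp
qed

lemma fs_Un: "finite A \<Longrightarrow> finite B \<Longrightarrow> A \<inter> B = {} \<Longrightarrow> (\<And>i. i \<in> A \<union> B \<Longrightarrow> f i \<in> carrier R) \<Longrightarrow>
    finsum R f (A \<union> B) = finsum R f A \<oplus> finsum R f B"
  by (rule finsum_Un_disjoint) auto

lemma fs_reindex: "inj_on h A \<Longrightarrow> (\<And>i. i \<in> A \<Longrightarrow> f (h i) \<in> carrier R) \<Longrightarrow>
    finsum R f (h ` A) = finsum R (\<lambda>i. f (h i)) A"
  by (rule finsum_reindex) auto

lemma fs_swap:
  assumes "finite A" "finite B" "\<And>a b. a \<in> A \<Longrightarrow> b \<in> B \<Longrightarrow> f a b \<in> carrier R"
  shows "finsum R (\<lambda>a. finsum R (f a) B) A = finsum R (\<lambda>b. finsum R (\<lambda>a. f a b) A) B"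
  using assms(1,3)
proof (induction A rule: finite_induct)
  case empty
  then show ?case by (simp add: fs_zero)
next
  case (insert a A)
  have "finsum R (\<lambda>a. finsum R (f a) B) (insert a A) =
      finsum R (f a) B \<oplus> finsum R (\<lambda>b. finsum R (\<lambda>a. f a b) A) B"
    using insert by (subst fs_insert) auto
  also have "\<dots> = finsum R (\<lambda>b. f a b \<oplus> finsum R (\<lambda>a. f a b) A) B"
    using insert by (subst fs_add) auto
  also have "\<dots> = finsum R (\<lambda>b. finsum R (\<lambda>a. f a b) (insert a A)) B"
    by (rule fs_cong) (use insert in \<open>auto simp: fs_insert\<close>)
  finally show ?case .
qed

lemma fs_Sigma:
  assumes "finite A" "\<And>a. a \<in> A \<Longrightarrow> finite (B a)" "\<And>a b. a \<in> A \<Longrightarrow> b \<in> B a \<Longrightarrow> f (a, b) \<in> carrier R"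
  shows "finsum R f (Sigma A B) = finsum R (\<lambda>a. finsum R (\<lambda>b. f (a, b)) (B a)) A"
  using assms
proof (induction A rule: finite_induct)
  case empty
  then show ?case by simp
next
  case (insert a A)
  have "Sigma (insert a A) B = Pair a ` B a \<union> Sigma A B" by auto
  then have "finsum R f (Sigma (insert a A) B) = finsum R f (Pair a ` B a) \<oplus> finsum R f (Sigma A B)"
    using insert by (simp only:) (rule fs_Un, auto)
  also have "finsum R f (Pair a ` B a) = finsum R (\<lambda>b. f (a, b)) (B a)"
    using insert by (intro fs_reindex) (auto intro: inj_onI)
  finally show ?case using insert by (simp add: fs_insert)
qed

lemma Idl_image_finsum:
  assumes "finite A" "\<And>a. a \<in> A \<Longrightarrow> f a \<in> carrier R" "r \<in> Idl (f ` A)"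
  shows "\<exists>c. (\<forall>a\<in>A. c a \<in> carrier R) \<and> r = finsum R (\<lambda>a. c a \<otimes> f a) A"
  using assms
proof (induction A arbitrary: r rule: finite_induct)
  case empty
  then show ?case by (simp add: Idl_empty)
next
  case (insert a A)
  obtain s j where s: "s \<in> carrier R" "j \<in> Idl (f ` A)" "r = s \<otimes> f a \<oplus> j"
    using insert.prems Idl_insert[of "f ` A" "f a"] by auto
  obtain c where c: "\<forall>a\<in>A. c a \<in> carrier R" "j = finsum R (\<lambda>a. c a \<otimes> f a) A"
    using insert.IH[OF _ s(2)] insert.prems by auto
  have "finsum R (\<lambda>b. (c(a := s)) b \<otimes> f b) (insert a A) =
      s \<otimes> f a \<oplus> finsum R (\<lambda>b. (c(a := s)) b \<otimes> f b) A"
    using insert s c by (subst fs_insert) auto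
  also have "finsum R (\<lambda>b. (c(a := s)) b \<otimes> f b) A = j"
    unfolding c(2) by (rule fs_cong) (use insert c in auto)
  finally show ?case using s c by (intro exI[of _ "c(a := s)"]) auto
qed

lemma ideal_sum_mult:
  assumes I: "ideal I R" and J: "ideal J R" and c: "c \<in> carrier R"
  shows "ideal {u \<oplus> c \<otimes> w | u w. u \<in> I \<and> w \<in> J} R" (is "ideal ?K R")
proof (rule idealI_closed)
  show "?K \<subseteq> carrier R" using ideal_carr[OF I] ideal_carr[OF J] c by auto
  have "\<zero> = \<zero> \<oplus> c \<otimes> \<zero>" using c by simp
  then show "\<zero> \<in> ?K" using ideal_zero[OF I] ideal_zero[OF J] by blast
  show "a \<oplus> b \<in> ?K" if ab: "a \<in> ?K" "b \<in> ?K" for a b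
  proof -
    from ab obtain u w u' w' where *: "u \<in> I" "w \<in> J" "a = u \<oplus> c \<otimes> w" "u' \<in> I" "w' \<in> J" "b = u' \<oplus> c \<otimes> w'"
      by auto
    then have cc: "u \<in> carrier R" "w \<in> carrier R" "u' \<in> carrier R" "w' \<in> carrier R"
      using ideal_carr[OF I] ideal_carr[OF J] by auto
    have "a \<oplus> b = (u \<oplus> u') \<oplus> c \<otimes> (w \<oplus> w')" using * cc c by algebra
    then show ?thesis using * ideal_add[OF I] ideal_add[OF J] by blast
  qed
  show "r \<otimes> a \<in> ?K" if ar: "a \<in> ?K" "r \<in> carrier R" for a r
  proof -
    from ar obtain u w where *: "u \<in> I" "w \<in> J" "a = u \<oplus> c \<otimes> w" by auto
    then have cc: "u \<in> carrier R" "w \<in> carrier R" using ideal_carr[OF I] ideal_carr[OF J] by auto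
    have "r \<otimes> a = (r \<otimes> u) \<oplus> c \<otimes> (r \<otimes> w)" using * cc c ar by algebra
    then show ?thesis using * ar ideal_lmult[OF I] ideal_lmult[OF J] by blast
  qed
qed

end

section \<open>Monomials in a regular sequence\<close>

locale monomials = cring R for R :: "('a, 'b) ring_scheme" (structure) +
  fixes x :: "'i \<Rightarrow> 'a" and V :: "'i set"
  assumes finV: "finite V" and xV: "i \<in> V \<Longrightarrow> x i \<in> carrier R"
begin

text \<open>
  The monomial \<open>x^\<alpha>\<close>. Exponents are multisets of indices.
\<close>

definition xm :: "'i multiset \<Rightarrow> 'a" where
  "xm \<alpha> = (\<Otimes>i\<in>V. x i [^] count \<alpha> i)"

lemma xm_closed [simp]: "xm \<alpha> \<in> carrier R"
  unfolding xm_def by (rule finprod_closed) (auto simp: xV)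

lemma xm_empty [simp]: "xm {#} = \<one>"
  unfolding xm_def by (simp add: finprod_one_eqI)

lemma xm_add: "xm (\<alpha> + \<beta>) = xm \<alpha> \<otimes> xm \<beta>"
proof -
  have "xm \<alpha> \<otimes> xm \<beta> = (\<Otimes>i\<in>V. x i [^] count \<alpha> i \<otimes> x i [^] count \<beta> i)"
    unfolding xm_def by (rule finprod_multf[symmetric]) (auto simp: xV)
  also have "\<dots> = xm (\<alpha> + \<beta>)"
    unfolding xm_def by (rule finprod_cong') (auto simp: xV nat_pow_mult)
  finally show ?thesis by simp
qed

lemma xm_single: "i \<in> V \<Longrightarrow> xm {#i#} = x i"
proof -
  assume i: "i \<in> V"
  have "xm {#i#} = (\<Otimes>j\<in>V. if i = j then x j else \<one>)"
    unfolding xm_def by (rule finprod_cong') (auto simp: xV)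
  also have "\<dots> = x i" using finprod_singleton[OF i finV, of x] xV by auto
  finally show ?thesis .
qed

lemma xm_add_mset: "i \<in> V \<Longrightarrow> xm (add_mset i \<alpha>) = x i \<otimes> xm \<alpha>"
  using xm_add[of "{#i#}" \<alpha>] by (simp add: xm_single)

lemma xm_remove: "i \<in> V \<Longrightarrow> i \<in># \<alpha> \<Longrightarrow> xm \<alpha> = x i \<otimes> xm (\<alpha> - {#i#})"
  using xm_add_mset[of i "\<alpha> - {#i#}"] by simp

definition mon_ideal :: "'i multiset set \<Rightarrow> 'a set" where
  "mon_ideal B = Idl (xm ` B)"

lemma mon_ideal_ideal: "ideal (mon_ideal B) R"
  unfolding mon_ideal_def by (rule genideal_ideal) auto

lemma mon_ideal_self: "\<beta> \<in> B \<Longrightarrow> xm \<beta> \<in> mon_ideal B"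
  unfolding mon_ideal_def by (rule Idl_self) auto

lemma mon_ideal_mono: "B \<subseteq> C \<Longrightarrow> mon_ideal B \<subseteq> mon_ideal C"
  unfolding mon_ideal_def by (rule Idl_mono) auto

lemma mon_ideal_least: "ideal I R \<Longrightarrow> (\<And>\<beta>. \<beta> \<in> B \<Longrightarrow> xm \<beta> \<in> I) \<Longrightarrow> mon_ideal B \<subseteq> I"
  unfolding mon_ideal_def by (rule Idl_least) auto

lemma mon_ideal_split:
  assumes j: "j \<in> V"
  shows "mon_ideal B \<subseteq> {u \<oplus> x j \<otimes> w | u w. u \<in> mon_ideal {\<beta> \<in> B. j \<notin># \<beta>} \<and> w \<in> mon_ideal ((\<lambda>\<beta>. \<beta> - {#j#}) ` {\<beta> \<in> B. j \<in># \<beta>})}"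
    (is "_ \<subseteq> ?K")
proof (rule mon_ideal_least[OF ideal_sum_mult[OF mon_ideal_ideal mon_ideal_ideal xV[OF j]]])
  fix \<beta> assume \<beta>: "\<beta> \<in> B"
  show "xm \<beta> \<in> ?K"
  proof (cases "j \<in># \<beta>")
    case True
    have "xm \<beta> = \<zero> \<oplus> x j \<otimes> xm (\<beta> - {#j#})" using xm_remove[OF j True] xV[OF j] by simp
    moreover have "xm (\<beta> - {#j#}) \<in> mon_ideal ((\<lambda>\<beta>. \<beta> - {#j#}) ` {\<beta> \<in> B. j \<in># \<beta>})"
      using \<beta> True by (intro mon_ideal_self) auto
    ultimately show ?thesis using ideal_zero[OF mon_ideal_ideal] by blast
  next
    case False
    have "xm \<beta> = xm \<beta> \<oplus> x j \<otimes> \<zero>" using xV[OF j] by simp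
    moreover have "xm \<beta> \<in> mon_ideal {\<beta> \<in> B. j \<notin># \<beta>}" using \<beta> False by (intro mon_ideal_self) auto
    ultimately show ?thesis using ideal_zero[OF mon_ideal_ideal] by blast
  qed
qed

text \<open>
  By \<open>mon_ideal_split\<close> an element of the ideal is \<open>u + x\<^sub>j w\<close> with \<open>w\<close> in the ideal of the generators
  divided by \<open>x\<^sub>j\<close>; what remains is to cancel \<open>x\<^sub>j\<close> modulo the generators that are free of it.
\<close>

lemma mon_ideal_colon_var_aux:
  assumes j: "j \<in> V" and r: "r \<in> carrier R" "x j \<otimes> r \<in> mon_ideal B"
    and Z: "\<And>r. r \<in> carrier R \<Longrightarrow> x j \<otimes> r \<in> mon_ideal {\<beta> \<in> B. j \<notin># \<beta>} \<Longrightarrow> r \<in> mon_ideal {\<beta> \<in> B. j \<notin># \<beta>}"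
  shows "r \<in> mon_ideal ((\<lambda>\<beta>. \<beta> - {#j#}) ` B)"
proof -
  obtain u w where u: "u \<in> mon_ideal {\<beta> \<in> B. j \<notin># \<beta>}" and w: "w \<in> mon_ideal ((\<lambda>\<beta>. \<beta> - {#j#}) ` {\<beta> \<in> B. j \<in># \<beta>})"
    and e: "x j \<otimes> r = u \<oplus> x j \<otimes> w"
    using mon_ideal_split[OF j, of B] r(2) by blast
  have c: "u \<in> carrier R" "w \<in> carrier R" "x j \<in> carrier R"
    using u w ideal_carr[OF mon_ideal_ideal] xV[OF j] by auto
  have "x j \<otimes> (r \<ominus> w) = (x j \<otimes> r) \<ominus> x j \<otimes> w" using c r by algebra
  also have "\<dots> = u" unfolding e using c r by algebra
  finally have "r \<ominus> w \<in> mon_ideal {\<beta> \<in> B. j \<notin># \<beta>}" using Z[of "r \<ominus> w"] u c r by simp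
  moreover have "{\<beta> \<in> B. j \<notin># \<beta>} \<subseteq> (\<lambda>\<beta>. \<beta> - {#j#}) ` B"
  proof
    fix \<beta> assume "\<beta> \<in> {\<beta> \<in> B. j \<notin># \<beta>}"
    then have "\<beta> = \<beta> - {#j#}" "\<beta> \<in> B" by (auto simp: diff_single_trivial)
    then show "\<beta> \<in> (\<lambda>\<beta>. \<beta> - {#j#}) ` B" by blast
  qed
  ultimately have 1: "r \<ominus> w \<in> mon_ideal ((\<lambda>\<beta>. \<beta> - {#j#}) ` B)" by (meson mon_ideal_mono subsetD)
  have "(\<lambda>\<beta>. \<beta> - {#j#}) ` {\<beta> \<in> B. j \<in># \<beta>} \<subseteq> (\<lambda>\<beta>. \<beta> - {#j#}) ` B" by (rule image_mono) auto
  then have 2: "w \<in> mon_ideal ((\<lambda>\<beta>. \<beta> - {#j#}) ` B)" using w by (meson mon_ideal_mono subsetD)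
  have "(r \<ominus> w) \<oplus> w = r" using c r by algebra
  then show ?thesis using ideal_add[OF mon_ideal_ideal 1 2] by simp
qed

definition mons :: "nat \<Rightarrow> 'i multiset set" where
  "mons s = {\<alpha>. size \<alpha> = s \<and> set_mset \<alpha> \<subseteq> V}"

lemma finite_mons [simp]: "finite (mons s)"
proof (induction s)
  case 0
  then show ?case by (simp add: mons_def)
next
  case (Suc s)
  have "mons (Suc s) \<subseteq> (\<lambda>(i, \<alpha>). add_mset i \<alpha>) ` (V \<times> mons s)"
  proof
    fix \<alpha> assume a: "\<alpha> \<in> mons (Suc s)"
    then obtain i \<beta> where "\<alpha> = add_mset i \<beta>" unfolding mons_def by (auto simp: size_Suc_Diff1 dest: size_eq_Suc_imp_eq_union)
    then show "\<alpha> \<in> (\<lambda>(i, \<alpha>). add_mset i \<alpha>) ` (V \<times> mons s)" using a unfolding mons_def by force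
  qed
  then show ?case using Suc finV finite_subset by blast
qed

lemma mons_add: "\<alpha> \<in> mons s \<Longrightarrow> \<beta> \<in> mons t \<Longrightarrow> \<alpha> + \<beta> \<in> mons (s + t)"
  by (auto simp: mons_def)

lemma mons_0: "mons 0 = {{#}}" by (auto simp: mons_def)

text \<open>
  The power \<open>q^s\<close> of the ideal \<open>q\<close> generated by the \<open>x\<^sub>i\<close>.
\<close>

definition Q :: "nat \<Rightarrow> 'a set" where "Q s = mon_ideal (mons s)"

lemma Q_ideal: "ideal (Q s) R" unfolding Q_def by (rule mon_ideal_ideal)

lemma xm_Q: "\<alpha> \<in> mons s \<Longrightarrow> xm \<alpha> \<in> Q s" unfolding Q_def by (rule mon_ideal_self)

lemma xm_in_Q: "set_mset \<alpha> \<subseteq> V \<Longrightarrow> s \<le> size \<alpha> \<Longrightarrow> xm \<alpha> \<in> Q s"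
proof (induction "size \<alpha> - s" arbitrary: \<alpha>)
  case 0
  then show ?case by (intro xm_Q) (auto simp: mons_def)
next
  case (Suc n)
  then obtain i \<beta> where \<alpha>: "\<alpha> = add_mset i \<beta>" by (metis diff_is_0_eq' multi_nonempty_split size_empty zero_diff nat.distinct(1))
  then have "xm \<beta> \<in> Q s" using Suc by auto
  then show ?case using \<alpha> Suc.prems xm_add_mset[of i \<beta>] xV[of i] ideal_lmult[OF Q_ideal] by auto
qed

lemma Q_mono: "s \<le> t \<Longrightarrow> Q t \<subseteq> Q s"
  unfolding Q_def[of t] by (rule mon_ideal_least[OF Q_ideal]) (auto intro: xm_in_Q simp: mons_def)

lemma Q_0: "Q 0 = carrier R"
proof -
  have "\<one> \<in> Q 0" using xm_Q[of "{#}" 0] by (simp add: mons_0)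
  then show ?thesis using ideal.one_imp_carrier[OF Q_ideal] by simp
qed

lemma Q_1: "Q 1 = Idl (x ` V)"
proof -
  have "mons 1 = (\<lambda>i. {#i#}) ` V"
  proof (intro equalityI subsetI)
    fix \<alpha> assume a: "\<alpha> \<in> mons 1"
    then obtain i where "\<alpha> = {#i#}" unfolding mons_def using size_1_singleton_mset by blast
    then show "\<alpha> \<in> (\<lambda>i. {#i#}) ` V" using a unfolding mons_def by auto
  qed (auto simp: mons_def)
  then have "xm ` mons 1 = x ` V" by (simp add: image_image xm_single cong: image_cong)
  then show ?thesis unfolding Q_def mon_ideal_def by simp
qed

lemma Q_mult: "a \<in> Q s \<Longrightarrow> b \<in> Q t \<Longrightarrow> a \<otimes> b \<in> Q (s + t)"
proof -
  assume a: "a \<in> Q s" and b: "b \<in> Q t"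
  have bc: "b \<in> carrier R" using b ideal_carr[OF Q_ideal] by blast
  have "xm \<alpha> \<otimes> b \<in> Q (s + t)" if \<alpha>: "\<alpha> \<in> mons s" for \<alpha>
  proof -
    have "Q t \<subseteq> {u \<in> carrier R. u \<otimes> xm \<alpha> \<in> Q (s + t)}"
      unfolding Q_def[of t]
    proof (rule mon_ideal_least[OF ideal_colon[OF Q_ideal xm_closed]])
      fix \<beta> assume "\<beta> \<in> mons t"
      then show "xm \<beta> \<in> {u \<in> carrier R. u \<otimes> xm \<alpha> \<in> Q (s + t)}"
        using xm_Q[OF mons_add[OF \<alpha>]] m_comm[of "xm \<beta>" "xm \<alpha>"] by (auto simp: xm_add)
    qed
    then show ?thesis using b bc m_comm[of b "xm \<alpha>"] by auto
  qed
  then have "Q s \<subseteq> {u \<in> carrier R. u \<otimes> b \<in> Q (s + t)}"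
    unfolding Q_def[of s] by (intro mon_ideal_least ideal_colon Q_ideal bc) auto
  then show ?thesis using a by blast
qed

text \<open>
  Pigeonhole: in a monomial of degree \<open>card V * n\<close> some exponent is at least \<open>n\<close>.
\<close>

lemma Q_sub_powers:
  "Q (card V * n) \<subseteq> Idl ((\<lambda>y. y [^] n) ` (x ` V))" if "V \<noteq> {}"
  unfolding Q_def
proof (rule mon_ideal_least)
  have sub: "(\<lambda>y. y [^] n) ` x ` V \<subseteq> carrier R" using xV by auto
  show I: "ideal (Idl ((\<lambda>y. y [^] n) ` x ` V)) R" by (rule genideal_ideal[OF sub])
  fix \<beta> assume b: "\<beta> \<in> mons (card V * n)"
  have "\<exists>i\<in>V. n \<le> count \<beta> i"
  proof (rule ccontr)
    assume "\<not> ?thesis"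
    then have "\<And>i. i \<in> V \<Longrightarrow> count \<beta> i < n" by auto
    then have "(\<Sum>i\<in>V. count \<beta> i) < (\<Sum>i\<in>V. n)" using finV that by (intro sum_strict_mono) auto
    moreover have "size \<beta> = (\<Sum>i\<in>V. count \<beta> i)"
      unfolding size_multiset_overloaded_eq using b finV
      by (intro sum.mono_neutral_left) (auto simp: mons_def count_eq_zero_iff)
    ultimately show False using b by (simp add: mons_def)
  qed
  then obtain i where i: "i \<in> V" "n \<le> count \<beta> i" by blast
  have "replicate_mset n i \<subseteq># \<beta>" using i by (simp add: count_le_replicate_mset_subset_eq)
  then have e: "\<beta> = replicate_mset n i + (\<beta> - replicate_mset n i)" by simp
  have "xm (replicate_mset n i) = x i [^] n" for n
    by (induction n) (use i xV in \<open>auto simp: xm_add_mset m_comm\<close>)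
  then have "xm \<beta> = x i [^] n \<otimes> xm (\<beta> - replicate_mset n i)" using xm_add e by metis
  moreover have "x i [^] n \<in> Idl ((\<lambda>y. y [^] n) ` x ` V)" using i by (intro Idl_self[OF sub]) auto
  ultimately show "xm \<beta> \<in> Idl ((\<lambda>y. y [^] n) ` x ` V)" using ideal_rmult[OF I] by simp
qed

lemma Q_finsum: "r \<in> Q s \<Longrightarrow> \<exists>c. (\<forall>\<alpha>\<in>mons s. c \<alpha> \<in> carrier R) \<and> r = finsum R (\<lambda>\<alpha>. c \<alpha> \<otimes> xm \<alpha>) (mons s)"
  unfolding Q_def mon_ideal_def by (rule Idl_image_finsum) auto

end

text \<open>
  Regularity of the sequence in every order.
\<close>

locale permutable_regular = monomials R x V
  for R :: "('a, 'b) ring_scheme" (structure) and x :: "'i \<Rightarrow> 'a" and V :: "'i set" +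
  assumes reg: "T \<subseteq> V \<Longrightarrow> i \<in> V - T \<Longrightarrow> r \<in> carrier R \<Longrightarrow> x i \<otimes> r \<in> Idl (x ` T) \<Longrightarrow> r \<in> Idl (x ` T)"
begin

text \<open>
  Induction on the total degree of the generators. If all generators are variables, this is the
  hypothesis on the sequence. Otherwise some \<open>x\<^sub>j\<close> properly divides a generator, and for the ideal
  \<open>\<bb>\<close> the sequence \<open>0 \<rightarrow> R/(\<bb> : x\<^sub>j) \<rightarrow> R/\<bb> \<rightarrow> R/(\<bb>, x\<^sub>j) \<rightarrow> 0\<close>, whose outer terms are given by
  monomial generators of smaller total degree, shows that \<open>x\<^sub>i\<close> is a nonzerodivisor in the middle.
\<close>

lemma mon_ideal_nonzerodivisor:
  assumes "finite B" "\<And>\<beta>. \<beta> \<in> B \<Longrightarrow> set_mset \<beta> \<subseteq> V - {i}" "i \<in> V" "r \<in> carrier R" "x i \<otimes> r \<in> mon_ideal B"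
  shows "r \<in> mon_ideal B"
  using assms
proof (induction "\<Sum>\<beta>\<in>B. size \<beta>" arbitrary: B i r rule: less_induct)
  case less
  note finB = less.prems(1) and BV = less.prems(2) and i = less.prems(3) and r = less.prems(4)
  have xi: "x i \<in> carrier R" using xV i by simp
  consider (one) "{#} \<in> B" | (vars) "\<forall>\<beta>\<in>B. size \<beta> = 1" | (big) \<beta>0 where "\<beta>0 \<in> B" "2 \<le> size \<beta>0"
  proof -
    have "size \<beta> = 0 \<or> size \<beta> = 1 \<or> 2 \<le> size \<beta>" for \<beta> :: "'i multiset" by linarith
    then show ?thesis using that by (metis size_eq_0_iff_empty)
  qed
  then show ?case
  proof cases
    case one
    then have "\<one> \<in> mon_ideal B" using mon_ideal_self[of "{#}" B] by simp
    then show ?thesis using ideal.one_imp_carrier[OF mon_ideal_ideal] r by simp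
  next
    case vars
    define T where "T = {j \<in> V. {#j#} \<in> B}"
    have "B = (\<lambda>j. {#j#}) ` T"
    proof
      show "B \<subseteq> (\<lambda>j. {#j#}) ` T"
      proof
        fix \<beta> assume b: "\<beta> \<in> B"
        then obtain j where "\<beta> = {#j#}" using vars size_1_singleton_mset by metis
        then show "\<beta> \<in> (\<lambda>j. {#j#}) ` T" using b BV[OF b] unfolding T_def by auto
      qed
    qed (auto simp: T_def)
    then have "xm ` B = (\<lambda>j. xm {#j#}) ` T" by (metis image_image)
    also have "\<dots> = x ` T" by (rule image_cong) (auto simp: T_def xm_single)
    finally have "xm ` B = x ` T" .
    then have miB: "mon_ideal B = Idl (x ` T)" unfolding mon_ideal_def by simp
    have "i \<notin> T" using BV[of "{#i#}"] unfolding T_def by auto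
    then show ?thesis using reg[of T i r] less.prems unfolding miB T_def by auto
  next
    case big
    then obtain j where j: "j \<in># \<beta>0" by (metis multiset_nonemptyE size_empty not_numeral_le_zero)
    have jV: "j \<in> V" and ji: "j \<noteq> i" using j BV[OF big(1)] by auto
    have xj: "x j \<in> carrier R" using xV jV by simp
    define B0 where "B0 = {\<beta> \<in> B. j \<notin># \<beta>}"
    have B0: "B0 \<subseteq> B" "\<beta>0 \<notin> B0" "finite B0" using j finB unfolding B0_def by auto
    have "sum size B0 + size \<beta>0 = sum size (insert \<beta>0 B0)" using B0 by simp
    also have "\<dots> \<le> sum size B" by (rule sum_mono2) (use B0 big finB in auto)
    finally have mB0: "sum size B0 + size \<beta>0 \<le> sum size B" .
    have mB0': "sum size (insert {#j#} B0) < sum size B"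
      using mB0 big(2) B0(3) by (cases "{#j#} \<in> B0") (auto simp: insert_absorb)
    have "mon_ideal B \<subseteq> mon_ideal (insert {#j#} B0)"
    proof (rule mon_ideal_least[OF mon_ideal_ideal])
      fix \<beta> assume b: "\<beta> \<in> B"
      show "xm \<beta> \<in> mon_ideal (insert {#j#} B0)"
      proof (cases "j \<in># \<beta>")
        case True
        have "xm {#j#} \<in> mon_ideal (insert {#j#} B0)" by (rule mon_ideal_self) simp
        then show ?thesis unfolding xm_remove[OF jV True] xm_single[OF jV]
          by (rule ideal_rmult[OF mon_ideal_ideal]) simp
      next
        case False
        then show ?thesis using b by (intro mon_ideal_self) (auto simp: B0_def)
      qed
    qed
    then have xr: "x i \<otimes> r \<in> mon_ideal (insert {#j#} B0)" using less.prems(5) by blast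
    have "r \<in> mon_ideal (insert {#j#} B0)"
    proof (rule less.hyps[OF mB0' _ _ i r xr])
      show "set_mset \<beta> \<subseteq> V - {i}" if "\<beta> \<in> insert {#j#} B0" for \<beta>
        using that BV B0(1) ji jV by auto
    qed (use B0 in simp)
    moreover have "xm ` B0 \<subseteq> carrier R" by auto
    ultimately obtain s b where s: "s \<in> carrier R" "b \<in> mon_ideal B0" "r = s \<otimes> x j \<oplus> b"
      unfolding mon_ideal_def using Idl_insert[OF _ xj, of "xm ` B0"] by (auto simp: xm_single[OF jV])
    have bB: "b \<in> mon_ideal B" using s(2) mon_ideal_mono[OF B0(1)] by blast
    have bc: "b \<in> carrier R" using bB ideal_carr[OF mon_ideal_ideal] by blast
    have "x j \<otimes> (x i \<otimes> s) = x i \<otimes> r \<ominus> x i \<otimes> b" unfolding s(3) using s bc xi xj by algebra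
    also have "\<dots> \<in> mon_ideal B" using less.prems(5) bB ideal_minus[OF mon_ideal_ideal] ideal_lmult[OF mon_ideal_ideal] xi by blast
    finally have xx: "x j \<otimes> (x i \<otimes> s) \<in> mon_ideal B" .
    have "x i \<otimes> s \<in> mon_ideal ((\<lambda>\<beta>. \<beta> - {#j#}) ` B)"
    proof (rule mon_ideal_colon_var_aux[OF jV _ xx])
      show "x i \<otimes> s \<in> carrier R" using xi s by simp
      show "r \<in> mon_ideal {\<beta> \<in> B. j \<notin># \<beta>}" if "r \<in> carrier R" "x j \<otimes> r \<in> mon_ideal {\<beta> \<in> B. j \<notin># \<beta>}" for r
        using less.hyps[of B0 j r] mB0 big(2) B0 BV jV that unfolding B0_def by fastforce
    qed
    moreover have "sum size ((\<lambda>\<beta>. \<beta> - {#j#}) ` B) < sum size B"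
    proof -
      have "sum size ((\<lambda>\<beta>. \<beta> - {#j#}) ` B) \<le> (\<Sum>\<beta>\<in>B. size (\<beta> - {#j#}))"
        using sum_image_le[OF finB, of size "\<lambda>\<beta>. \<beta> - {#j#}"] by simp
      also have "\<dots> < sum size B"
        by (rule sum_strict_mono_ex1[OF finB]) (use big(1) j in \<open>auto simp: size_Diff1_le size_Diff1_less intro!: bexI[of _ \<beta>0]\<close>)
      finally show ?thesis .
    qed
    ultimately have sj: "s \<in> mon_ideal ((\<lambda>\<beta>. \<beta> - {#j#}) ` B)"
      using less.hyps[of "(\<lambda>\<beta>. \<beta> - {#j#}) ` B" i s] finB BV i s by (auto dest!: in_diffD)
    have "mon_ideal ((\<lambda>\<beta>. \<beta> - {#j#}) ` B) \<subseteq> {u \<in> carrier R. u \<otimes> x j \<in> mon_ideal B}"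
    proof (rule mon_ideal_least[OF ideal_colon[OF mon_ideal_ideal xj]])
      fix \<gamma> assume "\<gamma> \<in> (\<lambda>\<beta>. \<beta> - {#j#}) ` B"
      then obtain \<beta> where b: "\<beta> \<in> B" "\<gamma> = \<beta> - {#j#}" by blast
      show "xm \<gamma> \<in> {u \<in> carrier R. u \<otimes> x j \<in> mon_ideal B}"
      proof (cases "j \<in># \<beta>")
        case True
        then have "xm \<gamma> \<otimes> x j = xm \<beta>" unfolding b using xm_remove[OF jV True] xj by (simp add: m_comm)
        then show ?thesis using mon_ideal_self[OF b(1)] by simp
      next
        case False
        then have "\<gamma> = \<beta>" using b by (simp add: diff_single_trivial)
        then show ?thesis using ideal_rmult[OF mon_ideal_ideal mon_ideal_self[OF b(1)] xj] by simp
      qed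
    qed
    then have "s \<otimes> x j \<in> mon_ideal B" using sj by blast
    then show ?thesis unfolding s(3) using bB ideal_add[OF mon_ideal_ideal] by blast
  qed
qed

lemma mon_ideal_colon_var:
  assumes "finite B" "\<And>\<beta>. \<beta> \<in> B \<Longrightarrow> set_mset \<beta> \<subseteq> V" "j \<in> V" "r \<in> carrier R" "x j \<otimes> r \<in> mon_ideal B"
  shows "r \<in> mon_ideal ((\<lambda>\<beta>. \<beta> - {#j#}) ` B)"
proof (rule mon_ideal_colon_var_aux[OF assms(3-5)])
  show "r \<in> mon_ideal {\<beta> \<in> B. j \<notin># \<beta>}" if "r \<in> carrier R" "x j \<otimes> r \<in> mon_ideal {\<beta> \<in> B. j \<notin># \<beta>}" for r
    by (rule mon_ideal_nonzerodivisor[OF _ _ assms(3) that]) (use assms in auto)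
qed

text \<open>
  Colon ideals of monomial ideals are computed as in a polynomial ring.
\<close>

lemma mon_ideal_colon:
  assumes "finite B" "\<And>\<beta>. \<beta> \<in> B \<Longrightarrow> set_mset \<beta> \<subseteq> V" "set_mset \<alpha> \<subseteq> V" "r \<in> carrier R" "xm \<alpha> \<otimes> r \<in> mon_ideal B"
  shows "r \<in> mon_ideal ((\<lambda>\<beta>. \<beta> - \<alpha>) ` B)"
  using assms
proof (induction \<alpha> arbitrary: r)
  case empty
  then show ?case by simp
next
  case (add j \<alpha>)
  then have j: "j \<in> V" "x j \<in> carrier R" using xV by auto
  have "xm \<alpha> \<otimes> (x j \<otimes> r) \<in> mon_ideal B"
    using add.prems(5) xm_add_mset[OF j(1), of \<alpha>] j add.prems(4) by (simp add: m_ac)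
  then have 1: "x j \<otimes> r \<in> mon_ideal ((\<lambda>\<beta>. \<beta> - \<alpha>) ` B)" using add.IH[of "x j \<otimes> r"] add.prems j by auto
  have "r \<in> mon_ideal ((\<lambda>\<beta>. \<beta> - {#j#}) ` (\<lambda>\<beta>. \<beta> - \<alpha>) ` B)"
    by (rule mon_ideal_colon_var[OF _ _ j(1) add.prems(4) 1]) (use add.prems in \<open>auto dest!: in_diffD\<close>)
  moreover have "(\<lambda>\<beta>. \<beta> - {#j#}) ` (\<lambda>\<beta>. \<beta> - \<alpha>) ` B = (\<lambda>\<beta>. \<beta> - add_mset j \<alpha>) ` B"
    by (simp add: image_image diff_diff_add_mset[symmetric] flip: add_mset_add_single)
  ultimately show ?case by simp
qed

text \<open>
  The monomial \<open>x^\<beta>\<close> is not divisible by any other monomial of degree \<open>s\<close> or more, so the colon of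
  the ideal of these monomials by \<open>x^\<beta>\<close> is generated by monomials different from 1.
\<close>

lemma quasi_regular:
  assumes c: "\<And>\<alpha>. \<alpha> \<in> mons s \<Longrightarrow> c \<alpha> \<in> carrier R"
    and sum: "finsum R (\<lambda>\<alpha>. c \<alpha> \<otimes> xm \<alpha>) (mons s) \<in> Q (Suc s)" and b: "\<beta> \<in> mons s"
  shows "c \<beta> \<in> Q 1"
proof -
  define B where "B = (mons s - {\<beta>}) \<union> mons (Suc s)"
  have QB: "Q (Suc s) \<subseteq> mon_ideal B" unfolding Q_def B_def by (rule mon_ideal_mono) auto
  define t where "t = finsum R (\<lambda>\<alpha>. c \<alpha> \<otimes> xm \<alpha>) (mons s - {\<beta>})"
  have "t \<in> mon_ideal B" unfolding t_def
  proof (rule fs_ideal[OF mon_ideal_ideal])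
    show "c \<alpha> \<otimes> xm \<alpha> \<in> mon_ideal B" if "\<alpha> \<in> mons s - {\<beta>}" for \<alpha>
      using that c by (intro ideal_lmult[OF mon_ideal_ideal mon_ideal_self]) (auto simp: B_def)
  qed simp
  moreover have "c \<beta> \<otimes> xm \<beta> \<oplus> t \<in> mon_ideal B"
    using sum QB fs_remove[of "mons s" \<beta> "\<lambda>\<alpha>. c \<alpha> \<otimes> xm \<alpha>"] b c unfolding t_def by auto
  ultimately have "c \<beta> \<otimes> xm \<beta> \<in> mon_ideal B" using ideal_add_cancel[OF mon_ideal_ideal] c[OF b] by simp
  then have "xm \<beta> \<otimes> c \<beta> \<in> mon_ideal B" using c[OF b] by (simp add: m_comm)
  then have "c \<beta> \<in> mon_ideal ((\<lambda>\<gamma>. \<gamma> - \<beta>) ` B)"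
  proof (intro mon_ideal_colon)
    show "finite B" unfolding B_def by simp
  qed (use b c in \<open>auto simp: B_def mons_def\<close>)
  moreover have "mon_ideal ((\<lambda>\<gamma>. \<gamma> - \<beta>) ` B) \<subseteq> Q 1"
  proof (rule mon_ideal_least[OF Q_ideal])
    fix \<delta> assume "\<delta> \<in> (\<lambda>\<gamma>. \<gamma> - \<beta>) ` B"
    then obtain \<gamma> where g: "\<gamma> \<in> B" "\<delta> = \<gamma> - \<beta>" by blast
    have "\<delta> \<noteq> {#}"
    proof
      assume "\<delta> = {#}"
      then have sub: "\<gamma> \<subseteq># \<beta>" using g by (simp add: Diff_eq_empty_iff_mset)
      have "size \<beta> \<le> size \<gamma>" using g b unfolding B_def mons_def by auto
      then have "\<gamma> = \<beta>" using sub by (metis mset_subset_size subset_mset.less_le not_le)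
      then show False using g b unfolding B_def mons_def by auto
    qed
    moreover have "set_mset \<delta> \<subseteq> V" using g unfolding B_def mons_def by (auto dest!: in_diffD)
    ultimately show "xm \<delta> \<in> Q 1" by (intro xm_in_Q) (auto simp: Suc_le_eq nonempty_has_size)
  qed
  ultimately show ?thesis by blast
qed

end


section \<open>Linear systems with unit coefficients\<close>

text \<open>
  The subring \<open>k\<close> plays the role of a coefficient field.
\<close>

locale unit_coeffs = cring R for R :: "('a, 'b) ring_scheme" (structure) +
  fixes k :: "'a set"
  assumes k_sub: "k \<subseteq> carrier R" and k_one: "\<one> \<in> k"
    and k_minus: "a \<in> k \<Longrightarrow> b \<in> k \<Longrightarrow> a \<ominus> b \<in> k"
    and k_mult: "a \<in> k \<Longrightarrow> b \<in> k \<Longrightarrow> a \<otimes> b \<in> k"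
    and k_unit: "a \<in> k \<Longrightarrow> a \<noteq> \<zero> \<Longrightarrow> a \<in> Units R"
begin

lemma k_carr: "a \<in> k \<Longrightarrow> a \<in> carrier R" using k_sub by blast

lemma k_zero: "\<zero> \<in> k"
  using k_minus[OF k_one k_one] by (simp add: minus_eq r_neg)

lemma k_neg: "a \<in> k \<Longrightarrow> \<ominus> a \<in> k"
  using k_minus[OF k_zero, of a] k_carr by (simp add: minus_eq)

lemma k_add: "a \<in> k \<Longrightarrow> b \<in> k \<Longrightarrow> a \<oplus> b \<in> k"
  using k_minus[OF _ k_neg, of a b] k_carr by (simp add: minus_eq)

lemma k_finsum: "finite A \<Longrightarrow> (\<And>i. i \<in> A \<Longrightarrow> f i \<in> k) \<Longrightarrow> finsum R f A \<in> k"
proof (induction A rule: finite_induct)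
  case empty
  then show ?case using k_zero by simp
next
  case (insert a A)
  then have "finsum R f (insert a A) = f a \<oplus> finsum R f A"
    by (intro fs_insert) (auto intro: k_carr)
  then show ?case using insert k_add by simp
qed

definition dot :: "'u set \<Rightarrow> ('u \<Rightarrow> 'a) \<Rightarrow> ('u \<Rightarrow> 'a) \<Rightarrow> 'a" where
  "dot I T c = finsum R (\<lambda>i. T i \<otimes> c i) I"

definition sols :: "'u set \<Rightarrow> ('u \<Rightarrow> 'a) set \<Rightarrow> ('u \<Rightarrow> 'a) set" where
  "sols I Ts = {v. (\<forall>i\<in>I. v i \<in> k) \<and> (\<forall>T\<in>Ts. dot I T v = \<zero>)}"

text \<open>
  The combinations of \<open>S\<close> with coefficients in \<open>R\<close>, modulo vectors with entries in \<open>q\<close>.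
\<close>

inductive span_mod :: "'a set \<Rightarrow> 'u set \<Rightarrow> ('u \<Rightarrow> 'a) set \<Rightarrow> ('u \<Rightarrow> 'a) \<Rightarrow> bool"
  for q I S where
  span_base: "(\<And>i. i \<in> I \<Longrightarrow> w i \<in> q) \<Longrightarrow> span_mod q I S w"
| span_step: "span_mod q I S c \<Longrightarrow> v \<in> S \<Longrightarrow> a \<in> carrier R \<Longrightarrow>
     (\<And>i. i \<in> I \<Longrightarrow> c' i = a \<otimes> v i \<oplus> c i) \<Longrightarrow> span_mod q I S c'"

context
  fixes q :: "'a set" and I :: "'u set"
  assumes q: "ideal q R" and I: "finite I"
begin

lemma span_carr:
  assumes "span_mod q I S c" "\<And>v i. v \<in> S \<Longrightarrow> i \<in> I \<Longrightarrow> v i \<in> carrier R"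
  shows "i \<in> I \<Longrightarrow> c i \<in> carrier R"
  using assms by (induction) (auto intro: ideal_carr[OF q])

lemma span_add_base:
  assumes "span_mod q I S c" "\<And>i. i \<in> I \<Longrightarrow> w i \<in> q" "\<And>i. i \<in> I \<Longrightarrow> c' i = c i \<oplus> w i"
    "\<And>v i. v \<in> S \<Longrightarrow> i \<in> I \<Longrightarrow> v i \<in> carrier R"
  shows "span_mod q I S c'"
  using assms
proof (induction arbitrary: c')
  case (span_base u)
  then show ?case by (intro span_mod.span_base) (auto intro: ideal_add[OF q])
next
  case (span_step c v a c'' c')
  have 1: "span_mod q I S (\<lambda>i. c i \<oplus> w i)" by (rule span_step.IH) (use span_step.prems in auto)
  show ?case
  proof (rule span_mod.span_step[OF 1 span_step.hyps(2,3)])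
    show "c' i = a \<otimes> v i \<oplus> (c i \<oplus> w i)" if i: "i \<in> I" for i
    proof -
      have "v i \<in> carrier R" "c i \<in> carrier R" "w i \<in> carrier R"
        using i span_step.hyps span_step.prems span_carr[OF span_step.hyps(1)] ideal_carr[OF q] by auto
      then show ?thesis using i span_step.hyps span_step.prems by (simp add: a_assoc)
    qed
  qed
qed

lemma dot_closed: "(\<And>i. i \<in> I \<Longrightarrow> T i \<in> carrier R) \<Longrightarrow> (\<And>i. i \<in> I \<Longrightarrow> c i \<in> carrier R) \<Longrightarrow> dot I T c \<in> carrier R"
  unfolding dot_def by (rule fs_closed) auto

lemma dot_lin:
  assumes "\<And>i. i \<in> I \<Longrightarrow> T i \<in> carrier R" "\<And>i. i \<in> I \<Longrightarrow> v i \<in> carrier R" "\<And>i. i \<in> I \<Longrightarrow> c i \<in> carrier R"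
    "a \<in> carrier R" "\<And>i. i \<in> I \<Longrightarrow> c' i = a \<otimes> v i \<oplus> c i"
  shows "dot I T c' = a \<otimes> dot I T v \<oplus> dot I T c"
proof -
  have "dot I T c' = finsum R (\<lambda>i. a \<otimes> (T i \<otimes> v i) \<oplus> T i \<otimes> c i) I"
    unfolding dot_def
  proof (rule fs_cong)
    fix i assume i: "i \<in> I"
    note * = assms(1)[OF i] assms(2)[OF i] assms(3)[OF i] assms(4)
    show "T i \<otimes> c' i = a \<otimes> (T i \<otimes> v i) \<oplus> T i \<otimes> c i"
      unfolding assms(5)[OF i] using * by algebra
    show "a \<otimes> (T i \<otimes> v i) \<oplus> T i \<otimes> c i \<in> carrier R" using * by simp
  qed
  also have "\<dots> = finsum R (\<lambda>i. a \<otimes> (T i \<otimes> v i)) I \<oplus> dot I T c"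
    unfolding dot_def using assms by (intro fs_add) auto
  also have "finsum R (\<lambda>i. a \<otimes> (T i \<otimes> v i)) I = a \<otimes> dot I T v"
    unfolding dot_def using assms I by (subst fs_lmult) auto
  finally show ?thesis .
qed

lemma span_all:
  assumes c: "\<And>i. i \<in> I \<Longrightarrow> c i \<in> carrier R"
  shows "span_mod q I (sols I {}) c"
proof -
  have "span_mod q I (sols I {}) (\<lambda>i. if i \<in> J then c i else \<zero>)" if "finite J" "J \<subseteq> I" for J
    using that
  proof (induction J rule: finite_induct)
    case empty
    then show ?case by (intro span_base) (auto intro: ideal_zero[OF q])
  next
    case (insert j J)
    show ?case
    proof (rule span_step)
      show "span_mod q I (sols I {}) (\<lambda>i. if i \<in> J then c i else \<zero>)" using insert by simp
      show "(\<lambda>i. if i = j then \<one> else \<zero>) \<in> sols I {}" unfolding sols_def using k_one k_zero by simp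
      show "c j \<in> carrier R" using c insert by simp
      show "(if i \<in> insert j J then c i else \<zero>) =
          c j \<otimes> (if i = j then \<one> else \<zero>) \<oplus> (if i \<in> J then c i else \<zero>)" if "i \<in> I" for i
        using that c insert by auto
    qed
  qed
  from this[OF I order_refl] have 1: "span_mod q I (sols I {}) (\<lambda>i. if i \<in> I then c i else \<zero>)" .
  show ?thesis
    by (rule span_add_base[OF 1, of "\<lambda>_. \<zero>"]) (use c ideal_zero[OF q] k_carr in \<open>auto simp: sols_def\<close>)
qed

text \<open>
  Solutions modulo \<open>q\<close> of a linear system with coefficients in \<open>k\<close> are combinations of solutions
  over \<open>k\<close>. The equations are added one at a time: if the new equation \<open>T\<close> does not
  vanish on all solutions so far, one of them with \<open>T w \<noteq> 0\<close> serves as pivot, by which the others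
  are corrected.
\<close>

lemma span_sols:
  assumes "finite Ts" "\<And>T i. T \<in> Ts \<Longrightarrow> i \<in> I \<Longrightarrow> T i \<in> k"
    "\<And>i. i \<in> I \<Longrightarrow> c i \<in> carrier R" "\<And>T. T \<in> Ts \<Longrightarrow> dot I T c \<in> q"
  shows "span_mod q I (sols I Ts) c"
  using assms
proof (induction Ts rule: finite_induct)
  case empty
  then show ?case using span_all by blast
next
  case (insert T Ts)
  have Tk: "\<And>i. i \<in> I \<Longrightarrow> T i \<in> k" and Tc: "\<And>i. i \<in> I \<Longrightarrow> T i \<in> carrier R" using insert.prems k_carr by auto
  have vk: "\<And>v i. v \<in> sols I Ts \<Longrightarrow> i \<in> I \<Longrightarrow> v i \<in> k" unfolding sols_def by auto
  have vc: "\<And>v i. v \<in> sols I Ts \<Longrightarrow> i \<in> I \<Longrightarrow> v i \<in> carrier R" using vk k_carr by blast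
  have dk: "dot I T v \<in> k" if "v \<in> sols I Ts" for v
    unfolding dot_def by (rule k_finsum[OF I]) (use Tk vk[OF that] k_mult in auto)
  have IH: "span_mod q I (sols I Ts) c" using insert by simp
  have cc: "\<And>i. i \<in> I \<Longrightarrow> c i \<in> carrier R" using insert.prems by simp
  show ?case
  proof (cases "\<forall>v\<in>sols I Ts. dot I T v = \<zero>")
    case True
    then have "sols I (insert T Ts) = sols I Ts" unfolding sols_def by auto
    then show ?thesis using IH by simp
  next
    case False
    then obtain w where w: "w \<in> sols I Ts" and tau0: "dot I T w \<noteq> \<zero>" by blast
    define \<tau> where "\<tau> = dot I T w"
    have \<tau>: "\<tau> \<in> k" "\<tau> \<in> Units R" unfolding \<tau>_def using dk[OF w] k_unit tau0 by auto
    have \<tau>c: "\<tau> \<in> carrier R" and \<tau>': "inv \<tau> \<in> carrier R" "inv \<tau> \<otimes> \<tau> = \<one>" using \<tau> by auto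
    have wc: "\<And>i. i \<in> I \<Longrightarrow> w i \<in> carrier R" using vc[OF w] .
    have new: "(\<lambda>i. \<tau> \<otimes> v i \<oplus> (\<ominus> dot I T v) \<otimes> w i) \<in> sols I (insert T Ts)" (is "?v' \<in> _")
      if v: "v \<in> sols I Ts" for v
    proof -
      have dv: "dot I T v \<in> k" "dot I T v \<in> carrier R" using dk[OF v] k_carr by auto
      have *: "dot I U ?v' = \<tau> \<otimes> dot I U v \<oplus> (\<ominus> dot I T v) \<otimes> dot I U w"
        if U: "\<And>i. i \<in> I \<Longrightarrow> U i \<in> carrier R" for U
      proof -
        have "dot I U ?v' = \<tau> \<otimes> dot I U v \<oplus> dot I U (\<lambda>i. (\<ominus> dot I T v) \<otimes> w i)"
          by (rule dot_lin[OF U]) (use v vc wc \<tau>c dv in auto)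
        also have "dot I U (\<lambda>i. (\<ominus> dot I T v) \<otimes> w i) = (\<ominus> dot I T v) \<otimes> dot I U w \<oplus> dot I U (\<lambda>_. \<zero>)"
          by (rule dot_lin[OF U]) (use wc dv in auto)
        also have "dot I U (\<lambda>_. \<zero>) = \<zero>" unfolding dot_def by (rule fs_zero) (use U in auto)
        finally show ?thesis using dot_closed[OF U wc] dv by simp
      qed
      have "dot I U ?v' = \<zero>" if U: "U \<in> insert T Ts" for U
      proof (cases "U = T")
        case True
        have "dot I T ?v' = \<tau> \<otimes> dot I T v \<oplus> (\<ominus> dot I T v) \<otimes> \<tau>"
          using *[of T, OF Tc] unfolding \<tau>_def .
        then show ?thesis using dv \<tau>c unfolding True
          by (simp add: l_minus m_comm[of "dot I T v"] r_neg)
      next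
        case False
        then have "dot I U v = \<zero>" "dot I U w = \<zero>" using v w U unfolding sols_def by auto
        moreover have "\<And>i. i \<in> I \<Longrightarrow> U i \<in> carrier R" using insert.prems(1) U k_carr by blast
        ultimately show ?thesis using *[of U] dv \<tau>c by simp
      qed
      moreover have "?v' i \<in> k" if "i \<in> I" for i
        using that v vk w dv \<tau> by (intro k_add k_mult k_neg) auto
      ultimately show ?thesis unfolding sols_def by auto
    qed
    have red: "span_mod q I (sols I (insert T Ts)) (\<lambda>i. c i \<ominus> (inv \<tau> \<otimes> dot I T c) \<otimes> w i)"
      if "span_mod q I (sols I Ts) c" for c
      using that
    proof (induction rule: span_mod.induct)
      case (span_base u)
      have uc: "\<And>i. i \<in> I \<Longrightarrow> u i \<in> carrier R" using span_base ideal_carr[OF q] by blast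
      have "dot I T u \<in> q" unfolding dot_def
        by (rule fs_ideal[OF q I]) (use span_base Tc ideal_lmult[OF q] in auto)
      then have "(inv \<tau> \<otimes> dot I T u) \<otimes> w i \<in> q" if "i \<in> I" for i
        using that wc \<tau>' by (intro ideal_rmult[OF q] ideal_lmult[OF q]) auto
      then show ?case using span_base by (intro span_mod.span_base ideal_minus[OF q]) auto
    next
      case (span_step c v a c')
      have cc: "\<And>i. i \<in> I \<Longrightarrow> c i \<in> carrier R" using span_carr[OF span_step.hyps(1)] vc by blast
      have v: "\<And>i. i \<in> I \<Longrightarrow> v i \<in> carrier R" using vc[OF span_step.hyps(2)] .
      have d: "dot I T c' = a \<otimes> dot I T v \<oplus> dot I T c"
        by (rule dot_lin[OF Tc v cc span_step.hyps(3,4)])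
      have dc: "dot I T v \<in> carrier R" "dot I T c \<in> carrier R" using dot_closed Tc v cc by auto
      have a: "a \<otimes> inv \<tau> \<in> carrier R" using span_step.hyps \<tau>' by simp
      show ?case
      proof (rule span_mod.span_step[OF span_step.IH new[OF span_step.hyps(2)] a])
        fix i assume i: "i \<in> I"
        have id: "(a \<otimes> t') \<otimes> (t \<otimes> y \<oplus> (\<ominus> g) \<otimes> z) \<oplus> (y' \<ominus> (t' \<otimes> g') \<otimes> z)
          = (t' \<otimes> t) \<otimes> (a \<otimes> y) \<oplus> y' \<ominus> (t' \<otimes> (a \<otimes> g \<oplus> g')) \<otimes> z"
          if "t \<in> carrier R" "t' \<in> carrier R" "y \<in> carrier R" "y' \<in> carrier R" "z \<in> carrier R"
            "g \<in> carrier R" "g' \<in> carrier R" for t t' y y' z g g'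
          using that span_step.hyps(3) by algebra
        have "(a \<otimes> inv \<tau>) \<otimes> (\<tau> \<otimes> v i \<oplus> (\<ominus> dot I T v) \<otimes> w i) \<oplus> (c i \<ominus> (inv \<tau> \<otimes> dot I T c) \<otimes> w i)
          = (inv \<tau> \<otimes> \<tau>) \<otimes> (a \<otimes> v i) \<oplus> c i \<ominus> (inv \<tau> \<otimes> (a \<otimes> dot I T v \<oplus> dot I T c)) \<otimes> w i"
          by (rule id) (use \<tau>' \<tau>c v[OF i] cc[OF i] wc[OF i] dc in auto)
        also have "\<dots> = c' i \<ominus> (inv \<tau> \<otimes> dot I T c') \<otimes> w i"
          unfolding d \<tau>'(2) span_step.hyps(4)[OF i]
          using span_step.hyps(3) v[OF i] by simp
        finally show "c' i \<ominus> (inv \<tau> \<otimes> dot I T c') \<otimes> w i =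
          (a \<otimes> inv \<tau>) \<otimes> (\<tau> \<otimes> v i \<oplus> (\<ominus> dot I T v) \<otimes> w i) \<oplus> (c i \<ominus> (inv \<tau> \<otimes> dot I T c) \<otimes> w i)" by simp
      qed
    qed
    have dq: "dot I T c \<in> q" using insert.prems by simp
    then have dc: "dot I T c \<in> carrier R" using ideal_carr[OF q] by blast
    show ?thesis
    proof (rule span_add_base[OF red[OF IH], of "\<lambda>i. (inv \<tau> \<otimes> dot I T c) \<otimes> w i"])
      show "(inv \<tau> \<otimes> dot I T c) \<otimes> w i \<in> q" if "i \<in> I" for i
        using that dq wc \<tau>' by (intro ideal_rmult[OF q] ideal_lmult[OF q]) auto
      show "c i = c i \<ominus> (inv \<tau> \<otimes> dot I T c) \<otimes> w i \<oplus> (inv \<tau> \<otimes> dot I T c) \<otimes> w i" if "i \<in> I" for i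
        using cc[OF that] wc[OF that] dc \<tau>'(1) by algebra
      show "\<And>v i. v \<in> sols I (insert T Ts) \<Longrightarrow> i \<in> I \<Longrightarrow> v i \<in> carrier R"
        unfolding sols_def using k_carr by auto
    qed
  qed
qed

end

end

section \<open>Forms with coefficients in the coefficient ring\<close>

locale graded = permutable_regular R x V + unit_coeffs R k
  for R :: "('a, 'b) ring_scheme" (structure) and x :: "'i \<Rightarrow> 'a" and V :: "'i set" and k :: "'a set"
begin

text \<open>
  The homogeneous polynomials of degree \<open>s\<close> over \<open>k\<close>, evaluated at the sequence.
\<close>

inductive_set forms :: "nat \<Rightarrow> 'a set" for s where
  forms_zero: "\<zero> \<in> forms s"
| forms_step: "f \<in> forms s \<Longrightarrow> \<kappa> \<in> k \<Longrightarrow> \<alpha> \<in> mons s \<Longrightarrow> \<kappa> \<otimes> xm \<alpha> \<oplus> f \<in> forms s"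

lemma forms_Q: "f \<in> forms s \<Longrightarrow> f \<in> Q s"
  by (induction rule: forms.induct)
     (auto intro!: ideal_zero[OF Q_ideal] ideal_add[OF Q_ideal] ideal_lmult[OF Q_ideal] xm_Q k_carr)

lemma forms_carr: "f \<in> forms s \<Longrightarrow> f \<in> carrier R"
  using forms_Q ideal_carr[OF Q_ideal] by blast

lemma forms_mon: "\<kappa> \<in> k \<Longrightarrow> \<alpha> \<in> mons s \<Longrightarrow> \<kappa> \<otimes> xm \<alpha> \<in> forms s"
  using forms_step[OF forms_zero] k_carr by simp

lemma forms_add: "f \<in> forms s \<Longrightarrow> g \<in> forms s \<Longrightarrow> f \<oplus> g \<in> forms s"
proof (induction rule: forms.induct)
  case forms_zero
  then show ?case using forms_carr by simp
next
  case (forms_step f \<kappa> \<alpha>)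
  then have "\<kappa> \<otimes> xm \<alpha> \<oplus> f \<oplus> g = \<kappa> \<otimes> xm \<alpha> \<oplus> (f \<oplus> g)"
    using k_carr forms_carr by (simp add: a_assoc)
  then show ?case using forms_step by (simp add: forms.forms_step)
qed

lemma forms_smult: "f \<in> forms s \<Longrightarrow> \<mu> \<in> k \<Longrightarrow> \<mu> \<otimes> f \<in> forms s"
proof (induction rule: forms.induct)
  case forms_zero
  then show ?case using k_carr forms.forms_zero by simp
next
  case (forms_step f \<kappa> \<alpha>)
  then have "\<mu> \<otimes> (\<kappa> \<otimes> xm \<alpha> \<oplus> f) = (\<mu> \<otimes> \<kappa>) \<otimes> xm \<alpha> \<oplus> \<mu> \<otimes> f"
    using k_carr forms_carr by (simp add: r_distr m_assoc)
  then show ?case using forms_step k_mult by (simp add: forms.forms_step)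
qed

lemma forms_neg: "f \<in> forms s \<Longrightarrow> \<ominus> f \<in> forms s"
  using forms_smult[of f s "\<ominus> \<one>"] k_neg[OF k_one] forms_carr[of f s] by (simp add: l_minus)

lemma forms_minus: "f \<in> forms s \<Longrightarrow> g \<in> forms s \<Longrightarrow> f \<ominus> g \<in> forms s"
  using forms_add forms_neg by (simp add: minus_eq)

lemma forms_mult_mon: "f \<in> forms s \<Longrightarrow> \<alpha> \<in> mons t \<Longrightarrow> f \<otimes> xm \<alpha> \<in> forms (s + t)"
proof (induction rule: forms.induct)
  case forms_zero
  then show ?case using forms.forms_zero by simp
next
  case (forms_step f \<kappa> \<beta>)
  then have "(\<kappa> \<otimes> xm \<beta> \<oplus> f) \<otimes> xm \<alpha> = \<kappa> \<otimes> xm (\<beta> + \<alpha>) \<oplus> f \<otimes> xm \<alpha>"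
    using k_carr forms_carr by (simp add: l_distr m_assoc xm_add)
  then show ?case using forms_step mons_add by (simp add: forms.forms_step)
qed

lemma forms_mult: "g \<in> forms t \<Longrightarrow> f \<in> forms s \<Longrightarrow> f \<otimes> g \<in> forms (s + t)"
proof (induction rule: forms.induct)
  case forms_zero
  then show ?case using forms.forms_zero forms_carr by simp
next
  case (forms_step g \<kappa> \<beta>)
  then have "f \<otimes> (\<kappa> \<otimes> xm \<beta> \<oplus> g) = \<kappa> \<otimes> (f \<otimes> xm \<beta>) \<oplus> f \<otimes> g"
    using k_carr[of \<kappa>] forms_carr[of f s] forms_carr[of g t] by (simp add: r_distr m_lcomm)
  then show ?case using forms_step forms_add forms_smult forms_mult_mon by simp
qed

lemma forms_pow: "f \<in> forms s \<Longrightarrow> f [^] (n::nat) \<in> forms (n * s)"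
proof (induction n)
  case 0
  have "\<one> \<otimes> xm {#} \<in> forms 0" by (rule forms_mon) (auto simp: k_one mons_0)
  then show ?case by simp
next
  case (Suc n)
  then show ?case using forms_mult[of f s "f [^] n" "n * s"] by (simp add: add.commute)
qed

lemma forms_var: "i \<in> V \<Longrightarrow> x i \<in> forms 1"
  using forms_mon[of \<one> "{#i#}" 1] k_one xV by (simp add: mons_def xm_single)

lemma forms_finsum: "finite A \<Longrightarrow> (\<And>i. i \<in> A \<Longrightarrow> f i \<in> forms s) \<Longrightarrow> finsum R f A \<in> forms s"
proof (induction A rule: finite_induct)
  case empty
  then show ?case using forms_zero by simp
next
  case (insert a A)
  then have "finsum R f (insert a A) = f a \<oplus> finsum R f A"
    by (intro fs_insert) (auto intro: forms_carr)
  then show ?case using insert forms_add by simp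
qed

lemma forms_coeffs: "f \<in> forms s \<Longrightarrow> \<exists>\<phi>. (\<forall>\<alpha>. \<phi> \<alpha> \<in> k) \<and> f = finsum R (\<lambda>\<alpha>. \<phi> \<alpha> \<otimes> xm \<alpha>) (mons s)"
proof (induction rule: forms.induct)
  case forms_zero
  have "finsum R (\<lambda>\<alpha>. \<zero> \<otimes> xm \<alpha>) (mons s) = \<zero>" by (rule fs_zero) simp
  then show ?case using k_zero by (intro exI[of _ "\<lambda>_. \<zero>"]) simp
next
  case (forms_step f \<kappa> \<alpha>)
  then obtain \<phi> where \<phi>: "\<forall>\<alpha>. \<phi> \<alpha> \<in> k" "f = finsum R (\<lambda>\<alpha>. \<phi> \<alpha> \<otimes> xm \<alpha>) (mons s)" by blast
  have pc: "\<phi> \<beta> \<in> carrier R" for \<beta> using \<phi> k_carr by blast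
  have kc: "\<kappa> \<in> carrier R" using forms_step k_carr by blast
  define \<psi> where "\<psi> = \<phi>(\<alpha> := \<kappa> \<oplus> \<phi> \<alpha>)"
  have \<psi>c: "\<psi> \<beta> \<in> carrier R" for \<beta> unfolding \<psi>_def using pc kc by simp
  have "finsum R (\<lambda>\<beta>. \<psi> \<beta> \<otimes> xm \<beta>) (mons s) =
      \<psi> \<alpha> \<otimes> xm \<alpha> \<oplus> finsum R (\<lambda>\<beta>. \<psi> \<beta> \<otimes> xm \<beta>) (mons s - {\<alpha>})"
    by (rule fs_remove) (use forms_step \<psi>c in auto)
  also have "finsum R (\<lambda>\<beta>. \<psi> \<beta> \<otimes> xm \<beta>) (mons s - {\<alpha>}) = finsum R (\<lambda>\<beta>. \<phi> \<beta> \<otimes> xm \<beta>) (mons s - {\<alpha>})"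
    by (rule fs_cong) (auto simp: \<psi>_def pc)
  also have "\<psi> \<alpha> \<otimes> xm \<alpha> = \<kappa> \<otimes> xm \<alpha> \<oplus> \<phi> \<alpha> \<otimes> xm \<alpha>" unfolding \<psi>_def using pc kc by (simp add: l_distr)
  also have "\<kappa> \<otimes> xm \<alpha> \<oplus> \<phi> \<alpha> \<otimes> xm \<alpha> \<oplus> finsum R (\<lambda>\<beta>. \<phi> \<beta> \<otimes> xm \<beta>) (mons s - {\<alpha>}) = \<kappa> \<otimes> xm \<alpha> \<oplus> f"
    unfolding \<phi>(2) using pc kc forms_step by (subst fs_remove[of "mons s" \<alpha>]) (auto simp: a_assoc)
  finally have "\<kappa> \<otimes> xm \<alpha> \<oplus> f = finsum R (\<lambda>\<beta>. \<psi> \<beta> \<otimes> xm \<beta>) (mons s)" by simp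
  moreover have "\<forall>\<beta>. \<psi> \<beta> \<in> k" unfolding \<psi>_def using \<phi> forms_step k_add by auto
  ultimately show ?case by blast
qed

lemma forms_0: "f \<in> forms 0 \<Longrightarrow> f \<in> k"
  by (induction rule: forms.induct) (auto simp: mons_0 k_zero k_add k_carr)

subsection \<open>Homogeneous solutions of linear systems\<close>

text \<open>
  The equations become homogeneous of degree \<open>s\<close> when the unknown \<open>l\<close>, whose coefficients have degree
  \<open>e l\<close>, is given degree \<open>s - e l\<close>; for \<open>e l > s\<close> there are no such forms and the unknown is zero.
\<close>

definition form_sols :: "'l set \<Rightarrow> ('l \<Rightarrow> nat) \<Rightarrow> 'o set \<Rightarrow> ('o \<Rightarrow> 'l \<Rightarrow> 'a) \<Rightarrow> nat \<Rightarrow> ('l \<Rightarrow> 'a) set" where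
  "form_sols \<Lambda> e \<Omega> M s = {g. (\<forall>l\<in>\<Lambda>. if e l \<le> s then g l \<in> forms (s - e l) else g l = \<zero>) \<and>
     (\<forall>o'\<in>\<Omega>. finsum R (\<lambda>l. M o' l \<otimes> g l) \<Lambda> = \<zero>)}"

inductive sol_span :: "'l set \<Rightarrow> ('l \<Rightarrow> nat) \<Rightarrow> 'o set \<Rightarrow> ('o \<Rightarrow> 'l \<Rightarrow> 'a) \<Rightarrow> ('l \<Rightarrow> 'a) \<Rightarrow> bool"
  for \<Lambda> e \<Omega> M where
  sol_span_zero: "(\<And>l. l \<in> \<Lambda> \<Longrightarrow> f l = \<zero>) \<Longrightarrow> sol_span \<Lambda> e \<Omega> M f"
| sol_span_step: "sol_span \<Lambda> e \<Omega> M f \<Longrightarrow> g \<in> form_sols \<Lambda> e \<Omega> M s \<Longrightarrow> a \<in> carrier R \<Longrightarrow>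
     (\<And>l. l \<in> \<Lambda> \<Longrightarrow> f' l = a \<otimes> g l \<oplus> f l) \<Longrightarrow> sol_span \<Lambda> e \<Omega> M f'"

context
  fixes \<Lambda> :: "'l set" and e :: "'l \<Rightarrow> nat" and \<Omega> :: "'o set" and M :: "'o \<Rightarrow> 'l \<Rightarrow> 'a"
  assumes fin\<Lambda>: "finite \<Lambda>" and fin\<Omega>: "finite \<Omega>"
    and M: "\<And>o' l. o' \<in> \<Omega> \<Longrightarrow> l \<in> \<Lambda> \<Longrightarrow> M o' l \<in> forms (e l)"
begin

lemma form_sols_carr: "g \<in> form_sols \<Lambda> e \<Omega> M s \<Longrightarrow> l \<in> \<Lambda> \<Longrightarrow> g l \<in> carrier R"
  unfolding form_sols_def by (auto split: if_splits intro: forms_carr)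

lemma M_carr: "o' \<in> \<Omega> \<Longrightarrow> l \<in> \<Lambda> \<Longrightarrow> M o' l \<in> carrier R"
  using M forms_carr by blast

lemma sol_span_carr: "sol_span \<Lambda> e \<Omega> M f \<Longrightarrow> l \<in> \<Lambda> \<Longrightarrow> f l \<in> carrier R"
  by (induction rule: sol_span.induct) (auto intro: form_sols_carr)

lemma sol_span_add: "sol_span \<Lambda> e \<Omega> M f \<Longrightarrow> sol_span \<Lambda> e \<Omega> M f' \<Longrightarrow> (\<And>l. l \<in> \<Lambda> \<Longrightarrow> h l = f l \<oplus> f' l) \<Longrightarrow> sol_span \<Lambda> e \<Omega> M h"
proof (induction arbitrary: h rule: sol_span.induct)
  case (sol_span_zero f)
  then have h: "\<And>l. l \<in> \<Lambda> \<Longrightarrow> h l = f' l" using sol_span_carr[OF sol_span_zero.prems(1)] by simp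
  from sol_span_zero.prems(1) h show ?case
  proof (induction arbitrary: h rule: sol_span.induct)
    case (sol_span_zero f)
    then show ?case by (intro sol_span.sol_span_zero) auto
  next
    case (sol_span_step f g s a f')
    show ?case by (rule sol_span.sol_span_step[OF sol_span_step.hyps(1-3)]) (use sol_span_step in auto)
  qed
next
  case (sol_span_step f g s a f'')
  have "sol_span \<Lambda> e \<Omega> M (\<lambda>l. f l \<oplus> f' l)" by (rule sol_span_step.IH) (use sol_span_step in auto)
  then show ?case
  proof (rule sol_span.sol_span_step[OF _ sol_span_step.hyps(2,3)])
    show "h l = a \<otimes> g l \<oplus> (f l \<oplus> f' l)" if l: "l \<in> \<Lambda>" for l
      using sol_span_step.prems(2)[OF l] sol_span_step.hyps(4)[OF l] sol_span_carr[OF sol_span_step.hyps(1) l]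
        sol_span_carr[OF sol_span_step.prems(1) l] form_sols_carr[OF sol_span_step.hyps(2) l] sol_span_step.hyps(3)
      by (simp add: a_assoc)
  qed
qed

lemma sol_span_solution: "sol_span \<Lambda> e \<Omega> M f \<Longrightarrow> o' \<in> \<Omega> \<Longrightarrow> finsum R (\<lambda>l. M o' l \<otimes> f l) \<Lambda> = \<zero>"
proof (induction rule: sol_span.induct)
  case (sol_span_zero f)
  then show ?case by (intro fs_zero) (auto simp: M_carr)
next
  case (sol_span_step f g s a f')
  have "finsum R (\<lambda>l. M o' l \<otimes> f' l) \<Lambda> = finsum R (\<lambda>l. a \<otimes> (M o' l \<otimes> g l) \<oplus> M o' l \<otimes> f l) \<Lambda>"
  proof (rule fs_cong)
    fix l assume l: "l \<in> \<Lambda>"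
    note * = form_sols_carr[OF sol_span_step.hyps(2) l] M_carr[OF sol_span_step.prems l] sol_span_carr[OF sol_span_step.hyps(1) l]
      sol_span_step.hyps(3)
    show "M o' l \<otimes> f' l = a \<otimes> (M o' l \<otimes> g l) \<oplus> M o' l \<otimes> f l"
      unfolding sol_span_step.hyps(4)[OF l] using * by algebra
    show "a \<otimes> (M o' l \<otimes> g l) \<oplus> M o' l \<otimes> f l \<in> carrier R" using * by simp
  qed
  also have "\<dots> = finsum R (\<lambda>l. a \<otimes> (M o' l \<otimes> g l)) \<Lambda> \<oplus> finsum R (\<lambda>l. M o' l \<otimes> f l) \<Lambda>"
    using form_sols_carr[OF sol_span_step.hyps(2)] M_carr[OF sol_span_step.prems] sol_span_carr[OF sol_span_step.hyps(1)] sol_span_step.hyps(3)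
    by (intro fs_add) auto
  also have "finsum R (\<lambda>l. a \<otimes> (M o' l \<otimes> g l)) \<Lambda> = a \<otimes> finsum R (\<lambda>l. M o' l \<otimes> g l) \<Lambda>"
    using form_sols_carr[OF sol_span_step.hyps(2)] M_carr[OF sol_span_step.prems] sol_span_step.hyps(3) fin\<Lambda>
    by (intro fs_lmult[symmetric]) auto
  also have "finsum R (\<lambda>l. M o' l \<otimes> g l) \<Lambda> = \<zero>" using sol_span_step.hyps(2) sol_span_step.prems unfolding form_sols_def by auto
  finally show ?case using sol_span_step by simp
qed

text \<open>
  Write \<open>u l\<close> as a sum of monomials of degree \<open>s - e l\<close> with coefficients in \<open>R\<close>. By
  quasi-regularity these coefficients satisfy, modulo \<open>q\<close>, the linear system over \<open>k\<close> that
  describes solutions in forms. So they are combinations of solutions over \<open>k\<close>, up to coefficients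
  in \<open>q\<close>, which contribute one order higher.
\<close>

lemma approx_step:
  assumes u: "\<And>l. l \<in> \<Lambda> \<Longrightarrow> u l \<in> Q (s - e l)"
    and eq: "\<And>o'. o' \<in> \<Omega> \<Longrightarrow> finsum R (\<lambda>l. M o' l \<otimes> u l) \<Lambda> = \<zero>"
  shows "\<exists>f. sol_span \<Lambda> e \<Omega> M f \<and> (\<forall>l\<in>\<Lambda>. u l \<ominus> f l \<in> Q (Suc s - e l))"
proof -
  define L where "L = {l \<in> \<Lambda>. e l \<le> s}"
  have L: "finite L" "L \<subseteq> \<Lambda>" unfolding L_def using fin\<Lambda> by auto
  define I where "I = Sigma L (\<lambda>l. mons (s - e l))"
  have finI: "finite I" unfolding I_def using L by auto
  have uc: "u l \<in> carrier R" if "l \<in> \<Lambda>" for l using u[OF that] ideal_carr[OF Q_ideal] by blast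
  have "\<forall>l\<in>L. \<exists>c. (\<forall>\<alpha>\<in>mons (s - e l). c \<alpha> \<in> carrier R) \<and>
      u l = finsum R (\<lambda>\<alpha>. c \<alpha> \<otimes> xm \<alpha>) (mons (s - e l))"
    using Q_finsum u L by blast
  then obtain c' where c': "\<And>l \<alpha>. l \<in> L \<Longrightarrow> \<alpha> \<in> mons (s - e l) \<Longrightarrow> c' l \<alpha> \<in> carrier R"
    "\<And>l. l \<in> L \<Longrightarrow> u l = finsum R (\<lambda>\<alpha>. c' l \<alpha> \<otimes> xm \<alpha>) (mons (s - e l))" by metis
  define c where "c i = c' (fst i) (snd i)" for i
  have cc: "\<And>i. i \<in> I \<Longrightarrow> c i \<in> carrier R" unfolding c_def I_def using c' by auto
  define ev where "ev c l = finsum R (\<lambda>\<alpha>. c (l, \<alpha>) \<otimes> xm \<alpha>) (mons (s - e l))" for c and l :: 'l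
  have ev_carr: "ev c l \<in> carrier R" if "\<And>i. i \<in> I \<Longrightarrow> c i \<in> carrier R" "l \<in> L" for c l
    unfolding ev_def using that by (intro fs_closed) (auto simp: I_def)
  have evu: "ev c l = u l" if "l \<in> L" for l using c'(2)[OF that] unfolding ev_def c_def by simp
  have "\<forall>o'\<in>\<Omega>. \<forall>i\<in>I. \<exists>\<phi>. (\<forall>\<alpha>. \<phi> \<alpha> \<in> k) \<and>
      M o' (fst i) \<otimes> xm (snd i) = finsum R (\<lambda>\<beta>. \<phi> \<beta> \<otimes> xm \<beta>) (mons s)"
  proof (intro ballI)
    fix o' i assume o: "o' \<in> \<Omega>" and i: "i \<in> I"
    then have l: "fst i \<in> L" "snd i \<in> mons (s - e (fst i))" "e (fst i) \<le> s" unfolding I_def L_def by auto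
    have "M o' (fst i) \<otimes> xm (snd i) \<in> forms (e (fst i) + (s - e (fst i)))"
      using M[OF o, of "fst i"] l L by (intro forms_mult_mon) auto
    then show "\<exists>\<phi>. (\<forall>\<alpha>. \<phi> \<alpha> \<in> k) \<and> M o' (fst i) \<otimes> xm (snd i) = finsum R (\<lambda>\<beta>. \<phi> \<beta> \<otimes> xm \<beta>) (mons s)"
      using forms_coeffs l(3) by simp
  qed
  then obtain T where T: "\<And>o' i \<beta>. o' \<in> \<Omega> \<Longrightarrow> i \<in> I \<Longrightarrow> T o' i \<beta> \<in> k"
    "\<And>o' i. o' \<in> \<Omega> \<Longrightarrow> i \<in> I \<Longrightarrow> M o' (fst i) \<otimes> xm (snd i) = finsum R (\<lambda>\<beta>. T o' i \<beta> \<otimes> xm \<beta>) (mons s)"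
    by metis
  have Tc: "\<And>o' i \<beta>. o' \<in> \<Omega> \<Longrightarrow> i \<in> I \<Longrightarrow> T o' i \<beta> \<in> carrier R" using T(1) k_carr by blast
  define Ts where "Ts = (\<lambda>(o', \<beta>) i. T o' i \<beta>) ` (\<Omega> \<times> mons s)"
  have key: "finsum R (\<lambda>l. M o' l \<otimes> ev c l) L = finsum R (\<lambda>\<beta>. dot I (\<lambda>i. T o' i \<beta>) c \<otimes> xm \<beta>) (mons s)"
    if o: "o' \<in> \<Omega>" and c: "\<And>i. i \<in> I \<Longrightarrow> c i \<in> carrier R" for o' c
  proof -
    have Mc: "\<And>l. l \<in> L \<Longrightarrow> M o' l \<in> carrier R" using M_carr[OF o] L by blast
    have "finsum R (\<lambda>l. M o' l \<otimes> ev c l) L =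
        finsum R (\<lambda>l. finsum R (\<lambda>\<alpha>. c (l, \<alpha>) \<otimes> (M o' l \<otimes> xm \<alpha>)) (mons (s - e l))) L"
    proof (rule fs_cong)
      fix l assume l: "l \<in> L"
      have cl: "c (l, \<alpha>) \<in> carrier R" if "\<alpha> \<in> mons (s - e l)" for \<alpha> using c that l unfolding I_def by auto
      have "M o' l \<otimes> ev c l = finsum R (\<lambda>\<alpha>. M o' l \<otimes> (c (l, \<alpha>) \<otimes> xm \<alpha>)) (mons (s - e l))"
        unfolding ev_def using Mc[OF l] cl by (intro fs_lmult) auto
      also have "\<dots> = finsum R (\<lambda>\<alpha>. c (l, \<alpha>) \<otimes> (M o' l \<otimes> xm \<alpha>)) (mons (s - e l))"
        using Mc[OF l] cl by (intro fs_cong) (auto simp: m_lcomm)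
      finally show "M o' l \<otimes> ev c l = finsum R (\<lambda>\<alpha>. c (l, \<alpha>) \<otimes> (M o' l \<otimes> xm \<alpha>)) (mons (s - e l))" .
      show "finsum R (\<lambda>\<alpha>. c (l, \<alpha>) \<otimes> (M o' l \<otimes> xm \<alpha>)) (mons (s - e l)) \<in> carrier R"
        using Mc[OF l] cl by (intro fs_closed) auto
    qed
    also have "\<dots> = finsum R (\<lambda>i. c i \<otimes> (M o' (fst i) \<otimes> xm (snd i))) I"
      unfolding I_def using c Mc L by (subst fs_Sigma) (auto simp: I_def)
    also have "\<dots> = finsum R (\<lambda>i. finsum R (\<lambda>\<beta>. (T o' i \<beta> \<otimes> c i) \<otimes> xm \<beta>) (mons s)) I"
    proof (rule fs_cong)
      fix i assume i: "i \<in> I"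
      have "c i \<otimes> (M o' (fst i) \<otimes> xm (snd i)) = finsum R (\<lambda>\<beta>. c i \<otimes> (T o' i \<beta> \<otimes> xm \<beta>)) (mons s)"
        unfolding T(2)[OF o i] using c[OF i] Tc[OF o i] by (intro fs_lmult) auto
      also have "\<dots> = finsum R (\<lambda>\<beta>. (T o' i \<beta> \<otimes> c i) \<otimes> xm \<beta>) (mons s)"
        using c[OF i] Tc[OF o i] by (intro fs_cong) (auto simp: m_ac)
      finally show "c i \<otimes> (M o' (fst i) \<otimes> xm (snd i)) = finsum R (\<lambda>\<beta>. (T o' i \<beta> \<otimes> c i) \<otimes> xm \<beta>) (mons s)" .
      show "finsum R (\<lambda>\<beta>. (T o' i \<beta> \<otimes> c i) \<otimes> xm \<beta>) (mons s) \<in> carrier R"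
        using c[OF i] Tc[OF o i] by (intro fs_closed) auto
    qed
    also have "\<dots> = finsum R (\<lambda>\<beta>. finsum R (\<lambda>i. (T o' i \<beta> \<otimes> c i) \<otimes> xm \<beta>) I) (mons s)"
      using c Tc[OF o] by (intro fs_swap finI) auto
    also have "\<dots> = finsum R (\<lambda>\<beta>. dot I (\<lambda>i. T o' i \<beta>) c \<otimes> xm \<beta>) (mons s)"
      unfolding dot_def using c Tc[OF o] finI by (intro fs_cong) (auto simp: fs_rmult)
    finally show ?thesis .
  qed
  have dotq: "dot I U c \<in> Q 1" if U: "U \<in> Ts" for U
  proof -
    obtain o' \<beta> where o: "o' \<in> \<Omega>" "\<beta> \<in> mons s" "U = (\<lambda>i. T o' i \<beta>)" using U unfolding Ts_def by auto
    have Mu: "M o' l \<otimes> u l \<in> carrier R" if "l \<in> \<Lambda>" for l using M_carr[OF o(1) that] uc[OF that] by simp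
    have "\<Lambda> = L \<union> (\<Lambda> - L)" using L by auto
    then have "finsum R (\<lambda>l. M o' l \<otimes> u l) L \<oplus> finsum R (\<lambda>l. M o' l \<otimes> u l) (\<Lambda> - L) = \<zero>"
      using fs_Un[of L "\<Lambda> - L" "\<lambda>l. M o' l \<otimes> u l"] L fin\<Lambda> Mu eq[OF o(1)] by auto
    moreover have "finsum R (\<lambda>l. M o' l \<otimes> u l) (\<Lambda> - L) \<in> Q (Suc s)"
    proof (rule fs_ideal[OF Q_ideal])
      fix l assume l: "l \<in> \<Lambda> - L"
      then have "M o' l \<in> Q (Suc s)" using forms_Q[OF M[OF o(1), of l]] Q_mono[of "Suc s" "e l"] unfolding L_def by auto
      then show "M o' l \<otimes> u l \<in> Q (Suc s)" using uc l by (intro ideal_rmult[OF Q_ideal]) auto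
    qed (use fin\<Lambda> in simp)
    moreover have "finsum R (\<lambda>l. M o' l \<otimes> u l) L \<in> carrier R" using Mu L(2) by (intro fs_closed) auto
    ultimately have "finsum R (\<lambda>l. M o' l \<otimes> u l) L \<in> Q (Suc s)"
      using ideal_add_cancel[OF Q_ideal] ideal_zero[OF Q_ideal] by metis
    moreover have "finsum R (\<lambda>l. M o' l \<otimes> u l) L = finsum R (\<lambda>l. M o' l \<otimes> ev c l) L"
    proof (rule fs_cong)
      show "M o' l \<otimes> u l = M o' l \<otimes> ev c l" "M o' l \<otimes> ev c l \<in> carrier R" if "l \<in> L" for l
        using evu[OF that] Mu[of l] L(2) that by auto
    qed
    ultimately have "finsum R (\<lambda>\<beta>. dot I (\<lambda>i. T o' i \<beta>) c \<otimes> xm \<beta>) (mons s) \<in> Q (Suc s)"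
      using key[OF o(1) cc] by simp
    then show ?thesis unfolding o(3)
      by (intro quasi_regular[OF _ _ o(2)]) (use cc Tc[OF o(1)] finI in \<open>auto simp: dot_def\<close>)
  qed
  have "span_mod (Q 1) I (sols I Ts) c"
    by (rule span_sols[OF Q_ideal finI _ _ cc dotq]) (use fin\<Omega> T(1) in \<open>auto simp: Ts_def\<close>)
  then have "\<exists>f. sol_span \<Lambda> e \<Omega> M f \<and> (\<forall>l\<in>L. ev c l \<ominus> f l \<in> Q (Suc s - e l))"
  proof (induction rule: span_mod.induct)
    case (span_base w)
    have "ev w l \<ominus> \<zero> \<in> Q (Suc s - e l)" if l: "l \<in> L" for l
    proof -
      have "ev w l \<in> Q (1 + (s - e l))"
        unfolding ev_def
      proof (rule fs_ideal[OF Q_ideal])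
        show "w (l, \<alpha>) \<otimes> xm \<alpha> \<in> Q (1 + (s - e l))" if "\<alpha> \<in> mons (s - e l)" for \<alpha>
          by (rule Q_mult) (use span_base l that in \<open>auto simp: I_def intro: xm_Q\<close>)
      qed simp
      moreover have "1 + (s - e l) = Suc s - e l" using l unfolding L_def by auto
      ultimately show ?thesis using ideal_carr[OF Q_ideal] by (auto simp: minus_eq)
    qed
    then show ?case by (intro exI[of _ "\<lambda>_. \<zero>"]) (auto intro: sol_span_zero)
  next
    case (span_step c v a c')
    then obtain f where f: "sol_span \<Lambda> e \<Omega> M f" "\<forall>l\<in>L. ev c l \<ominus> f l \<in> Q (Suc s - e l)" by blast
    have vk: "\<And>i. i \<in> I \<Longrightarrow> v i \<in> k" using span_step.hyps(2) unfolding sols_def by auto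
    have vc: "\<And>i. i \<in> I \<Longrightarrow> v i \<in> carrier R" using vk k_carr by blast
    have cc: "\<And>i. i \<in> I \<Longrightarrow> c i \<in> carrier R"
      by (rule span_carr[OF Q_ideal finI span_step.hyps(1)]) (auto simp: sols_def k_carr)
    define g where "g l = (if e l \<le> s then ev v l else \<zero>)" for l
    have g: "g \<in> form_sols \<Lambda> e \<Omega> M s"
    proof -
      have "finsum R (\<lambda>l. M o' l \<otimes> g l) \<Lambda> = \<zero>" if o: "o' \<in> \<Omega>" for o'
      proof -
        have gc: "g l \<in> carrier R" if "l \<in> \<Lambda>" for l
          unfolding g_def using ev_carr[of v l, OF vc] that by (auto simp: L_def)
        have "finsum R (\<lambda>l. M o' l \<otimes> g l) \<Lambda> = finsum R (\<lambda>l. M o' l \<otimes> g l) L \<oplus> finsum R (\<lambda>l. M o' l \<otimes> g l) (\<Lambda> - L)"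
          using fs_Un[of L "\<Lambda> - L" "\<lambda>l. M o' l \<otimes> g l"] L fin\<Lambda> M_carr[OF o] gc by (auto simp: Un_absorb1)
        also have "finsum R (\<lambda>l. M o' l \<otimes> g l) (\<Lambda> - L) = \<zero>"
          by (rule fs_zero) (use M_carr[OF o] in \<open>auto simp: g_def L_def\<close>)
        also have "finsum R (\<lambda>l. M o' l \<otimes> g l) L = finsum R (\<lambda>l. M o' l \<otimes> ev v l) L"
          by (rule fs_cong) (use M_carr[OF o] ev_carr[of v, OF vc] L in \<open>auto simp: g_def L_def\<close>)
        also have "\<dots> = finsum R (\<lambda>\<beta>. dot I (\<lambda>i. T o' i \<beta>) v \<otimes> xm \<beta>) (mons s)" by (rule key[OF o vc])
        also have "\<dots> = \<zero>"
        proof (rule fs_zero)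
          fix \<beta> assume "\<beta> \<in> mons s"
          then have "dot I (\<lambda>i. T o' i \<beta>) v = \<zero>" using span_step.hyps(2) o unfolding sols_def Ts_def by auto
          then show "dot I (\<lambda>i. T o' i \<beta>) v \<otimes> xm \<beta> = \<zero>" by simp
        qed
        finally show ?thesis by simp
      qed
      moreover have "ev v l \<in> forms (s - e l)" if "l \<in> L" for l
        unfolding ev_def by (rule forms_finsum) (use vk that in \<open>auto simp: I_def intro!: forms_mon\<close>)
      ultimately show ?thesis unfolding form_sols_def g_def by (auto simp: L_def)
    qed
    define f' where "f' l = a \<otimes> g l \<oplus> f l" for l
    have "sol_span \<Lambda> e \<Omega> M f'" by (rule sol_span_step[OF f(1) g span_step.hyps(3)]) (simp add: f'_def)
    moreover have "ev c' l \<ominus> f' l \<in> Q (Suc s - e l)" if l: "l \<in> L" for l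
    proof -
      have *: "v (l, \<alpha>) \<in> carrier R" "c (l, \<alpha>) \<in> carrier R" "c' (l, \<alpha>) = a \<otimes> v (l, \<alpha>) \<oplus> c (l, \<alpha>)"
        if "\<alpha> \<in> mons (s - e l)" for \<alpha> using that l vc cc span_step.hyps(4) unfolding I_def by auto
      have "ev c' l = finsum R (\<lambda>\<alpha>. a \<otimes> (v (l, \<alpha>) \<otimes> xm \<alpha>) \<oplus> c (l, \<alpha>) \<otimes> xm \<alpha>) (mons (s - e l))"
        unfolding ev_def by (rule fs_cong) (use * span_step.hyps(3) in \<open>auto simp: l_distr m_assoc\<close>)
      also have "\<dots> = finsum R (\<lambda>\<alpha>. a \<otimes> (v (l, \<alpha>) \<otimes> xm \<alpha>)) (mons (s - e l)) \<oplus> ev c l"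
        unfolding ev_def using * span_step.hyps(3) by (intro fs_add) auto
      also have "finsum R (\<lambda>\<alpha>. a \<otimes> (v (l, \<alpha>) \<otimes> xm \<alpha>)) (mons (s - e l)) = a \<otimes> ev v l"
        unfolding ev_def using * span_step.hyps(3) by (intro fs_lmult[symmetric]) auto
      finally have evc': "ev c' l = a \<otimes> ev v l \<oplus> ev c l" .
      have gl: "g l = ev v l" using l unfolding g_def L_def by auto
      have "ev v l \<in> carrier R" "ev c l \<in> carrier R" "f l \<in> carrier R"
        using ev_carr[of v l, OF vc l] ev_carr[of c l, OF cc l] sol_span_carr[OF f(1)] l L by auto
      then have "ev c' l \<ominus> f' l = ev c l \<ominus> f l"
        unfolding evc' f'_def gl using span_step.hyps(3) by algebra
      then show ?thesis using f(2) l by simp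
    qed
    ultimately show ?case by blast
  qed
  then obtain f where f: "sol_span \<Lambda> e \<Omega> M f" "\<forall>l\<in>L. ev c l \<ominus> f l \<in> Q (Suc s - e l)" by blast
  have "u l \<ominus> f l \<in> Q (Suc s - e l)" if l: "l \<in> \<Lambda>" for l
  proof (cases "l \<in> L")
    case True
    then show ?thesis using f(2) evu by auto
  next
    case False
    then have "Suc s - e l = 0" using l unfolding L_def by auto
    then show ?thesis using Q_0 uc[OF l] sol_span_carr[OF f(1) l] by simp
  qed
  then show ?thesis using f(1) by blast
qed

text \<open>
  An elementary form of the flatness of \<open>R\<close> over the polynomial ring \<open>k[X]\<close>.
\<close>

lemma graded_approximation:
  assumes r: "\<And>l. l \<in> \<Lambda> \<Longrightarrow> r l \<in> carrier R"
    and eq: "\<And>o'. o' \<in> \<Omega> \<Longrightarrow> finsum R (\<lambda>l. M o' l \<otimes> r l) \<Lambda> = \<zero>"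
  shows "\<exists>f. sol_span \<Lambda> e \<Omega> M f \<and> (\<forall>l\<in>\<Lambda>. r l \<ominus> f l \<in> Q (s - e l))"
proof (induction s)
  case 0
  then show ?case using r by (intro exI[of _ "\<lambda>_. \<zero>"]) (auto simp: Q_0 intro: sol_span_zero)
next
  case (Suc s)
  then obtain f where f: "sol_span \<Lambda> e \<Omega> M f" "\<forall>l\<in>\<Lambda>. r l \<ominus> f l \<in> Q (s - e l)" by blast
  have fc: "\<And>l. l \<in> \<Lambda> \<Longrightarrow> f l \<in> carrier R" using sol_span_carr f(1) by blast
  have "finsum R (\<lambda>l. M o' l \<otimes> (r l \<ominus> f l)) \<Lambda> = \<zero>" if o: "o' \<in> \<Omega>" for o'
  proof -
    have "finsum R (\<lambda>l. M o' l \<otimes> (r l \<ominus> f l)) \<Lambda> = finsum R (\<lambda>l. M o' l \<otimes> r l \<ominus> M o' l \<otimes> f l) \<Lambda>"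
    proof (rule fs_cong)
      show "M o' l \<otimes> (r l \<ominus> f l) = M o' l \<otimes> r l \<ominus> M o' l \<otimes> f l" if "l \<in> \<Lambda>" for l
        using M_carr[OF o that] r[OF that] fc[OF that] by algebra
    qed (use M_carr[OF o] r fc in auto)
    also have "\<dots> = \<zero> \<ominus> \<zero>"
      using eq[OF o] sol_span_solution[OF f(1) o] M_carr[OF o] r fc fin\<Lambda> by (subst fs_diff) auto
    finally show ?thesis by simp
  qed
  then obtain f' where f': "sol_span \<Lambda> e \<Omega> M f'" "\<forall>l\<in>\<Lambda>. r l \<ominus> f l \<ominus> f' l \<in> Q (Suc s - e l)"
    using approx_step[of "\<lambda>l. r l \<ominus> f l" s] f(2) by blast
  have "r l \<ominus> (f l \<oplus> f' l) = r l \<ominus> f l \<ominus> f' l" if "l \<in> \<Lambda>" for l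
    using r[OF that] fc[OF that] sol_span_carr[OF f'(1) that] by algebra
  moreover have "sol_span \<Lambda> e \<Omega> M (\<lambda>l. f l \<oplus> f' l)" by (rule sol_span_add[OF f(1) f'(1)]) simp
  ultimately show ?case using f'(2) by (intro exI[of _ "\<lambda>l. f l \<oplus> f' l"]) auto
qed

end

end


section \<open>Regular sequences and coefficients in local rings\<close>

context local_noeth
begin

text \<open>
  Induction on the length. To cancel the last element modulo a proper subset of the others, enlarge
  the subset by some \<open>y j\<close>, for which cancellation is known, and then cancel \<open>y j\<close>: for the colon
  ideal \<open>N\<close> this gives \<open>N = (T) + y j N\<close>, and Nakayama's lemma applies. If the last element is among
  those divided out, it is first exchanged with \<open>y i\<close>.
\<close>

lemma regular_sequence_permutable:
  fixes y :: "nat \<Rightarrow> 'a"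
  assumes ym: "\<And>i. i < n \<Longrightarrow> y i \<in> \<mm>"
    and reg: "\<And>i r. i < n \<Longrightarrow> r \<in> carrier R \<Longrightarrow> y i \<otimes> r \<in> Idl (y ` {..<i}) \<Longrightarrow> r \<in> Idl (y ` {..<i})"
    and "T \<subseteq> {..<n}" "i \<in> {..<n} - T" "r \<in> carrier R" "y i \<otimes> r \<in> Idl (y ` T)"
  shows "r \<in> Idl (y ` T)"
  using assms
proof (induction n arbitrary: T i r)
  case 0
  then show ?case by simp
next
  case (Suc n)
  have yc: "y i \<in> carrier R" if "i \<le> n" for i using Suc.prems(1)[of i] that ideal_carr[OF ideal_m] by simp
  have idl: "ideal (Idl (y ` T)) R" if "T \<subseteq> {..n}" for T
    using yc that by (intro genideal_ideal) auto
  have IH: "r \<in> Idl (y ` T)"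
    if "T \<subseteq> {..<n}" "i \<in> {..<n} - T" "r \<in> carrier R" "y i \<otimes> r \<in> Idl (y ` T)" for T i r
    using Suc.IH[of T i r] Suc.prems(1,2) that by simp
  have last: "r \<in> Idl (y ` T)"
    if "T \<subseteq> {..<n}" "r \<in> carrier R" "y n \<otimes> r \<in> Idl (y ` T)" for T r
    using that
  proof (induction "card ({..<n} - T)" arbitrary: T r)
    case 0
    then have "T = {..<n}" by auto
    then show ?case using Suc.prems(2)[of n r] 0 by simp
  next
    case (Suc c)
    then obtain j where j: "j \<in> {..<n} - T" by (metis card.empty ex_in_conv nat.distinct(1))
    have jc: "y j \<in> carrier R" and nc: "y n \<in> carrier R" using yc j by auto
    have Tc: "y ` T \<subseteq> carrier R" using Suc.prems(1) yc by auto
    have I: "ideal (Idl (y ` T)) R" by (rule genideal_ideal[OF Tc])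
    define N where "N = {r \<in> carrier R. r \<otimes> y n \<in> Idl (y ` T)}"
    have N: "ideal N R" unfolding N_def by (rule ideal_colon[OF I nc])
    have TN: "Idl (y ` T) \<subseteq> N" unfolding N_def using ideal_carr[OF I] ideal_rmult[OF I _ nc] by auto
    have "N = Idl (y ` T)"
    proof (rule nakayama[OF N I TN], rule subsetI)
      fix u assume u: "u \<in> N"
      then have uc: "u \<in> carrier R" "y n \<otimes> u \<in> Idl (y ` T)" unfolding N_def using nc by (auto simp: m_comm)
      have "card ({..<n} - T) = Suc (card ({..<n} - insert j T))"
        using j by (metis Diff_insert card_Suc_Diff1 finite_Diff finite_lessThan)
      then have "c = card ({..<n} - insert j T)" using Suc.hyps(2) by simp
      moreover have "y n \<otimes> u \<in> Idl (y ` insert j T)" using uc Idl_mono[of "y ` T" "y ` insert j T"] by auto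
      ultimately have "u \<in> Idl (insert (y j) (y ` T))"
        using Suc.hyps(1)[of "insert j T" u] Suc.prems(1) j uc by auto
      then obtain s t where s: "s \<in> carrier R" "t \<in> Idl (y ` T)" "u = s \<otimes> y j \<oplus> t"
        unfolding Idl_insert[OF Tc jc] by blast
      have tc: "t \<in> carrier R" using s ideal_carr[OF I] by blast
      have "y j \<otimes> (y n \<otimes> s) = y n \<otimes> u \<ominus> y n \<otimes> t" unfolding s(3) using s(1) tc nc jc by algebra
      also have "\<dots> \<in> Idl (y ` T)" using uc(2) ideal_lmult[OF I s(2) nc] ideal_minus[OF I] by blast
      finally have "y n \<otimes> s \<in> Idl (y ` T)" using IH[of T j "y n \<otimes> s"] Suc.prems(1) j s(1) nc by simp
      then have "s \<in> N" unfolding N_def using s(1) nc by (simp add: m_comm)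
      moreover have "y j \<in> \<mm>" using \<open>\<And>i. i < Suc n \<Longrightarrow> y i \<in> \<mm>\<close> j by simp
      moreover have "u = y j \<otimes> s \<oplus> t" using s jc by (simp add: m_comm)
      ultimately show "u \<in> Idl (Idl (y ` T) \<union> {y \<otimes> n | y n. y \<in> \<mm> \<and> n \<in> N})" (is "_ \<in> Idl ?A")
      proof -
        assume *: "s \<in> N" "y j \<in> \<mm>" "u = y j \<otimes> s \<oplus> t"
        have A: "?A \<subseteq> carrier R" using ideal_carr[OF I] ideal_carr[OF ideal_m] ideal_carr[OF N] by auto
        have "y j \<otimes> s \<in> Idl ?A" by (rule Idl_self[OF A]) (use * in blast)
        moreover have "t \<in> Idl ?A" by (rule Idl_self[OF A]) (use s in blast)
        ultimately show ?thesis unfolding *(3) by (rule ideal_add[OF genideal_ideal[OF A]])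
      qed
    qed
    moreover have "r \<in> N" unfolding N_def using Suc.prems nc by (simp add: m_comm)
    ultimately show ?case by simp
  qed
  show ?case
  proof (cases "i = n")
    case True
    then have "T \<subseteq> {..<n}" using Suc.prems(3,4) by (auto simp: less_Suc_eq)
    then show ?thesis using last[of T r] Suc.prems True by simp
  next
    case False
    then have i: "i < n" using Suc.prems by auto
    show ?thesis
    proof (cases "n \<in> T")
      case False
      then have "T \<subseteq> {..<n}" using Suc.prems(3) by (auto simp: less_Suc_eq)
      then show ?thesis using IH[of T i r] Suc.prems i by simp
    next
      case True
      define T' where "T' = T - {n}"
      have T': "T = insert n T'" "T' \<subseteq> {..<n}" "i \<notin> T'" unfolding T'_def using True Suc.prems by (auto simp: less_Suc_eq)
      have T'c: "y ` T' \<subseteq> carrier R" using T' yc by auto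
      have I: "ideal (Idl (y ` T')) R" by (rule genideal_ideal[OF T'c])
      have ic: "y i \<in> carrier R" and nc: "y n \<in> carrier R" and r: "r \<in> carrier R" using yc i Suc.prems by auto
      obtain s t where s: "s \<in> carrier R" "t \<in> Idl (y ` T')" "y i \<otimes> r = s \<otimes> y n \<oplus> t"
        using Suc.prems(6) Idl_insert[OF T'c nc] unfolding T'(1) by auto
      have tc: "t \<in> carrier R" using s ideal_carr[OF I] by blast
      have iT: "ideal (Idl (insert (y i) (y ` T'))) R" using T'c ic by (intro genideal_ideal) auto
      have "y n \<otimes> s = r \<otimes> y i \<oplus> (\<ominus> t)"
      proof -
        have "y n \<otimes> s = (s \<otimes> y n \<oplus> t) \<ominus> t" using s tc nc by algebra
        also have "\<dots> = y i \<otimes> r \<ominus> t" using s(3) by simp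
        finally show ?thesis using ic r by (simp add: minus_eq m_comm)
      qed
      moreover have "\<ominus> t \<in> Idl (y ` T')" using s(2) ideal_neg[OF I] by blast
      ultimately have "y n \<otimes> s \<in> Idl (y ` insert i T')"
        unfolding image_insert Idl_insert[OF T'c ic] using r by blast
      then have "s \<in> Idl (insert (y i) (y ` T'))" using last[of "insert i T'" s] T' i s by auto
      then obtain s' t' where s': "s' \<in> carrier R" "t' \<in> Idl (y ` T')" "s = s' \<otimes> y i \<oplus> t'"
        unfolding Idl_insert[OF T'c ic] by blast
      have t'c: "t' \<in> carrier R" using s' ideal_carr[OF I] by blast
      have "y i \<otimes> (r \<ominus> s' \<otimes> y n) = y i \<otimes> r \<ominus> (s' \<otimes> y i) \<otimes> y n" using r s' ic nc by algebra
      also have "\<dots> = (s' \<otimes> y i \<oplus> t') \<otimes> y n \<oplus> t \<ominus> (s' \<otimes> y i) \<otimes> y n" unfolding s(3) s'(3) by simp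
      also have "\<dots> = t' \<otimes> y n \<oplus> t" using s'(1) t'c tc ic nc by algebra
      also have "\<dots> \<in> Idl (y ` T')" using ideal_rmult[OF I s'(2) nc] s(2) ideal_add[OF I] by blast
      finally have 1: "r \<ominus> s' \<otimes> y n \<in> Idl (y ` T')" using IH[of T' i "r \<ominus> s' \<otimes> y n"] T' i r s' nc by simp
      have 2: "r = s' \<otimes> y n \<oplus> (r \<ominus> s' \<otimes> y n)" using r s'(1) nc by algebra
      show ?thesis unfolding T'(1) image_insert Idl_insert[OF T'c nc]
        by (rule CollectI, rule exI, rule exI, rule conjI[OF 2 conjI[OF s'(1) 1]])
    qed
  qed
qed

definition int_multiples :: "'a set" where
  "int_multiples = range (\<lambda>i::int. [i] \<cdot> \<one>)"

text \<open>
  If a multiple of 1 is in the maximal ideal, the characteristic of the residue field divides the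
  multiplier. As \<open>R\<close> has the same characteristic, the multiple is zero.
\<close>

lemma int_multiples_unit_coeffs:
  assumes eq: "equicharacteristic R \<mm>"
  shows "unit_coeffs R int_multiples"
proof
  interpret m: ideal \<mm> R by (rule ideal_m)
  interpret h: ring_hom_cring R "R Quot \<mm>" "(+>) \<mm>" by (rule m.rcos_ring_hom_cring[OF is_cring])
  have qzero: "\<zero>\<^bsub>R Quot \<mm>\<^esub> = \<mm>" unfolding FactRing_def by simp
  have hn: "\<mm> +> ([l] \<cdot> \<one>) = [l] \<cdot>\<^bsub>R Quot \<mm>\<^esub> \<one>\<^bsub>R Quot \<mm>\<^esub>" for l :: nat
  proof (induction l)
    case 0
    then show ?case using h.hom_zero by simp
  next
    case (Suc l)
    then show ?case by simp
  qed
  have nat_unit: "[l] \<cdot> \<one> = \<zero>" if "[l] \<cdot> \<one> \<in> \<mm>" for l :: nat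
  proof -
    have "\<mm> +> ([l] \<cdot> \<one>) = \<mm>" by (rule a_rcos_zero[OF ideal_m that])
    then have "[l] \<cdot>\<^bsub>R Quot \<mm>\<^esub> \<one>\<^bsub>R Quot \<mm>\<^esub> = \<mm>" unfolding hn .
    then have "[l] \<cdot>\<^bsub>R Quot \<mm>\<^esub> \<one>\<^bsub>R Quot \<mm>\<^esub> = \<zero>\<^bsub>R Quot \<mm>\<^esub>" unfolding qzero .
    then have "ring_characteristic (R Quot \<mm>) dvd l"
      unfolding ring_characteristic_def using h.S.add.pow_eq_id[of "\<one>\<^bsub>R Quot \<mm>\<^esub>" l] by simp
    then have "ring_characteristic R dvd l" using eq unfolding equicharacteristic_def by simp
    then show ?thesis unfolding ring_characteristic_def using add.pow_eq_id[of \<one> l] by simp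
  qed
  show "int_multiples \<subseteq> carrier R" unfolding int_multiples_def by auto
  have "\<one> = [(1::int)] \<cdot> \<one>" by (simp add: add_pow_int_ge)
  then show "\<one> \<in> int_multiples" unfolding int_multiples_def by blast
  show "a \<ominus> b \<in> int_multiples" if "a \<in> int_multiples" "b \<in> int_multiples" for a b
  proof -
    obtain i j :: int where "a = [i] \<cdot> \<one>" "b = [j] \<cdot> \<one>" using \<open>a \<in> _\<close> \<open>b \<in> _\<close> unfolding int_multiples_def by blast
    then have "a \<ominus> b = [(i - j)] \<cdot> \<one>" using add.int_pow_diff[of \<one> i j] by (simp add: minus_eq)
    then show ?thesis unfolding int_multiples_def by blast
  qed
  show "a \<otimes> b \<in> int_multiples" if "a \<in> int_multiples" "b \<in> int_multiples" for a b
  proof -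
    obtain i j :: int where *: "a = [i] \<cdot> \<one>" "b = [j] \<cdot> \<one>" using \<open>a \<in> _\<close> \<open>b \<in> _\<close> unfolding int_multiples_def by blast
    then have "a \<otimes> b = [i] \<cdot> ([j] \<cdot> \<one>)" using add_pow_ldistr_int[of \<one> b i] by simp
    then have "a \<otimes> b = [(j * i)] \<cdot> \<one>" using add.int_pow_pow[of \<one> i j] by simp
    then show ?thesis unfolding int_multiples_def by blast
  qed
  show "a \<in> Units R" if a: "a \<in> int_multiples" "a \<noteq> \<zero>" for a
  proof (rule unit_if_notin_m)
    obtain i :: int where i: "a = [i] \<cdot> \<one>" using a unfolding int_multiples_def by blast
    show ac: "a \<in> carrier R" unfolding i by simp
    show "a \<notin> \<mm>"
    proof
      assume am: "a \<in> \<mm>"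
      show False
      proof (cases "0 \<le> i")
        case True
        then show ?thesis using nat_unit[of "nat i"] am a unfolding i by (simp add: add_pow_int_ge)
      next
        case False
        then have e: "a = \<ominus> ([nat (- i)] \<cdot> \<one>)" unfolding i by (simp add: add_pow_int_lt)
        then have "[nat (- i)] \<cdot> \<one> = \<ominus> a" by simp
        then have "[nat (- i)] \<cdot> \<one> \<in> \<mm>" using ideal_neg[OF ideal_m am] by simp
        then show ?thesis using nat_unit[of "nat (- i)"] e a by simp
      qed
    qed
  qed
qed

end

section \<open>Primes over the regular sequence associated to ideals of forms\<close>

context cring
begin

lemma Idl_finite_support:
  assumes A: "A \<subseteq> carrier R" and r: "r \<in> Idl A"
  shows "\<exists>G. finite G \<and> G \<subseteq> A \<and> r \<in> Idl G"
proof -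
  have up: "r \<in> Idl G'" if "r \<in> Idl G" "G \<subseteq> G'" for r G G' using that Idl_mono by blast
  have "ideal {r. \<exists>G. finite G \<and> G \<subseteq> A \<and> r \<in> Idl G} R" (is "ideal ?K R")
  proof (rule idealI_closed)
    have I: "ideal (Idl G) R" if "G \<subseteq> A" for G using that A by (intro genideal_ideal) auto
    show "?K \<subseteq> carrier R" using ideal_carr[OF I] by blast
    show "\<zero> \<in> ?K" using Idl_empty by blast
    show "a \<oplus> b \<in> ?K" if ab: "a \<in> ?K" "b \<in> ?K" for a b
    proof -
      obtain G G' where *: "finite G" "G \<subseteq> A" "a \<in> Idl G" "finite G'" "G' \<subseteq> A" "b \<in> Idl G'"
        using ab by blast
      then have "a \<oplus> b \<in> Idl (G \<union> G')"
        using up[of a G "G \<union> G'"] up[of b G' "G \<union> G'"] ideal_add[OF I[of "G \<union> G'"]] by auto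
      then show ?thesis using * by (intro CollectI exI[of _ "G \<union> G'"]) auto
    qed
    show "s \<otimes> a \<in> ?K" if "a \<in> ?K" "s \<in> carrier R" for a s
      using that ideal_lmult[OF I] by blast
  qed
  moreover have "A \<subseteq> ?K"
  proof
    fix a assume "a \<in> A"
    then show "a \<in> ?K" using Idl_self[of "{a}" a] A by (intro CollectI exI[of _ "{a}"]) auto
  qed
  ultimately have "Idl A \<subseteq> ?K" by (rule Idl_least)
  then show ?thesis using r by blast
qed

text \<open>
  Otherwise each \<open>A g\<close> has an element outside \<open>P\<close>, and the product of these elements is in all
  \<open>A g\<close> but not in the prime \<open>P\<close>.
\<close>

lemma prime_eq_finite_Int:
  assumes P: "primeideal P R" and "finite G" and A: "\<And>g. g \<in> G \<Longrightarrow> ideal (A g) R"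
    and eq: "P = {p \<in> carrier R. \<forall>g\<in>G. p \<in> A g}"
  shows "\<exists>g\<in>G. P = A g"
proof (rule ccontr)
  assume no: "\<not> ?thesis"
  have Pi: "ideal P R" using primeideal.axioms(1)[OF P] .
  have "\<exists>u\<in>carrier R. u \<notin> P \<and> (\<forall>g\<in>G'. u \<in> A g)" if "finite G'" "G' \<subseteq> G" for G'
    using that
  proof (induction G' rule: finite_induct)
    case empty
    then show ?case using primeideal.I_notcarr[OF P] ideal_subset[OF Pi] by blast
  next
    case (insert g G')
    then obtain u where u: "u \<in> carrier R" "u \<notin> P" "\<forall>g\<in>G'. u \<in> A g" by auto
    have "P \<subseteq> A g" using eq insert by auto
    then obtain v where v: "v \<in> A g" "v \<notin> P" using no insert by blast
    have vc: "v \<in> carrier R" using v ideal_carr[OF A[of g]] insert by blast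
    have "u \<otimes> v \<notin> P" using primeideal.I_prime[OF P u(1) vc] u v by blast
    moreover have "\<forall>g'\<in>insert g G'. u \<otimes> v \<in> A g'"
      using u v vc insert.prems ideal_lmult[OF A] ideal_rmult[OF A] by auto
    ultimately show ?case using u vc by blast
  qed
  from this[OF assms(2) order_refl] show False using eq by blast
qed

end

locale local_graded = local_noeth R \<mm> + graded R x V k
  for R :: "('a, 'b) ring_scheme" (structure) and \<mm> :: "'a set"
    and x :: "'i \<Rightarrow> 'a" and V :: "'i set" and k :: "'a set" +
  assumes x_in_m: "i \<in> V \<Longrightarrow> x i \<in> \<mm>" and V_ne: "V \<noteq> {}"
begin

context
  fixes F :: "'a set" and D :: nat
  assumes finF: "finite F" and F: "\<And>f. f \<in> F \<Longrightarrow> f \<in> forms D"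
begin

lemma F_carr: "f \<in> F \<Longrightarrow> f \<in> carrier R" using F forms_carr by blast

lemma J_ideal: "ideal (Idl F) R" by (rule genideal_ideal) (use F_carr in auto)

text \<open>
  The forms in \<open>(J : q)\<close>, where \<open>J\<close> is the ideal generated by \<open>F\<close>.
\<close>

definition socle_forms :: "'a set" where
  "socle_forms = {g. (\<exists>s. g \<in> forms s) \<and> (\<forall>i\<in>V. x i \<otimes> g \<in> Idl F)}"

lemma socle_forms_carr: "socle_forms \<subseteq> carrier R"
  unfolding socle_forms_def using forms_carr by blast

lemma Idl_F_repr: "r \<in> Idl F \<Longrightarrow> \<exists>c. (\<forall>f\<in>F. c f \<in> carrier R) \<and> r = finsum R (\<lambda>f. c f \<otimes> f) F"
  using Idl_image_finsum[of F "\<lambda>f. f" r] finF F_carr by auto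

lemma finsum_Idl_F: "(\<And>f. f \<in> F \<Longrightarrow> c f \<in> carrier R) \<Longrightarrow> finsum R (\<lambda>f. f \<otimes> c f) F \<in> Idl F"
proof (rule fs_ideal[OF J_ideal finF])
  show "f \<otimes> c f \<in> Idl F" if "f \<in> F" "\<And>f. f \<in> F \<Longrightarrow> c f \<in> carrier R" for f
    using that F_carr Idl_self[of F f] by (intro ideal_rmult[OF J_ideal]) auto
qed

text \<open>
  Expressing \<open>x\<^sub>i r\<close> by the generators \<open>f\<close> of \<open>J\<close> is a linear system with form coefficients; its
  unknowns are \<open>r\<close> and the cofactors of the \<open>f\<close>. The component at \<open>r\<close> of a solution in forms is in
  \<open>socle_forms\<close>. So \<open>r\<close> is \<open>q\<close>-adically in the closure of the ideal generated by these, which is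
  closed by Krull's intersection theorem.
\<close>

lemma socle_generated_by_forms:
  assumes r: "r \<in> carrier R" and xr: "\<And>i. i \<in> V \<Longrightarrow> x i \<otimes> r \<in> Idl F"
  shows "r \<in> Idl socle_forms"
proof -
  define \<Lambda> :: "('i \<times> 'a) option set" where "\<Lambda> = insert None (Some ` (V \<times> F))"
  define e :: "('i \<times> 'a) option \<Rightarrow> nat" where "e l = (case l of None \<Rightarrow> 1 | Some _ \<Rightarrow> D)" for l
  \<comment> \<open>\<open>None\<close> stands for the unknown \<open>r\<close>, and \<open>Some (i, f)\<close> for the cofactor of \<open>f\<close> in \<open>x\<^sub>i r\<close>\<close>
  define M :: "'i \<Rightarrow> ('i \<times> 'a) option \<Rightarrow> 'a" where
    "M o' l = (case l of None \<Rightarrow> x o' | Some (i, f) \<Rightarrow> if i = o' then f else \<zero>)" for o' l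
  have fin: "finite \<Lambda>" unfolding \<Lambda>_def using finV finF by simp
  have MFm: "M o' l \<in> forms (e l)" if "o' \<in> V" "l \<in> \<Lambda>" for o' l
    using that forms_var F forms_zero unfolding M_def e_def \<Lambda>_def by auto
  have Msum: "finsum R (\<lambda>l. M o' l \<otimes> h l) \<Lambda> = x o' \<otimes> h None \<oplus> finsum R (\<lambda>f. f \<otimes> h (Some (o', f))) F"
    if o: "o' \<in> V" and h: "\<And>l. l \<in> \<Lambda> \<Longrightarrow> h l \<in> carrier R" for o' h
  proof -
    have Mh: "M o' l \<otimes> h l \<in> carrier R" if "l \<in> \<Lambda>" for l using h[OF that] forms_carr[OF MFm[OF o that]] by simp
    have "finsum R (\<lambda>l. M o' l \<otimes> h l) \<Lambda> = M o' None \<otimes> h None \<oplus> finsum R (\<lambda>l. M o' l \<otimes> h l) (Some ` (V \<times> F))"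
      unfolding \<Lambda>_def by (rule fs_insert) (use finV finF Mh in \<open>auto simp: \<Lambda>_def\<close>)
    also have "finsum R (\<lambda>l. M o' l \<otimes> h l) (Some ` (V \<times> F)) = finsum R (\<lambda>p. M o' (Some p) \<otimes> h (Some p)) (V \<times> F)"
      by (rule fs_reindex) (use Mh in \<open>auto simp: \<Lambda>_def\<close>)
    also have "\<dots> = finsum R (\<lambda>i. finsum R (\<lambda>f. M o' (Some (i, f)) \<otimes> h (Some (i, f))) F) V"
      by (rule fs_Sigma) (use finV finF Mh in \<open>auto simp: \<Lambda>_def\<close>)
    also have "\<dots> = finsum R (\<lambda>f. M o' (Some (o', f)) \<otimes> h (Some (o', f))) F"
    proof (rule fs_single[OF finV o])
      show "finsum R (\<lambda>f. M o' (Some (o', f)) \<otimes> h (Some (o', f))) F \<in> carrier R"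
        using Mh o by (intro fs_closed) (auto simp: \<Lambda>_def)
      show "finsum R (\<lambda>f. M o' (Some (i, f)) \<otimes> h (Some (i, f))) F = \<zero>" if "i \<in> V" "i \<noteq> o'" for i
        using that h by (intro fs_zero) (auto simp: M_def \<Lambda>_def)
    qed
    finally show ?thesis by (simp add: M_def)
  qed
  have "\<forall>i\<in>V. \<exists>c. (\<forall>f\<in>F. c f \<in> carrier R) \<and> x i \<otimes> r = finsum R (\<lambda>f. c f \<otimes> f) F"
    using Idl_F_repr xr by blast
  then obtain s where s: "\<And>i f. i \<in> V \<Longrightarrow> f \<in> F \<Longrightarrow> s i f \<in> carrier R"
    "\<And>i. i \<in> V \<Longrightarrow> x i \<otimes> r = finsum R (\<lambda>f. s i f \<otimes> f) F" by metis
  define u where "u l = (case l of None \<Rightarrow> r | Some (i, f) \<Rightarrow> \<ominus> s i f)" for l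
  have uc: "u l \<in> carrier R" if "l \<in> \<Lambda>" for l using that r s unfolding u_def \<Lambda>_def by auto
  have usol: "finsum R (\<lambda>l. M o' l \<otimes> u l) \<Lambda> = \<zero>" if o: "o' \<in> V" for o'
  proof -
    have "finsum R (\<lambda>f. f \<otimes> u (Some (o', f))) F = finsum R (\<lambda>f. (\<ominus> \<one>) \<otimes> (s o' f \<otimes> f)) F"
    proof (rule fs_cong)
      show "f \<otimes> u (Some (o', f)) = (\<ominus> \<one>) \<otimes> (s o' f \<otimes> f)" if "f \<in> F" for f
      proof -
        have "a \<otimes> (\<ominus> b) = (\<ominus> \<one>) \<otimes> (b \<otimes> a)" if "a \<in> carrier R" "b \<in> carrier R" for a b using that by algebra
        then show ?thesis using F_carr[OF that] s(1)[OF o that] unfolding u_def by simp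
      qed
    qed (use F_carr s o in auto)
    also have "\<dots> = (\<ominus> \<one>) \<otimes> (x o' \<otimes> r)" unfolding s(2)[OF o]
      by (rule fs_lmult[symmetric]) (use finF F_carr s o in auto)
    finally show ?thesis using Msum[OF o, of u] uc xV[OF o] r
      by (simp add: u_def l_minus r_neg)
  qed
  have sol_span_socle: "f None \<in> Idl socle_forms" if "sol_span \<Lambda> e V M f" for f
    using that
  proof (induction rule: sol_span.induct)
    fix f :: "('i \<times> 'a) option \<Rightarrow> 'a" assume "\<And>l. l \<in> \<Lambda> \<Longrightarrow> f l = \<zero>"
    then show "f None \<in> Idl socle_forms" using ideal_zero[OF genideal_ideal[OF socle_forms_carr]] by (simp add: \<Lambda>_def)
  next
    fix f g f' :: "('i \<times> 'a) option \<Rightarrow> 'a" and s a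
    assume *: "f None \<in> Idl socle_forms" "g \<in> form_sols \<Lambda> e V M s" "a \<in> carrier R"
      "\<And>l. l \<in> \<Lambda> \<Longrightarrow> f' l = a \<otimes> g l \<oplus> f l"
    have gc: "g l \<in> carrier R" if "l \<in> \<Lambda>" for l
      using form_sols_carr[OF fin finV MFm *(2) that] by simp
    have "g None \<in> Idl socle_forms"
    proof (cases "1 \<le> s")
      case True
      have "g None \<in> forms (s - 1)"
        using *(2) True unfolding form_sols_def by (auto simp: \<Lambda>_def e_def)
      moreover have "x o' \<otimes> g None \<in> Idl F" if o: "o' \<in> V" for o'
      proof -
        have "x o' \<otimes> g None \<oplus> finsum R (\<lambda>f. f \<otimes> g (Some (o', f))) F = \<zero>"
          using *(2) o Msum[OF o gc] unfolding form_sols_def by auto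
        moreover have "finsum R (\<lambda>f. f \<otimes> g (Some (o', f))) F \<in> Idl F"
          using gc o by (intro finsum_Idl_F) (auto simp: \<Lambda>_def)
        moreover have "x o' \<otimes> g None \<in> carrier R" using xV[OF o] gc by (auto simp: \<Lambda>_def)
        ultimately show ?thesis using ideal_add_cancel[OF J_ideal] ideal_zero[OF J_ideal] by metis
      qed
      ultimately show ?thesis by (intro Idl_self[OF socle_forms_carr]) (auto simp: socle_forms_def)
    next
      case False
      then have "g None = \<zero>" using *(2) unfolding form_sols_def by (auto simp: \<Lambda>_def e_def)
      then show ?thesis using ideal_zero[OF genideal_ideal[OF socle_forms_carr]] by simp
    qed
    then show "f' None \<in> Idl socle_forms"
      using * ideal_add[OF genideal_ideal[OF socle_forms_carr]] ideal_lmult[OF genideal_ideal[OF socle_forms_carr]]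
      by (simp add: \<Lambda>_def)
  qed
  have approx: "\<exists>g\<in>Idl socle_forms. r \<ominus> g \<in> Q s" for s
  proof -
    obtain f where f: "sol_span \<Lambda> e V M f" "\<forall>l\<in>\<Lambda>. u l \<ominus> f l \<in> Q (Suc s - e l)"
      using graded_approximation[where M = M and r = u and s = "Suc s", OF fin finV MFm uc usol] by blast
    have "r \<ominus> f None \<in> Q s" using f(2) unfolding \<Lambda>_def u_def e_def by auto
    then show ?thesis using sol_span_socle[OF f(1)] by blast
  qed
  define L where "L = Idl socle_forms"
  define N where "N = Idl (insert r L)"
  have L: "ideal L R" unfolding L_def by (rule genideal_ideal[OF socle_forms_carr])
  have rL: "insert r L \<subseteq> carrier R" using r ideal_subset[OF L] by auto
  have N: "ideal N R" unfolding N_def by (rule genideal_ideal[OF rL])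
  have "N = L"
  proof (rule krull_intersection[OF N L])
    show "L \<subseteq> N" unfolding N_def using genideal_self[OF rL] by blast
    show "finite (x ` V)" "x ` V \<subseteq> \<mm>" using finV x_in_m by auto
    fix n :: nat
    have gens: "L \<union> (\<lambda>y. y [^] n) ` (x ` V) \<subseteq> carrier R" using ideal_subset[OF L] xV by auto
    have I: "ideal (Idl (L \<union> (\<lambda>y. y [^] n) ` (x ` V))) R" by (rule genideal_ideal[OF gens])
    obtain g where g: "g \<in> L" "r \<ominus> g \<in> Q (card V * n)" using approx unfolding L_def by blast
    have "r \<ominus> g \<in> Idl (L \<union> (\<lambda>y. y [^] n) ` (x ` V))"
      using g(2) Q_sub_powers[OF V_ne, of n] Idl_mono[of "(\<lambda>y. y [^] n) ` (x ` V)"] by blast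
    moreover have gI: "g \<in> Idl (L \<union> (\<lambda>y. y [^] n) ` (x ` V))" using g(1) Idl_self[OF gens] by blast
    moreover have "(r \<ominus> g) \<oplus> g = r" using r ideal_carr[OF L g(1)] by algebra
    ultimately have "r \<in> Idl (L \<union> (\<lambda>y. y [^] n) ` (x ` V))" using ideal_add[OF I] by metis
    then show "N \<subseteq> Idl (L \<union> (\<lambda>y. y [^] n) ` (x ` V))"
      unfolding N_def using Idl_self[OF gens] by (intro Idl_least[OF I]) auto
  qed
  then show ?thesis using Idl_self[OF rL, of r] unfolding N_def L_def by auto
qed

lemma Q1_kills_socle: "g \<in> socle_forms \<Longrightarrow> u \<in> Q 1 \<Longrightarrow> u \<otimes> g \<in> Idl F"
proof -
  assume g: "g \<in> socle_forms" and u: "u \<in> Q 1"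
  have "Q 1 \<subseteq> {u \<in> carrier R. u \<otimes> g \<in> Idl F}"
    unfolding Q_1 using g socle_forms_carr xV
    by (intro Idl_least ideal_colon[OF J_ideal]) (auto simp: socle_forms_def)
  then show ?thesis using u by blast
qed

text \<open>
  The relation is one equation for the coefficients \<open>c g\<close> and the cofactors of the generators of \<open>J\<close>.
  In a solution by forms, the components at \<open>g\<close> have positive degree, and are then in \<open>q\<close>, or are
  constants. Because \<open>q\<close> multiplies the \<open>g\<close> into \<open>J\<close>, the constants satisfy a relation over \<open>k\<close>
  modulo \<open>J\<close> by themselves, so they vanish. Hence all solutions have their components at \<open>g\<close> in \<open>q\<close>.
\<close>

lemma independent_socle_coeffs:
  assumes G: "finite G" "G \<subseteq> socle_forms"
    and indep: "\<And>\<kappa> g. (\<And>g. g \<in> G \<Longrightarrow> \<kappa> g \<in> k) \<Longrightarrow> finsum R (\<lambda>g. \<kappa> g \<otimes> g) G \<in> Idl F \<Longrightarrow> g \<in> G \<Longrightarrow> \<kappa> g = \<zero>"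
    and c: "\<And>g. g \<in> G \<Longrightarrow> c g \<in> carrier R" and cJ: "finsum R (\<lambda>g. c g \<otimes> g) G \<in> Idl F"
    and g: "g \<in> G"
  shows "c g \<in> Q 1"
proof -
  have Gc: "\<And>g. g \<in> G \<Longrightarrow> g \<in> carrier R" using G socle_forms_carr by blast
  have "\<forall>g\<in>G. \<exists>s. g \<in> forms s" using G unfolding socle_forms_def by blast
  then obtain dg where dg: "\<And>g. g \<in> G \<Longrightarrow> g \<in> forms (dg g)" by metis
  define \<Lambda> :: "('a + 'a) set" where "\<Lambda> = Inl ` G \<union> Inr ` F"
  define e :: "'a + 'a \<Rightarrow> nat" where "e l = (case l of Inl g \<Rightarrow> dg g | Inr _ \<Rightarrow> D)" for l
  \<comment> \<open>\<open>Inl g\<close> stands for the coefficient of \<open>g\<close>, and \<open>Inr f\<close> for the cofactor of \<open>f\<close>\<close>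
  define M :: "unit \<Rightarrow> 'a + 'a \<Rightarrow> 'a" where "M o' l = (case l of Inl g \<Rightarrow> g | Inr f \<Rightarrow> f)" for o' l
  have fin: "finite \<Lambda>" unfolding \<Lambda>_def using G finF by simp
  have finU: "finite {()}" by simp
  have MFm: "M o' l \<in> forms (e l)" if "o' \<in> {()}" "l \<in> \<Lambda>" for o' l
    using that dg F unfolding M_def e_def \<Lambda>_def by auto
  have Msum: "finsum R (\<lambda>l. M () l \<otimes> h l) \<Lambda> = finsum R (\<lambda>g. g \<otimes> h (Inl g)) G \<oplus> finsum R (\<lambda>f. f \<otimes> h (Inr f)) F"
    if h: "\<And>l. l \<in> \<Lambda> \<Longrightarrow> h l \<in> carrier R" for h
  proof -
    have Mh: "M () l \<otimes> h l \<in> carrier R" if "l \<in> \<Lambda>" for l using h[OF that] forms_carr[OF MFm[OF _ that]] by simp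
    have "finsum R (\<lambda>l. M () l \<otimes> h l) \<Lambda> =
        finsum R (\<lambda>l. M () l \<otimes> h l) (Inl ` G) \<oplus> finsum R (\<lambda>l. M () l \<otimes> h l) (Inr ` F)"
      unfolding \<Lambda>_def by (rule fs_Un) (use G finF Mh in \<open>auto simp: \<Lambda>_def\<close>)
    also have "finsum R (\<lambda>l. M () l \<otimes> h l) (Inl ` G) = finsum R (\<lambda>g. M () (Inl g) \<otimes> h (Inl g)) G"
      by (rule fs_reindex) (use Mh in \<open>auto simp: \<Lambda>_def\<close>)
    also have "finsum R (\<lambda>l. M () l \<otimes> h l) (Inr ` F) = finsum R (\<lambda>f. M () (Inr f) \<otimes> h (Inr f)) F"
      by (rule fs_reindex) (use Mh in \<open>auto simp: \<Lambda>_def\<close>)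
    finally show ?thesis by (simp add: M_def)
  qed
  obtain s where s: "\<And>f. f \<in> F \<Longrightarrow> s f \<in> carrier R"
    "finsum R (\<lambda>g. c g \<otimes> g) G = finsum R (\<lambda>f. s f \<otimes> f) F"
    using Idl_F_repr[OF cJ] by blast
  define u where "u l = (case l of Inl g \<Rightarrow> c g | Inr f \<Rightarrow> \<ominus> s f)" for l
  have uc: "u l \<in> carrier R" if "l \<in> \<Lambda>" for l using that c s unfolding u_def \<Lambda>_def by auto
  have usol: "finsum R (\<lambda>l. M o' l \<otimes> u l) \<Lambda> = \<zero>" if o: "o' \<in> {()}" for o'
  proof -
    have "finsum R (\<lambda>f. f \<otimes> u (Inr f)) F = finsum R (\<lambda>f. (\<ominus> \<one>) \<otimes> (s f \<otimes> f)) F"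
    proof (rule fs_cong)
      show "f \<otimes> u (Inr f) = (\<ominus> \<one>) \<otimes> (s f \<otimes> f)" if "f \<in> F" for f
      proof -
        have "a \<otimes> (\<ominus> b) = (\<ominus> \<one>) \<otimes> (b \<otimes> a)" if "a \<in> carrier R" "b \<in> carrier R" for a b using that by algebra
        then show ?thesis using F_carr[OF that] s(1)[OF that] unfolding u_def by simp
      qed
    qed (use F_carr s in auto)
    also have "\<dots> = (\<ominus> \<one>) \<otimes> finsum R (\<lambda>f. s f \<otimes> f) F"
      by (rule fs_lmult[symmetric]) (use finF F_carr s in auto)
    finally have 1: "finsum R (\<lambda>f. f \<otimes> u (Inr f)) F = (\<ominus> \<one>) \<otimes> finsum R (\<lambda>f. s f \<otimes> f) F" .
    have "finsum R (\<lambda>g. g \<otimes> u (Inl g)) G = finsum R (\<lambda>g. c g \<otimes> g) G"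
      by (rule fs_cong) (use c Gc in \<open>auto simp: u_def m_comm\<close>)
    then show ?thesis using Msum[of u] uc 1 s o F_carr by (simp add: l_minus r_neg)
  qed
  have sol_span_Q: "f (Inl g) \<in> Q 1" if "sol_span \<Lambda> e {()} M f" "g \<in> G" for f g
    using that
  proof (induction arbitrary: g rule: sol_span.induct)
    fix f :: "'a + 'a \<Rightarrow> 'a" and g assume "\<And>l. l \<in> \<Lambda> \<Longrightarrow> f l = \<zero>" "g \<in> G"
    then show "f (Inl g) \<in> Q 1" using ideal_zero[OF Q_ideal] by (simp add: \<Lambda>_def)
  next
    fix f h f' :: "'a + 'a \<Rightarrow> 'a" and s a g
    assume *: "\<And>g. g \<in> G \<Longrightarrow> f (Inl g) \<in> Q 1" "h \<in> form_sols \<Lambda> e {()} M s" "a \<in> carrier R"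
      "\<And>l. l \<in> \<Lambda> \<Longrightarrow> f' l = a \<otimes> h l \<oplus> f l" and g: "g \<in> G"
    have hc: "h l \<in> carrier R" if "l \<in> \<Lambda>" for l
      using form_sols_carr[OF fin finU MFm *(2) that] by simp
    have h: "if dg g \<le> s then h (Inl g) \<in> forms (s - dg g) else h (Inl g) = \<zero>" if "g \<in> G" for g
      using *(2) that unfolding form_sols_def by (force simp: \<Lambda>_def e_def)
    have hQ: "h (Inl g) \<in> Q 1" if "g \<in> G" "dg g \<noteq> s" for g
    proof (cases "dg g \<le> s")
      case True
      then have "h (Inl g) \<in> Q (s - dg g)" using h[OF that(1)] forms_Q by auto
      moreover have "1 \<le> s - dg g" using True that by linarith
      ultimately show ?thesis using Q_mono[of 1 "s - dg g"] by blast
    next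
      case False
      then show ?thesis using h[OF that(1)] ideal_zero[OF Q_ideal] by simp
    qed
    define \<kappa> where "\<kappa> g = (if dg g = s then h (Inl g) else \<zero>)" for g
    have \<kappa>k: "\<kappa> g \<in> k" if "g \<in> G" for g
      using h[OF that] forms_0 k_zero unfolding \<kappa>_def by auto
    have \<kappa>c: "\<kappa> g \<in> carrier R" if "g \<in> G" for g using \<kappa>k[OF that] k_carr by blast
    have hlc: "h (Inl g) \<in> carrier R" if "g \<in> G" for g using hc that by (auto simp: \<Lambda>_def)
    have "finsum R (\<lambda>g. g \<otimes> h (Inl g)) G \<oplus> finsum R (\<lambda>f. f \<otimes> h (Inr f)) F = \<zero>"
      using *(2) Msum[of h] hc unfolding form_sols_def by auto
    moreover have "finsum R (\<lambda>f. f \<otimes> h (Inr f)) F \<in> Idl F"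
      using hc by (intro finsum_Idl_F) (auto simp: \<Lambda>_def)
    moreover have "finsum R (\<lambda>g. g \<otimes> h (Inl g)) G \<in> carrier R" using Gc hlc by (intro fs_closed) auto
    ultimately have 1: "finsum R (\<lambda>g. g \<otimes> h (Inl g)) G \<in> Idl F"
      using ideal_add_cancel[OF J_ideal] ideal_zero[OF J_ideal] by metis
    have 2: "finsum R (\<lambda>g. (h (Inl g) \<ominus> \<kappa> g) \<otimes> g) G \<in> Idl F"
    proof (rule fs_ideal[OF J_ideal G(1)])
      fix g assume g: "g \<in> G"
      have "h (Inl g) \<ominus> \<kappa> g \<in> Q 1"
        using hQ[OF g] hlc[OF g] ideal_zero[OF Q_ideal] unfolding \<kappa>_def by (auto simp: minus_eq r_neg)
      then show "(h (Inl g) \<ominus> \<kappa> g) \<otimes> g \<in> Idl F" using Q1_kills_socle g G by blast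
    qed
    have "finsum R (\<lambda>g. \<kappa> g \<otimes> g) G = finsum R (\<lambda>g. g \<otimes> h (Inl g) \<ominus> (h (Inl g) \<ominus> \<kappa> g) \<otimes> g) G"
    proof (rule fs_cong)
      fix g assume g: "g \<in> G"
      have "b \<otimes> a = a \<otimes> y \<ominus> (y \<ominus> b) \<otimes> a" if "a \<in> carrier R" "b \<in> carrier R" "y \<in> carrier R" for a b y
        using that by algebra
      then show "\<kappa> g \<otimes> g = g \<otimes> h (Inl g) \<ominus> (h (Inl g) \<ominus> \<kappa> g) \<otimes> g" using Gc[OF g] \<kappa>c[OF g] hlc[OF g] by blast
      show "g \<otimes> h (Inl g) \<ominus> (h (Inl g) \<ominus> \<kappa> g) \<otimes> g \<in> carrier R" using Gc[OF g] \<kappa>c[OF g] hlc[OF g] by simp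
    qed
    also have "\<dots> = finsum R (\<lambda>g. g \<otimes> h (Inl g)) G \<ominus> finsum R (\<lambda>g. (h (Inl g) \<ominus> \<kappa> g) \<otimes> g) G"
      by (rule fs_diff[OF G(1)]) (use Gc \<kappa>c hlc in auto)
    finally have "finsum R (\<lambda>g. \<kappa> g \<otimes> g) G \<in> Idl F" using ideal_minus[OF J_ideal 1 2] by simp
    then have "\<kappa> g = \<zero>" using indep[of \<kappa> g, OF \<kappa>k _ g] by blast
    then have "h (Inl g) \<in> Q 1" using hQ[OF g] ideal_zero[OF Q_ideal] unfolding \<kappa>_def by (cases "dg g = s") auto
    then show "f' (Inl g) \<in> Q 1" using * g ideal_add[OF Q_ideal] ideal_lmult[OF Q_ideal] by (simp add: \<Lambda>_def)
  qed
  obtain f where f: "sol_span \<Lambda> e {()} M f" "\<forall>l\<in>\<Lambda>. u l \<ominus> f l \<in> Q (Suc (dg g) - e l)"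
    using graded_approximation[where M = M and r = u and s = "Suc (dg g)", OF fin finU MFm uc usol] by blast
  have "c g \<ominus> f (Inl g) \<in> Q 1" using f(2) g unfolding \<Lambda>_def u_def e_def by force
  moreover have fg: "f (Inl g) \<in> Q 1" by (rule sol_span_Q[OF f(1) g])
  moreover have "(c g \<ominus> f (Inl g)) \<oplus> f (Inl g) = c g"
  proof -
    have "(a \<ominus> b) \<oplus> b = a" if "a \<in> carrier R" "b \<in> carrier R" for a b using that by algebra
    then show ?thesis using c[OF g] ideal_carr[OF Q_ideal fg] by blast
  qed
  ultimately show ?thesis using ideal_add[OF Q_ideal] by metis
qed

text \<open>
  Write \<open>r\<close> modulo \<open>J\<close> as a combination of as few socle forms \<open>g\<close> as possible, with coefficients
  \<open>c g\<close>. A relation over \<open>k\<close> between these forms would allow to drop one of them, so they are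
  independent, and \<open>p r\<close> is in \<open>J\<close> iff all \<open>p (c g)\<close> are in \<open>q\<close>. Thus the prime \<open>P\<close> is the
  intersection of the finitely many ideals \<open>(q : c g)\<close>, hence equal to one of them.
\<close>

lemma associated_prime_over_sequence:
  assumes P: "primeideal P R" and r: "r \<in> carrier R" and eq: "P = {p \<in> carrier R. p \<otimes> r \<in> Idl F}"
    and xP: "x ` V \<subseteq> P"
  shows "P \<in> ass_quot (Idl (x ` V))"
proof -
  define good_rep where "good_rep n \<longleftrightarrow> (\<exists>G c. finite G \<and> card G = n \<and> G \<subseteq> socle_forms \<and>
      (\<forall>g\<in>G. c g \<in> carrier R) \<and> r \<ominus> finsum R (\<lambda>g. c g \<otimes> g) G \<in> Idl F)" for n
  have "r \<in> Idl socle_forms"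
    by (rule socle_generated_by_forms[OF r]) (use xP eq in auto)
  then obtain G where G: "finite G" "G \<subseteq> socle_forms" "r \<in> Idl G"
    using Idl_finite_support[OF socle_forms_carr] by blast
  have Gc: "\<And>g. g \<in> G \<Longrightarrow> g \<in> carrier R" using G socle_forms_carr by blast
  obtain c where c: "\<forall>g\<in>G. c g \<in> carrier R" "r = finsum R (\<lambda>g. c g \<otimes> g) G"
    using Idl_image_finsum[of G "\<lambda>g. g" r] G Gc by auto
  have "good_rep (card G)"
    unfolding good_rep_def using G c r ideal_zero[OF J_ideal]
    by (intro exI[of _ G] exI[of _ c]) (simp add: minus_eq r_neg)
  then have "good_rep (LEAST n. good_rep n)" by (rule LeastI)
  then obtain G c where G: "finite G" "card G = (LEAST n. good_rep n)" "G \<subseteq> socle_forms"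
    and c: "\<And>g. g \<in> G \<Longrightarrow> c g \<in> carrier R" and rG: "r \<ominus> finsum R (\<lambda>g. c g \<otimes> g) G \<in> Idl F"
    unfolding good_rep_def by blast
  have Gc: "\<And>g. g \<in> G \<Longrightarrow> g \<in> carrier R" using G socle_forms_carr by blast
  define S where "S = finsum R (\<lambda>g. c g \<otimes> g) G"
  have Sc: "S \<in> carrier R" unfolding S_def using c Gc by (intro fs_closed) auto
  have indep: "\<kappa> g = \<zero>"
    if \<kappa>: "\<And>g. g \<in> G \<Longrightarrow> \<kappa> g \<in> k" and \<kappa>J: "finsum R (\<lambda>g. \<kappa> g \<otimes> g) G \<in> Idl F" and g: "g \<in> G" for \<kappa> g
  proof (rule ccontr)
    assume ne: "\<kappa> g \<noteq> \<zero>"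
    have u: "\<kappa> g \<in> Units R" using k_unit[OF \<kappa>[OF g] ne] .
    have \<kappa>c: "\<And>g. g \<in> G \<Longrightarrow> \<kappa> g \<in> carrier R" using \<kappa> k_carr by blast
    define t where "t = c g \<otimes> inv (\<kappa> g)"
    have t: "t \<in> carrier R" "t \<otimes> \<kappa> g = c g" unfolding t_def using u c[OF g] by (auto simp: m_assoc Units_closed)
    define c' where "c' h = c h \<ominus> t \<otimes> \<kappa> h" for h
    have c'c: "\<And>h. h \<in> G \<Longrightarrow> c' h \<in> carrier R" unfolding c'_def using c t \<kappa>c by simp
    have c'g: "c' g = \<zero>" unfolding c'_def using t c[OF g] by (simp add: minus_eq r_neg)
    have "finsum R (\<lambda>h. c' h \<otimes> h) G = finsum R (\<lambda>h. c h \<otimes> h \<ominus> t \<otimes> (\<kappa> h \<otimes> h)) G"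
    proof (rule fs_cong)
      fix h assume h: "h \<in> G"
      have "(a \<ominus> t \<otimes> b) \<otimes> y = a \<otimes> y \<ominus> t \<otimes> (b \<otimes> y)" if "a \<in> carrier R" "b \<in> carrier R" "y \<in> carrier R" for a b y
        using that t(1) by algebra
      then show "c' h \<otimes> h = c h \<otimes> h \<ominus> t \<otimes> (\<kappa> h \<otimes> h)" unfolding c'_def using c[OF h] \<kappa>c[OF h] Gc[OF h] by blast
      show "c h \<otimes> h \<ominus> t \<otimes> (\<kappa> h \<otimes> h) \<in> carrier R" using c[OF h] \<kappa>c[OF h] Gc[OF h] t by simp
    qed
    also have "\<dots> = S \<ominus> finsum R (\<lambda>h. t \<otimes> (\<kappa> h \<otimes> h)) G"
      unfolding S_def by (rule fs_diff[OF G(1)]) (use c \<kappa>c Gc t in auto)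
    also have "finsum R (\<lambda>h. t \<otimes> (\<kappa> h \<otimes> h)) G = t \<otimes> finsum R (\<lambda>h. \<kappa> h \<otimes> h) G"
      by (rule fs_lmult[symmetric, OF G(1)]) (use \<kappa>c Gc t in auto)
    finally have 1: "finsum R (\<lambda>h. c' h \<otimes> h) G = S \<ominus> t \<otimes> finsum R (\<lambda>h. \<kappa> h \<otimes> h) G" .
    have "finsum R (\<lambda>h. c' h \<otimes> h) G = c' g \<otimes> g \<oplus> finsum R (\<lambda>h. c' h \<otimes> h) (G - {g})"
      by (rule fs_remove[OF G(1) g]) (use c'c Gc in auto)
    then have 2: "finsum R (\<lambda>h. c' h \<otimes> h) (G - {g}) = finsum R (\<lambda>h. c' h \<otimes> h) G"
      using c'g Gc[OF g] c'c Gc by (simp add: fs_closed)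
    define w where "w = finsum R (\<lambda>h. \<kappa> h \<otimes> h) G"
    have wc: "w \<in> carrier R" using \<kappa>J ideal_carr[OF J_ideal] unfolding w_def by blast
    have "r \<ominus> finsum R (\<lambda>h. c' h \<otimes> h) (G - {g}) = (r \<ominus> S) \<oplus> t \<otimes> w"
      unfolding 2 1 w_def[symmetric] using r Sc t(1) wc by algebra
    also have "\<dots> \<in> Idl F" using rG ideal_lmult[OF J_ideal \<kappa>J t(1)] ideal_add[OF J_ideal] unfolding S_def w_def by blast
    finally have "good_rep (card (G - {g}))"
      unfolding good_rep_def using G(1,3) c'c by (intro exI[of _ "G - {g}"] exI[of _ c']) auto
    then have "card G \<le> card (G - {g})" unfolding G(2) by (rule Least_le)
    then show False using card_Diff1_less[OF G(1) g] by simp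
  qed
  have mem: "p \<in> P \<longleftrightarrow> (\<forall>g\<in>G. p \<otimes> c g \<in> Q 1)" if p: "p \<in> carrier R" for p
  proof -
    have "p \<otimes> r = p \<otimes> (r \<ominus> S) \<oplus> p \<otimes> S" using p r Sc by algebra
    moreover have "p \<otimes> (r \<ominus> S) \<in> Idl F" using ideal_lmult[OF J_ideal _ p] rG unfolding S_def by blast
    ultimately have "p \<otimes> r \<in> Idl F \<longleftrightarrow> p \<otimes> S \<in> Idl F"
      using ideal_add[OF J_ideal] ideal_add_cancel[OF J_ideal, of "p \<otimes> S" "p \<otimes> (r \<ominus> S)"] p Sc r
      by (auto simp: a_comm)
    moreover have pS: "p \<otimes> S = finsum R (\<lambda>g. (p \<otimes> c g) \<otimes> g) G"
    proof -
      have "p \<otimes> S = finsum R (\<lambda>g. p \<otimes> (c g \<otimes> g)) G"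
        unfolding S_def by (rule fs_lmult[OF G(1) p]) (use c Gc in auto)
      also have "\<dots> = finsum R (\<lambda>g. (p \<otimes> c g) \<otimes> g) G"
        by (rule fs_cong) (use c Gc p in \<open>auto simp: m_assoc\<close>)
      finally show ?thesis .
    qed
    moreover have "p \<otimes> S \<in> Idl F \<longleftrightarrow> (\<forall>g\<in>G. p \<otimes> c g \<in> Q 1)"
    proof
      assume pJ: "p \<otimes> S \<in> Idl F"
      show "\<forall>g\<in>G. p \<otimes> c g \<in> Q 1"
      proof
        fix g assume g: "g \<in> G"
        show "p \<otimes> c g \<in> Q 1"
        proof (rule independent_socle_coeffs[OF G(1,3) _ _ _ g, where c = "\<lambda>g. p \<otimes> c g"])
          show "\<kappa> g = \<zero>" if "\<And>g. g \<in> G \<Longrightarrow> \<kappa> g \<in> k" "finsum R (\<lambda>g. \<kappa> g \<otimes> g) G \<in> Idl F" "g \<in> G" for \<kappa> g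
            by (rule indep[OF that])
        qed (use c p pJ pS in auto)
      qed
    next
      assume "\<forall>g\<in>G. p \<otimes> c g \<in> Q 1"
      then show "p \<otimes> S \<in> Idl F" unfolding pS
        using Q1_kills_socle G by (intro fs_ideal[OF J_ideal G(1)]) auto
    qed
    ultimately show ?thesis using eq p by auto
  qed
  have Pc: "P \<subseteq> carrier R" using eq by auto
  have "\<exists>g\<in>G. P = {p \<in> carrier R. p \<otimes> c g \<in> Q 1}"
  proof (rule prime_eq_finite_Int[OF P G(1)])
    show "ideal {p \<in> carrier R. p \<otimes> c g \<in> Q 1} R" if "g \<in> G" for g
      by (rule ideal_colon[OF Q_ideal c[OF that]])
    show "P = {p \<in> carrier R. \<forall>g\<in>G. p \<in> {p \<in> carrier R. p \<otimes> c g \<in> Q 1}}" using mem Pc by blast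
  qed
  then show ?thesis unfolding ass_quot_def Q_1[symmetric] using P c by blast
qed

end

end


section \<open>Formal power series\<close>

locale powser = cring S for S :: "('c multiset \<Rightarrow> 'k) ring" (structure) +
  fixes K :: "('k, 'b) ring_scheme" and V :: "'c set"
  assumes field_K: "field K" and S_eq: "S = powser_ring K V"
begin

sublocale K: field K by (rule field_K)

lemma S_carrier: "f \<in> carrier S \<longleftrightarrow> (\<forall>m. f m \<in> carrier K) \<and> (\<forall>m. \<not> set_mset m \<subseteq> V \<longrightarrow> f m = \<zero>\<^bsub>K\<^esub>)"
  unfolding S_eq powser_ring_def by simp

lemma coeff_closed [simp]: "f \<in> carrier S \<Longrightarrow> f m \<in> carrier K"
  by (simp add: S_carrier)

lemma coeff_supp: "f \<in> carrier S \<Longrightarrow> f m \<noteq> \<zero>\<^bsub>K\<^esub> \<Longrightarrow> set_mset m \<subseteq> V"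
  by (auto simp: S_carrier)

lemma S_zero: "\<zero> = (\<lambda>m. \<zero>\<^bsub>K\<^esub>)"
  unfolding S_eq powser_ring_def by (simp add: K.indexed_const_def)

lemma S_one: "\<one> = (\<lambda>m. if m = {#} then \<one>\<^bsub>K\<^esub> else \<zero>\<^bsub>K\<^esub>)"
  unfolding S_eq powser_ring_def by (simp add: K.indexed_const_def)

lemma S_add: "(f \<oplus> g) m = f m \<oplus>\<^bsub>K\<^esub> g m"
  unfolding S_eq powser_ring_def by (simp add: K.indexed_padd_def)

lemma S_mult: "(f \<otimes> g) m = (\<Oplus>\<^bsub>K\<^esub>a \<in> {a. a \<subseteq># m}. f a \<otimes>\<^bsub>K\<^esub> g (m - a))"
  unfolding S_eq powser_ring_def by simp

lemma S_neg: "f \<in> carrier S \<Longrightarrow> (\<ominus> f) m = \<ominus>\<^bsub>K\<^esub> f m"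
proof -
  assume f: "f \<in> carrier S"
  have "\<ominus> f = (\<lambda>m. \<ominus>\<^bsub>K\<^esub> f m)"
  proof (rule minus_equality)
    show "(\<lambda>m. \<ominus>\<^bsub>K\<^esub> f m) \<oplus> f = \<zero>" using f by (intro ext) (simp add: S_add S_zero K.l_neg)
    show "(\<lambda>m. \<ominus>\<^bsub>K\<^esub> f m) \<in> carrier S" using f by (simp add: S_carrier)
  qed (rule f)
  then show ?thesis by simp
qed

lemma S_minus: "f \<in> carrier S \<Longrightarrow> g \<in> carrier S \<Longrightarrow> (f \<ominus> g) m = f m \<ominus>\<^bsub>K\<^esub> g m"
  by (simp add: minus_eq S_add S_neg K.minus_eq)

lemma finite_sub_mset: "finite {a. a \<subseteq># (m :: 'd multiset)}"
proof (induction m)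
  case empty
  then show ?case by simp
next
  case (add x m)
  have "{a. a \<subseteq># add_mset x m} \<subseteq> {a. a \<subseteq># m} \<union> add_mset x ` {a. a \<subseteq># m}"
  proof
    fix a assume "a \<in> {a. a \<subseteq># add_mset x m}"
    then have a: "a \<subseteq># add_mset x m" by simp
    show "a \<in> {a. a \<subseteq># m} \<union> add_mset x ` {a. a \<subseteq># m}"
    proof (cases "x \<in># a")
      case True
      then have "a - {#x#} \<subseteq># m" "a = add_mset x (a - {#x#})" using a by (simp_all add: subset_eq_diff_conv)
      then show ?thesis by blast
    next
      case False
      then have "a \<subseteq># m" using a by (metis diff_single_trivial subset_eq_diff_conv add_mset_add_single)
      then show ?thesis by simp
    qed
  qed
  then show ?case using add finite_subset by blast
qed

definition mono :: "'c multiset \<Rightarrow> 'c multiset \<Rightarrow> 'k" where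
  "mono \<beta> m = (if m = \<beta> then \<one>\<^bsub>K\<^esub> else \<zero>\<^bsub>K\<^esub>)"

lemma mono_closed: "set_mset \<beta> \<subseteq> V \<Longrightarrow> mono \<beta> \<in> carrier S"
  by (auto simp: S_carrier mono_def)

lemma indexed_var_mono: "K.indexed_var i = mono {#i#}"
proof
  fix m
  have "i \<in># m \<and> m - {#i#} = {#} \<longleftrightarrow> m = {#i#}"
    by (metis add_mset_remove_trivial insert_DiffM union_single_eq_member add_mset_add_single empty_neutral(1))
  then show "K.indexed_var i m = mono {#i#} m"
    unfolding K.indexed_var_def K.indexed_pmult_def K.indexed_const_def mono_def by auto
qed

lemma scaled_mono_mult:
  assumes "f \<in> carrier S" "k \<in> carrier K"
  shows "((\<lambda>m. if m = \<beta> then k else \<zero>\<^bsub>K\<^esub>) \<otimes> f) m = (if \<beta> \<subseteq># m then k \<otimes>\<^bsub>K\<^esub> f (m - \<beta>) else \<zero>\<^bsub>K\<^esub>)"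
proof (cases "\<beta> \<subseteq># m")
  case True
  have "((\<lambda>m. if m = \<beta> then k else \<zero>\<^bsub>K\<^esub>) \<otimes> f) m = (if \<beta> = \<beta> then k else \<zero>\<^bsub>K\<^esub>) \<otimes>\<^bsub>K\<^esub> f (m - \<beta>)"
    unfolding S_mult by (rule K.fs_single) (use True assms finite_sub_mset in auto)
  then show ?thesis using True by simp
next
  case False
  then have "((\<lambda>m. if m = \<beta> then k else \<zero>\<^bsub>K\<^esub>) \<otimes> f) m = \<zero>\<^bsub>K\<^esub>"
    unfolding S_mult using assms by (intro K.fs_zero) auto
  then show ?thesis using False by simp
qed

lemma mono_mult: "f \<in> carrier S \<Longrightarrow> (mono \<beta> \<otimes> f) m = (if \<beta> \<subseteq># m then f (m - \<beta>) else \<zero>\<^bsub>K\<^esub>)"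
  using scaled_mono_mult[of f "\<one>\<^bsub>K\<^esub>" \<beta> m] unfolding mono_def[abs_def] by simp

lemma mono_mono: "set_mset \<beta> \<subseteq> V \<Longrightarrow> set_mset \<gamma> \<subseteq> V \<Longrightarrow> mono \<beta> \<otimes> mono \<gamma> = mono (\<beta> + \<gamma>)"
proof
  fix m assume "set_mset \<beta> \<subseteq> V" "set_mset \<gamma> \<subseteq> V"
  then show "(mono \<beta> \<otimes> mono \<gamma>) m = mono (\<beta> + \<gamma>) m"
    using mono_mult[OF mono_closed[of \<gamma>], of \<beta> m] by (auto simp: mono_def)
qed

lemma binomial_mult:
  assumes "set_mset M1 \<subseteq> V" "set_mset M2 \<subseteq> V" "f \<in> carrier S"
  shows "((mono M1 \<ominus> mono M2) \<otimes> f) m =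
    (if M1 \<subseteq># m then f (m - M1) else \<zero>\<^bsub>K\<^esub>) \<ominus>\<^bsub>K\<^esub> (if M2 \<subseteq># m then f (m - M2) else \<zero>\<^bsub>K\<^esub>)"
proof -
  have c: "mono M1 \<in> carrier S" "mono M2 \<in> carrier S" using assms mono_closed by auto
  have "(g \<ominus> h) \<otimes> f = g \<otimes> f \<ominus> h \<otimes> f" if "g \<in> carrier S" "h \<in> carrier S" for g h
    using that assms(3) by algebra
  then have "(mono M1 \<ominus> mono M2) \<otimes> f = mono M1 \<otimes> f \<ominus> mono M2 \<otimes> f" using c by blast
  then show ?thesis using c assms by (simp add: S_minus mono_mult)
qed

subsection \<open>The ideal of the indeterminates\<close>

lemma no_constant_term:
  assumes "finite W" "W \<subseteq> V" "f \<in> carrier S" "\<And>m. f m \<noteq> \<zero>\<^bsub>K\<^esub> \<Longrightarrow> set_mset m \<inter> W \<noteq> {}"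
  shows "f \<in> Idl ((\<lambda>i. mono {#i#}) ` W)"
  using assms
proof (induction W arbitrary: f rule: finite_induct)
  case empty
  then have "f = \<zero>" unfolding S_zero by auto
  then show ?case by (simp add: Idl_empty)
next
  case (insert i W)
  have Wc: "(\<lambda>i. mono {#i#}) ` W \<subseteq> carrier S" and ic: "mono {#i#} \<in> carrier S"
    using insert.prems by (auto intro!: mono_closed)
  define g where "g m = f (add_mset i m)" for m
  have g: "g \<in> carrier S" using insert.prems unfolding S_carrier g_def by auto
  define y where "y = mono {#i#}"
  define h where "h = f \<ominus> y \<otimes> g"
  have y: "y \<in> carrier S" unfolding y_def by (rule ic)
  have h: "h \<in> carrier S" unfolding h_def using insert.prems g y by simp
  have hm: "h m = (if i \<in># m then \<zero>\<^bsub>K\<^esub> else f m)" for m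
    unfolding h_def y_def using insert.prems g ic
    by (simp add: S_minus mono_mult g_def K.minus_eq K.r_neg)
  have "h \<in> Idl ((\<lambda>i. mono {#i#}) ` W)"
  proof (rule insert.IH[OF _ h])
    show "set_mset m \<inter> W \<noteq> {}" if "h m \<noteq> \<zero>\<^bsub>K\<^esub>" for m
      using that insert.prems(3)[of m] unfolding hm by (auto split: if_splits)
  qed (use insert in simp)
  moreover have "f = g \<otimes> y \<oplus> h" unfolding h_def using insert.prems(2) g y by algebra
  ultimately have "f \<in> Idl (insert y ((\<lambda>i. mono {#i#}) ` W))" unfolding Idl_insert[OF Wc y] using g by blast
  then show ?case unfolding y_def by simp
qed

text \<open>
  A series with constant term \<open>k \<noteq> 0\<close> is congruent to the unit \<open>k\<close> modulo the indeterminates.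
\<close>

lemma prime_over_variables:
  assumes V: "finite V" and P: "primeideal P S" and vP: "\<And>i. i \<in> V \<Longrightarrow> mono {#i#} \<in> P"
  shows "P = Idl ((\<lambda>i. mono {#i#}) ` V)"
proof
  have Pi: "ideal P S" using primeideal.axioms(1)[OF P] .
  show IP: "Idl ((\<lambda>i. mono {#i#}) ` V) \<subseteq> P" using vP by (intro Idl_least[OF Pi]) auto
  have nc: "f \<in> Idl ((\<lambda>i. mono {#i#}) ` V)" if f: "f \<in> carrier S" and f0: "f {#} = \<zero>\<^bsub>K\<^esub>" for f
  proof (rule no_constant_term[OF V order_refl f])
    show "set_mset m \<inter> V \<noteq> {}" if "f m \<noteq> \<zero>\<^bsub>K\<^esub>" for m
      using f0 that coeff_supp[OF f that] by (cases "m = {#}") (auto simp: Int_absorb2)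
  qed
  show "P \<subseteq> Idl ((\<lambda>i. mono {#i#}) ` V)"
  proof
    fix f assume f: "f \<in> P"
    then have fc: "f \<in> carrier S" using ideal_carr[OF Pi] by blast
    define C where "C k = (\<lambda>m :: 'c multiset. if m = {#} then k else \<zero>\<^bsub>K\<^esub>)" for k
    have Cc: "C k \<in> carrier S" if "k \<in> carrier K" for k using that by (auto simp: S_carrier C_def)
    have "f {#} = \<zero>\<^bsub>K\<^esub>"
    proof (rule ccontr)
      assume ne: "f {#} \<noteq> \<zero>\<^bsub>K\<^esub>"
      define k where "k = f {#}"
      have k: "k \<in> carrier K" "k \<in> Units K" unfolding k_def using fc ne K.field_Units by auto
      have "(f \<ominus> C k) {#} = \<zero>\<^bsub>K\<^esub>"
        using S_minus[OF fc Cc[OF k(1)], of "{#}"] k by (simp add: C_def k_def K.minus_eq K.r_neg)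
      then have fC: "f \<ominus> C k \<in> P" using nc[of "f \<ominus> C k"] IP fc Cc[OF k(1)] by auto
      have "b = a \<ominus> (a \<ominus> b)" if "a \<in> carrier S" "b \<in> carrier S" for a b using that by algebra
      then have "C k = f \<ominus> (f \<ominus> C k)" using fc Cc[OF k(1)] by blast
      then have "C k \<in> P" using ideal_minus[OF Pi f fC] by simp
      moreover have i: "inv\<^bsub>K\<^esub> k \<in> carrier K" "k \<otimes>\<^bsub>K\<^esub> inv\<^bsub>K\<^esub> k = \<one>\<^bsub>K\<^esub>" using k by auto
      ultimately have "C k \<otimes> C (inv\<^bsub>K\<^esub> k) \<in> P" using ideal_rmult[OF Pi] Cc by blast
      moreover have "C k \<otimes> C (inv\<^bsub>K\<^esub> k) = \<one>"
      proof
        fix m show "(C k \<otimes> C (inv\<^bsub>K\<^esub> k)) m = \<one> m"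
          using scaled_mono_mult[OF Cc[OF i(1)] k(1), of "{#}" m] i k
          unfolding C_def[of k] S_one by (simp add: C_def)
      qed
      ultimately show False using primeideal.I_notcarr[OF P] ideal.one_imp_carrier[OF Pi] by simp
    qed
    then show "f \<in> Idl ((\<lambda>i. mono {#i#}) ` V)" by (rule nc[OF fc])
  qed
qed

subsection \<open>Initial monomials\<close>

context
  fixes \<sigma> :: "'c \<Rightarrow> nat"
  assumes \<sigma>: "inj_on \<sigma> V"
begin

abbreviation key :: "'c multiset \<Rightarrow> nat multiset" where "key m \<equiv> image_mset \<sigma> m"

text \<open>
  Monomials are compared in the multiset order of their images under \<open>\<sigma>\<close>, and the initial monomial
  is the smallest one. The order of two monomials is decided by the largest label at which they
  differ, so the choice of \<open>\<sigma>\<close> decides which term of a binomial is initial.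
\<close>

definition initial :: "('c multiset \<Rightarrow> 'k) \<Rightarrow> 'c multiset \<Rightarrow> bool" where
  "initial f \<mu> \<longleftrightarrow> f \<mu> \<noteq> \<zero>\<^bsub>K\<^esub> \<and> (\<forall>m. f m \<noteq> \<zero>\<^bsub>K\<^esub> \<longrightarrow> key \<mu> \<le> key m)"

lemma key_inj: "set_mset m \<subseteq> V \<Longrightarrow> set_mset n \<subseteq> V \<Longrightarrow> key m = key n \<Longrightarrow> m = n"
proof -
  assume m: "set_mset m \<subseteq> V" and n: "set_mset n \<subseteq> V" and e: "key m = key n"
  have unkey: "image_mset (inv_into V \<sigma>) (key m) = m" if "set_mset m \<subseteq> V" for m
  proof -
    have "image_mset (inv_into V \<sigma>) (key m) = image_mset (\<lambda>x. x) m"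
      unfolding image_mset.compositionality
      by (rule image_mset_cong) (use that \<sigma> in \<open>auto simp: inv_into_f_f\<close>)
    then show ?thesis by simp
  qed
  show ?thesis by (rule trans[OF sym[OF unkey[OF m]] unkey[OF n, folded e]])
qed

lemma initial_exists:
  assumes "f \<in> carrier S" "f \<noteq> \<zero>"
  shows "\<exists>\<mu>. initial f \<mu>"
proof -
  obtain m where "f m \<noteq> \<zero>\<^bsub>K\<^esub>" using assms unfolding S_zero by auto
  then have "\<exists>y. y \<in> key ` {m. f m \<noteq> \<zero>\<^bsub>K\<^esub>}" by blast
  then obtain y where y: "y \<in> key ` {m. f m \<noteq> \<zero>\<^bsub>K\<^esub>}" "\<And>z. z < y \<Longrightarrow> z \<notin> key ` {m. f m \<noteq> \<zero>\<^bsub>K\<^esub>}"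
    using exists_least_iff[of "\<lambda>y. y \<in> key ` {m. f m \<noteq> \<zero>\<^bsub>K\<^esub>}"] by blast
  then obtain \<mu> where \<mu>: "f \<mu> \<noteq> \<zero>\<^bsub>K\<^esub>" "y = key \<mu>" by blast
  have "key \<mu> \<le> key m" if "f m \<noteq> \<zero>\<^bsub>K\<^esub>" for m
    using y(2)[of "key m"] that \<mu> by (meson imageI mem_Collect_eq not_le)
  then show ?thesis using \<mu> unfolding initial_def by blast
qed

lemma initial_unique: "f \<in> carrier S \<Longrightarrow> initial f \<mu> \<Longrightarrow> initial f \<nu> \<Longrightarrow> \<mu> = \<nu>"
  using key_inj coeff_supp unfolding initial_def by (meson order_antisym)

lemma initial_mult:
  assumes f: "f \<in> carrier S" "initial f \<mu>" and g: "g \<in> carrier S" "initial g \<nu>"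
  shows "initial (f \<otimes> g) (\<mu> + \<nu>)"
proof -
  have "(f \<otimes> g) (\<mu> + \<nu>) = f \<mu> \<otimes>\<^bsub>K\<^esub> g (\<mu> + \<nu> - \<mu>)"
    unfolding S_mult
  proof (rule K.fs_single[OF finite_sub_mset])
    fix a assume a: "a \<in> {a. a \<subseteq># \<mu> + \<nu>}" "a \<noteq> \<mu>"
    show "f a \<otimes>\<^bsub>K\<^esub> g (\<mu> + \<nu> - a) = \<zero>\<^bsub>K\<^esub>"
    proof (rule ccontr)
      assume "f a \<otimes>\<^bsub>K\<^esub> g (\<mu> + \<nu> - a) \<noteq> \<zero>\<^bsub>K\<^esub>"
      then have ne: "f a \<noteq> \<zero>\<^bsub>K\<^esub>" "g (\<mu> + \<nu> - a) \<noteq> \<zero>\<^bsub>K\<^esub>" using f g by auto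
      then have le: "key \<mu> \<le> key a" "key \<nu> \<le> key (\<mu> + \<nu> - a)" using f g unfolding initial_def by auto
      have sum: "key a + key (\<mu> + \<nu> - a) = key \<mu> + key \<nu>"
        using a(1) by (metis image_mset_union mem_Collect_eq subset_mset.add_diff_inverse)
      have "key a = key \<mu>"
      proof (rule ccontr)
        assume "key a \<noteq> key \<mu>"
        then have "key \<mu> < key a" using le by simp
        then have "key \<mu> + key \<nu> < key a + key (\<mu> + \<nu> - a)" using le by (simp add: add_less_le_mono)
        then show False using sum by simp
      qed
      moreover have "set_mset a \<subseteq> V" "set_mset \<mu> \<subseteq> V"
        using coeff_supp f ne unfolding initial_def by auto
      ultimately show False using key_inj a by blast
    qed
  qed (use f g in auto)
  then have "(f \<otimes> g) (\<mu> + \<nu>) \<noteq> \<zero>\<^bsub>K\<^esub>"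
    using f g K.integral[of "f \<mu>" "g \<nu>"] unfolding initial_def by auto
  moreover have "key (\<mu> + \<nu>) \<le> key m" if m: "(f \<otimes> g) m \<noteq> \<zero>\<^bsub>K\<^esub>" for m
  proof -
    have "\<exists>a. a \<subseteq># m \<and> f a \<otimes>\<^bsub>K\<^esub> g (m - a) \<noteq> \<zero>\<^bsub>K\<^esub>"
    proof (rule ccontr)
      assume "\<not> ?thesis"
      then have "(f \<otimes> g) m = \<zero>\<^bsub>K\<^esub>" unfolding S_mult by (intro K.fs_zero) auto
      then show False using m by simp
    qed
    then obtain a where a: "a \<subseteq># m" "f a \<otimes>\<^bsub>K\<^esub> g (m - a) \<noteq> \<zero>\<^bsub>K\<^esub>" by blast
    then have "f a \<noteq> \<zero>\<^bsub>K\<^esub>" "g (m - a) \<noteq> \<zero>\<^bsub>K\<^esub>" using f g by auto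
    then have "key \<mu> \<le> key a" "key \<nu> \<le> key (m - a)" using f g unfolding initial_def by auto
    moreover have "key m = key a + key (m - a)"
      using a(1) by (metis image_mset_union subset_mset.add_diff_inverse)
    ultimately show ?thesis by (simp add: add_mono)
  qed
  ultimately show ?thesis unfolding initial_def by blast
qed

lemma integral_S:
  assumes "f \<in> carrier S" "g \<in> carrier S" "f \<otimes> g = \<zero>" "f \<noteq> \<zero>"
  shows "g = \<zero>"
proof (rule ccontr)
  assume "g \<noteq> \<zero>"
  then obtain \<mu> \<nu> where "initial f \<mu>" "initial g \<nu>" using initial_exists assms by blast
  then have "initial (f \<otimes> g) (\<mu> + \<nu>)" using initial_mult assms by blast
  then show False using assms(3) unfolding initial_def S_zero by simp
qed

lemma initial_binomial:
  assumes "set_mset A \<subseteq> V" "set_mset B \<subseteq> V" "key B < key A"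
  shows "initial (mono A \<ominus> mono B) B" "initial (mono B \<ominus> mono A) B"
proof -
  have c: "mono A \<in> carrier S" "mono B \<in> carrier S" using mono_closed assms by auto
  have "A \<noteq> B" using assms(3) by auto
  have 1: "(mono A \<ominus> mono B) m \<noteq> \<zero>\<^bsub>K\<^esub> \<longleftrightarrow> m = A \<or> m = B" for m
    using c \<open>A \<noteq> B\<close> by (auto simp: S_minus mono_def K.minus_eq)
  have 2: "(mono B \<ominus> mono A) m \<noteq> \<zero>\<^bsub>K\<^esub> \<longleftrightarrow> m = A \<or> m = B" for m
    using c \<open>A \<noteq> B\<close> by (auto simp: S_minus mono_def K.minus_eq)
  show "initial (mono A \<ominus> mono B) B" "initial (mono B \<ominus> mono A) B"
    using assms(3) unfolding initial_def 1 2 by auto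
qed

subsection \<open>Division by a binomial\<close>

context
  fixes M1 M2 :: "'c multiset"
  assumes MV: "set_mset M1 \<subseteq> V" "set_mset M2 \<subseteq> V" and disj: "set_mset M1 \<inter> set_mset M2 = {}"
    and M1_ne: "M1 \<noteq> {#}"
begin

text \<open>
  Modulo the binomial \<open>X^M1 - X^M2\<close> a factor \<open>X^M2\<close> of a monomial may be replaced by \<open>X^M1\<close>. The
  coefficient at \<open>n\<close> collects the coefficients of those monomials of \<open>f\<close> that \<open>p\<close> such replacements
  turn into \<open>n + M2\<close>, for all \<open>p\<close>. Adding \<open>quo f\<close> times the binomial to \<open>f\<close> thus removes all
  monomials divisible by \<open>X^M2\<close>, see \<open>division\<close>.
\<close>

definition quo :: "('c multiset \<Rightarrow> 'k) \<Rightarrow> 'c multiset \<Rightarrow> 'k" where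
  "quo f n = (\<Oplus>\<^bsub>K\<^esub>p \<in> {p. repeat_mset p M1 \<subseteq># n}. f (n - repeat_mset p M1 + repeat_mset (Suc p) M2))"

lemma finite_repeats: "finite {p. repeat_mset p M1 \<subseteq># n}"
proof (rule finite_subset)
  show "{p. repeat_mset p M1 \<subseteq># n} \<subseteq> {..size n}"
  proof
    fix p assume "p \<in> {p. repeat_mset p M1 \<subseteq># n}"
    then have "size (repeat_mset p M1) \<le> size n" using size_mset_mono by blast
    then have "p * size M1 \<le> size n" by simp
    moreover have "1 \<le> size M1" using M1_ne by (simp add: Suc_le_eq nonempty_has_size)
    ultimately have "p \<le> size n" by (metis mult_le_mono2 nat_mult_1_right le_trans)
    then show "p \<in> {..size n}" by simp
  qed
qed simp

lemma quo_closed: "f \<in> carrier S \<Longrightarrow> quo f \<in> carrier S"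
proof -
  assume f: "f \<in> carrier S"
  have "quo f n = \<zero>\<^bsub>K\<^esub>" if n: "\<not> set_mset n \<subseteq> V" for n
    unfolding quo_def
  proof (rule K.fs_zero)
    fix p assume p: "p \<in> {p. repeat_mset p M1 \<subseteq># n}"
    obtain i where i: "i \<in># n" "i \<notin> V" using n by auto
    have "count M1 i = 0" using i MV by (auto simp: count_eq_zero_iff)
    moreover have "count n i \<noteq> 0" using i by simp
    ultimately have "count (n - repeat_mset p M1 + repeat_mset (Suc p) M2) i \<noteq> 0" by simp
    then have "i \<in># n - repeat_mset p M1 + repeat_mset (Suc p) M2" by (meson count_eq_zero_iff)
    then show "f (n - repeat_mset p M1 + repeat_mset (Suc p) M2) = \<zero>\<^bsub>K\<^esub>"
      using coeff_supp[OF f] i by blast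
  qed
  moreover have "quo f n \<in> carrier K" for n unfolding quo_def using f by (intro K.fs_closed) simp
  ultimately show ?thesis unfolding S_carrier by blast
qed

lemma division:
  assumes f: "f \<in> carrier S" and m: "M2 \<subseteq># m"
  shows "(f \<oplus> (mono M1 \<ominus> mono M2) \<otimes> quo f) m = \<zero>\<^bsub>K\<^esub>"
proof -
  have dz: "count M1 i = 0 \<or> count M2 i = 0" for i
    using disj by (metis IntI count_eq_zero_iff empty_iff)
  define n where "n = m - M2"
  have mn: "m = n + M2" unfolding n_def using m by simp
  define h where "h p = f (n - repeat_mset p M1 + repeat_mset (Suc p) M2)" for p
  have hc: "h p \<in> carrier K" for p unfolding h_def using f by simp
  define A where "A = {p. repeat_mset p M1 \<subseteq># n}"
  have finA: "finite A" unfolding A_def by (rule finite_repeats)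
  have "0 \<in> A" unfolding A_def by simp
  have "quo f n = h 0 \<oplus>\<^bsub>K\<^esub> finsum K h (A - {0})"
    unfolding quo_def A_def[symmetric] h_def[symmetric]
    by (rule K.fs_remove[OF finA \<open>0 \<in> A\<close> hc])
  then have qn: "quo f n = f m \<oplus>\<^bsub>K\<^esub> finsum K h (A - {0})" by (simp add: h_def mn)
  have second: "(if M1 \<subseteq># m then quo f (m - M1) else \<zero>\<^bsub>K\<^esub>) = finsum K h (A - {0})"
  proof (cases "M1 \<subseteq># m")
    case True
    have M1n: "M1 \<subseteq># n"
    proof (rule mset_subset_eqI)
      fix i show "count M1 i \<le> count n i"
        using dz[of i] mset_subset_eq_count[OF True, of i] by (auto simp: mn)
    qed
    have A: "A - {0} = Suc ` {p. repeat_mset p M1 \<subseteq># m - M1}"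
    proof (intro equalityI subsetI)
      fix p assume p: "p \<in> A - {0}"
      then obtain p' where p': "p = Suc p'" by (cases p) auto
      have "repeat_mset p' M1 \<subseteq># m - M1"
      proof (rule mset_subset_eqI)
        fix i show "count (repeat_mset p' M1) i \<le> count (m - M1) i"
          using p mset_subset_eq_count[of "repeat_mset p M1" n i] unfolding A_def p' mn by simp
      qed
      then show "p \<in> Suc ` {p. repeat_mset p M1 \<subseteq># m - M1}" using p' by blast
    next
      fix p assume "p \<in> Suc ` {p. repeat_mset p M1 \<subseteq># m - M1}"
      then obtain p' where p': "p = Suc p'" "repeat_mset p' M1 \<subseteq># m - M1" by blast
      have "repeat_mset p M1 \<subseteq># n"
      proof (rule mset_subset_eqI)
        fix i show "count (repeat_mset p M1) i \<le> count n i"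
          using dz[of i] mset_subset_eq_count[OF p'(2), of i] mset_subset_eq_count[OF M1n, of i]
          unfolding p' mn by auto
      qed
      then show "p \<in> A - {0}" unfolding A_def p' by auto
    qed
    have "quo f (m - M1) = finsum K (\<lambda>p. h (Suc p)) {p. repeat_mset p M1 \<subseteq># m - M1}"
      unfolding quo_def
    proof (rule K.fs_cong)
      fix p assume p: "p \<in> {p. repeat_mset p M1 \<subseteq># m - M1}"
      have "m - M1 - repeat_mset p M1 + repeat_mset (Suc p) M2 =
          n - repeat_mset (Suc p) M1 + repeat_mset (Suc (Suc p)) M2"
      proof (rule multiset_eqI)
        fix i show "count (m - M1 - repeat_mset p M1 + repeat_mset (Suc p) M2) i =
          count (n - repeat_mset (Suc p) M1 + repeat_mset (Suc (Suc p)) M2) i"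
          using dz[of i] by (auto simp: mn)
      qed
      then show "f (m - M1 - repeat_mset p M1 + repeat_mset (Suc p) M2) = h (Suc p)"
        unfolding h_def by (rule arg_cong)
    qed (rule hc)
    also have "\<dots> = finsum K h (A - {0})"
      unfolding A by (rule K.fs_reindex[symmetric]) (auto intro: hc)
    finally show ?thesis using True by simp
  next
    case False
    have "p = 0" if p: "p \<in> A" for p
    proof (rule ccontr)
      assume "p \<noteq> 0"
      have "M1 \<subseteq># m"
      proof (rule mset_subset_eqI)
        fix i
        have "count M1 i \<le> p * count M1 i" using \<open>p \<noteq> 0\<close> by (cases p) simp_all
        also have "\<dots> \<le> count n i"
          using mset_subset_eq_count[of "repeat_mset p M1" n i] p unfolding A_def by simp
        also have "\<dots> \<le> count m i" unfolding mn by simp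
        finally show "count M1 i \<le> count m i" .
      qed
      then show False using False by simp
    qed
    then have "A - {0} = {}" by blast
    then have "finsum K h (A - {0}) = \<zero>\<^bsub>K\<^esub>" by (simp only: K.finsum_empty)
    then show ?thesis using False by simp
  qed
  have sc: "finsum K h (A - {0}) \<in> carrier K" using hc by (intro K.fs_closed)
  have fm: "f m \<in> carrier K" using f by simp
  have "((mono M1 \<ominus> mono M2) \<otimes> quo f) m = finsum K h (A - {0}) \<ominus>\<^bsub>K\<^esub> (f m \<oplus>\<^bsub>K\<^esub> finsum K h (A - {0}))"
    unfolding binomial_mult[OF MV quo_closed[OF f]] second using m qn unfolding n_def by simp
  moreover have "a \<oplus>\<^bsub>K\<^esub> (b \<ominus>\<^bsub>K\<^esub> (a \<oplus>\<^bsub>K\<^esub> b)) = \<zero>\<^bsub>K\<^esub>" if "a \<in> carrier K" "b \<in> carrier K" for a b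
    using that by algebra
  ultimately show ?thesis unfolding S_add using sc fm by simp
qed

text \<open>
  Let \<open>r\<close> be the remainder of \<open>s\<close> on division by the binomial. Then \<open>c r\<close> is a multiple of the
  binomial, and comparing initial monomials gives \<open>\<nu> + \<mu> = M2 + \<tau>\<close> with \<open>\<mu>\<close> the initial monomial of
  \<open>r\<close>. As \<open>\<nu>\<close> is disjoint from \<open>M2\<close>, the monomial \<open>M2\<close> divides \<open>\<mu>\<close>, which is impossible for a
  remainder. So \<open>r = 0\<close>.
\<close>

lemma binomial_colon:
  assumes key: "key M2 < key M1" and c: "c \<in> carrier S" "initial c \<nu>" and \<nu>: "set_mset \<nu> \<inter> set_mset M2 = {}"
    and st: "s \<in> carrier S" "t \<in> carrier S" "c \<otimes> s = (mono M1 \<ominus> mono M2) \<otimes> t"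
  shows "\<exists>s'\<in>carrier S. s = (mono M1 \<ominus> mono M2) \<otimes> s'"
proof -
  define b where "b = mono M1 \<ominus> mono M2"
  have b: "b \<in> carrier S" "initial b M2"
    unfolding b_def using mono_closed MV initial_binomial[OF MV key] by auto
  define q where "q = quo s"
  have q: "q \<in> carrier S" unfolding q_def by (rule quo_closed[OF st(1)])
  define r where "r = s \<oplus> b \<otimes> q"
  have r: "r \<in> carrier S" unfolding r_def using st b q by simp
  have r0: "r m = \<zero>\<^bsub>K\<^esub>" if "M2 \<subseteq># m" for m
    unfolding r_def b_def q_def by (rule division[OF st(1) that])
  have e: "c \<otimes> r = b \<otimes> (t \<oplus> c \<otimes> q)"
  proof -
    have "c \<otimes> r = c \<otimes> s \<oplus> b \<otimes> (c \<otimes> q)" unfolding r_def using c(1) st(1,2) b(1) q by algebra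
    also have "\<dots> = b \<otimes> (t \<oplus> c \<otimes> q)" unfolding st(3) b_def[symmetric] using c(1) st(1,2) b(1) q by algebra
    finally show ?thesis .
  qed
  have "r = \<zero>"
  proof (rule ccontr)
    assume "r \<noteq> \<zero>"
    then obtain \<mu> where \<mu>: "initial r \<mu>" using initial_exists r by blast
    have i1: "initial (c \<otimes> r) (\<nu> + \<mu>)" by (rule initial_mult[OF c r \<mu>])
    have t': "t \<oplus> c \<otimes> q \<in> carrier S" using st c q by simp
    have "t \<oplus> c \<otimes> q \<noteq> \<zero>"
    proof
      assume "t \<oplus> c \<otimes> q = \<zero>"
      then have "c \<otimes> r = \<zero>" using e b by simp
      then show False using i1 unfolding initial_def S_zero by simp
    qed
    then obtain \<tau> where \<tau>: "initial (t \<oplus> c \<otimes> q) \<tau>" using initial_exists t' by blast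
    have "initial (c \<otimes> r) (M2 + \<tau>)" unfolding e by (rule initial_mult[OF b t' \<tau>])
    then have eq: "\<nu> + \<mu> = M2 + \<tau>" using initial_unique[OF _ i1] c r by simp
    have "M2 \<subseteq># \<mu>"
    proof (rule mset_subset_eqI)
      fix i
      have "count \<nu> i + count \<mu> i = count M2 i + count \<tau> i" using eq by (metis count_union)
      moreover have "count \<nu> i = 0 \<or> count M2 i = 0" using \<nu> by (metis IntI count_eq_zero_iff empty_iff)
      ultimately show "count M2 i \<le> count \<mu> i" by auto
    qed
    then show False using r0 \<mu> unfolding initial_def by blast
  qed
  then have "s \<oplus> b \<otimes> q = \<zero>" unfolding r_def .
  then have "s = \<ominus> (b \<otimes> q)" using st b q minus_equality[of s "b \<otimes> q"] by simp
  then have "s = b \<otimes> (\<ominus> q)" using b q by (simp add: r_minus)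
  then show ?thesis using q unfolding b_def by blast
qed

end

end

end

section \<open>Two-term sequences\<close>

lemma (in cring) stable_seq_pair:
  assumes b: "b \<in> carrier R" and c: "c \<in> carrier R"
    and nzd: "\<And>s. s \<in> carrier R \<Longrightarrow> b \<otimes> s = \<zero> \<Longrightarrow> s = \<zero>"
    and col: "\<And>s t. s \<in> carrier R \<Longrightarrow> t \<in> carrier R \<Longrightarrow> c \<otimes> s = b \<otimes> t \<Longrightarrow> \<exists>s'\<in>carrier R. s = b \<otimes> s'"
  shows "stable_seq [c, b]"
proof -
  have 1: "\<exists>s'\<in>carrier R. s = b [^] m \<otimes> s'"
    if "s \<in> carrier R" "t \<in> carrier R" "c \<otimes> s = b [^] m \<otimes> t" for s t and m :: nat
    using that
  proof (induction m arbitrary: s t)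
    case 0
    then show ?case by (intro bexI[of _ s]) auto
  next
    case (Suc m)
    have e: "c \<otimes> s = b \<otimes> (b [^] m \<otimes> t)" using Suc.prems b by (simp add: m_ac)
    then obtain s' where s': "s' \<in> carrier R" "s = b \<otimes> s'" using col[of s "b [^] m \<otimes> t"] Suc.prems b by auto
    have bm: "b [^] m \<otimes> t \<in> carrier R" using b Suc.prems by simp
    have "b \<otimes> (c \<otimes> s' \<ominus> u) = c \<otimes> (b \<otimes> s') \<ominus> b \<otimes> u" if "u \<in> carrier R" for u
      using b c s'(1) that by algebra
    then have "b \<otimes> (c \<otimes> s' \<ominus> b [^] m \<otimes> t) = c \<otimes> (b \<otimes> s') \<ominus> b \<otimes> (b [^] m \<otimes> t)" using bm by blast
    also have "\<dots> = \<zero>" using e s' b c Suc.prems bm by (simp add: minus_eq r_neg)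
    finally have "c \<otimes> s' \<ominus> b [^] m \<otimes> t = \<zero>" using nzd[of "c \<otimes> s' \<ominus> b [^] m \<otimes> t"] c s' bm by simp
    then have "c \<otimes> s' = b [^] m \<otimes> t" using eq_by_minus[of "c \<otimes> s'" "b [^] m \<otimes> t"] c s' bm by simp
    then obtain s'' where "s'' \<in> carrier R" "s' = b [^] m \<otimes> s''" using Suc.IH s' Suc.prems by blast
    then show ?case using s' b by (intro bexI[of _ s'']) (auto simp: m_ac)
  qed
  have 2: "s \<in> power_ideal [b] m" if "s \<in> carrier R" "s \<otimes> c [^] n \<in> power_ideal [b] m" for s and m n :: nat
    using that
  proof (induction n arbitrary: s)
    case 0
    then show ?case by simp
  next
    case (Suc n)
    have "(s \<otimes> c) \<otimes> c [^] n \<in> power_ideal [b] m" using Suc.prems c by (simp add: m_ac)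
    then have "s \<otimes> c \<in> power_ideal [b] m" using Suc.IH[of "s \<otimes> c"] Suc.prems c by simp
    then obtain t where t: "t \<in> carrier R" "s \<otimes> c = t \<otimes> b [^] m"
      unfolding power_ideal_def using b by (auto simp: Idl_singleton_iff)
    then have "c \<otimes> s = b [^] m \<otimes> t" using Suc.prems b c by (simp add: m_comm)
    then obtain s' where "s' \<in> carrier R" "s = b [^] m \<otimes> s'" using 1 Suc.prems t by blast
    then show ?case unfolding power_ideal_def using b by (auto simp: Idl_singleton_iff m_comm)
  qed
  have 3: "s = \<zero>" if "s \<in> carrier R" "s \<otimes> b [^] n = \<zero>" for s and n :: nat
    using that
  proof (induction n arbitrary: s)
    case 0
    then show ?case by simp
  next
    case (Suc n)
    have "(s \<otimes> b) \<otimes> b [^] n = \<zero>" using Suc.prems b by (simp add: m_ac)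
    then have "s \<otimes> b = \<zero>" using Suc.IH[of "s \<otimes> b"] Suc.prems b by simp
    then show ?case using nzd[of s] Suc.prems b by (simp add: m_comm)
  qed
  have "colon_stable [b] c" unfolding colon_stable_def using 2 c by (intro allI exI[of _ 0]) auto
  moreover have "colon_stable [] b" unfolding colon_stable_def power_ideal_Nil using 3 b by (intro allI exI[of _ 0]) auto
  ultimately show ?thesis using b c by simp
qed


section \<open>The ideal of maximal minors\<close>

text \<open>
  The minor that omits column \<open>j\<close>; all indices other than 1 and 2 stand for the third column.
\<close>

definition minor :: "('a, 'b) ring_scheme \<Rightarrow> (nat \<Rightarrow> 'a) \<Rightarrow> nat \<Rightarrow> 'a" where
  "minor R x j = (if j = 1 then x 2 \<otimes>\<^bsub>R\<^esub> x 6 \<ominus>\<^bsub>R\<^esub> x 3 \<otimes>\<^bsub>R\<^esub> x 5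
     else if j = 2 then x 1 \<otimes>\<^bsub>R\<^esub> x 6 \<ominus>\<^bsub>R\<^esub> x 3 \<otimes>\<^bsub>R\<^esub> x 4
     else x 1 \<otimes>\<^bsub>R\<^esub> x 5 \<ominus>\<^bsub>R\<^esub> x 2 \<otimes>\<^bsub>R\<^esub> x 4)"

abbreviation minors :: "('a, 'b) ring_scheme \<Rightarrow> (nat \<Rightarrow> 'a) \<Rightarrow> 'a list" where
  "minors R x \<equiv> [minor R x 1, minor R x 2, minor R x 3]"

lemma minors_ideal_eq: "minors_ideal R x = genideal R (set (minors R x))"
  unfolding minors_ideal_def minor_def by simp

lemma all_entries: "(\<forall>i\<in>{1..6::nat}. P i) \<longleftrightarrow> P 1 \<and> P 2 \<and> P 3 \<and> P 4 \<and> P 5 \<and> P 6"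
proof -
  have "{1..6::nat} = {1, 2, 3, 4, 5, 6}" by auto
  then show ?thesis by simp
qed

context cring
begin

lemma Idl_pair_mem:
  assumes "b \<in> carrier R" "c \<in> carrier R" "u \<in> carrier R" "v \<in> carrier R"
  shows "u \<otimes> c \<oplus> v \<otimes> b \<in> Idl {c, b}"
proof -
  have s: "{c, b} \<subseteq> carrier R" using assms by auto
  have I: "ideal (Idl {c, b}) R" by (rule genideal_ideal[OF s])
  have "c \<in> Idl {c, b}" "b \<in> Idl {c, b}" by (rule Idl_self[OF s], simp)+
  then show ?thesis using ideal_add[OF I] ideal_lmult[OF I] assms by blast
qed

lemma prime_pow_mem:
  assumes P: "primeideal P R" and y: "y \<in> carrier R"
  shows "y [^] (n::nat) \<in> P \<Longrightarrow> y \<in> P"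
proof (induction n)
  case 0
  then show ?case using primeideal.I_notcarr[OF P] ideal.one_imp_carrier[OF primeideal.axioms(1)[OF P]] by simp
next
  case (Suc n)
  then show ?case using primeideal.I_prime[OF P, of "y [^] n" y] y by auto
qed

lemma minor_closed:
  assumes "x \<in> {1..6} \<rightarrow> carrier R" shows "minor R x j \<in> carrier R"
  using assms by (auto simp: minor_def Pi_def)

text \<open>
  Expansion of the \<open>3 \<times> 3\<close> determinants in which one row of the matrix is repeated.
\<close>

lemma minor_relations:
  assumes x: "x \<in> {1..6} \<rightarrow> carrier R"
  shows "x 1 \<otimes> minor R x 1 \<in> Idl {minor R x 3, minor R x 2}"
    "x 4 \<otimes> minor R x 1 \<in> Idl {minor R x 3, minor R x 2}"
    "x 2 \<otimes> minor R x 2 \<in> Idl {minor R x 3, minor R x 1}"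
    "x 5 \<otimes> minor R x 2 \<in> Idl {minor R x 3, minor R x 1}"
    "x 3 \<otimes> minor R x 3 \<in> Idl {minor R x 2, minor R x 1}"
    "x 6 \<otimes> minor R x 3 \<in> Idl {minor R x 2, minor R x 1}"
proof -
  have c: "x 1 \<in> carrier R" "x 2 \<in> carrier R" "x 3 \<in> carrier R" "x 4 \<in> carrier R" "x 5 \<in> carrier R" "x 6 \<in> carrier R"
    using x by (auto simp: Pi_def)
  note m = minor_closed[OF x]
  have ids: "p1 \<otimes> (p2 \<otimes> p6 \<ominus> p3 \<otimes> p5) = (\<ominus> p3) \<otimes> (p1 \<otimes> p5 \<ominus> p2 \<otimes> p4) \<oplus> p2 \<otimes> (p1 \<otimes> p6 \<ominus> p3 \<otimes> p4)"
    "p4 \<otimes> (p2 \<otimes> p6 \<ominus> p3 \<otimes> p5) = (\<ominus> p6) \<otimes> (p1 \<otimes> p5 \<ominus> p2 \<otimes> p4) \<oplus> p5 \<otimes> (p1 \<otimes> p6 \<ominus> p3 \<otimes> p4)"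
    "p2 \<otimes> (p1 \<otimes> p6 \<ominus> p3 \<otimes> p4) = p3 \<otimes> (p1 \<otimes> p5 \<ominus> p2 \<otimes> p4) \<oplus> p1 \<otimes> (p2 \<otimes> p6 \<ominus> p3 \<otimes> p5)"
    "p5 \<otimes> (p1 \<otimes> p6 \<ominus> p3 \<otimes> p4) = p6 \<otimes> (p1 \<otimes> p5 \<ominus> p2 \<otimes> p4) \<oplus> p4 \<otimes> (p2 \<otimes> p6 \<ominus> p3 \<otimes> p5)"
    "p3 \<otimes> (p1 \<otimes> p5 \<ominus> p2 \<otimes> p4) = p2 \<otimes> (p1 \<otimes> p6 \<ominus> p3 \<otimes> p4) \<oplus> (\<ominus> p1) \<otimes> (p2 \<otimes> p6 \<ominus> p3 \<otimes> p5)"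
    "p6 \<otimes> (p1 \<otimes> p5 \<ominus> p2 \<otimes> p4) = p5 \<otimes> (p1 \<otimes> p6 \<ominus> p3 \<otimes> p4) \<oplus> (\<ominus> p4) \<otimes> (p2 \<otimes> p6 \<ominus> p3 \<otimes> p5)"
    if "p1 \<in> carrier R" "p2 \<in> carrier R" "p3 \<in> carrier R" "p4 \<in> carrier R" "p5 \<in> carrier R" "p6 \<in> carrier R"
    for p1 p2 p3 p4 p5 p6
    using that by algebra+
  note ids' = ids[OF c]
  have D: "x 2 \<otimes> x 6 \<ominus> x 3 \<otimes> x 5 = minor R x 1" "x 1 \<otimes> x 6 \<ominus> x 3 \<otimes> x 4 = minor R x 2"
    "x 1 \<otimes> x 5 \<ominus> x 2 \<otimes> x 4 = minor R x 3" by (simp_all add: minor_def)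
  show "x 1 \<otimes> minor R x 1 \<in> Idl {minor R x 3, minor R x 2}"
    unfolding ids'(1)[unfolded D] by (rule Idl_pair_mem) (use m c in auto)
  show "x 4 \<otimes> minor R x 1 \<in> Idl {minor R x 3, minor R x 2}"
    unfolding ids'(2)[unfolded D] by (rule Idl_pair_mem) (use m c in auto)
  show "x 2 \<otimes> minor R x 2 \<in> Idl {minor R x 3, minor R x 1}"
    unfolding ids'(3)[unfolded D] by (rule Idl_pair_mem) (use m c in auto)
  show "x 5 \<otimes> minor R x 2 \<in> Idl {minor R x 3, minor R x 1}"
    unfolding ids'(4)[unfolded D] by (rule Idl_pair_mem) (use m c in auto)
  show "x 3 \<otimes> minor R x 3 \<in> Idl {minor R x 2, minor R x 1}"
    unfolding ids'(5)[unfolded D] by (rule Idl_pair_mem) (use m c in auto)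
  show "x 6 \<otimes> minor R x 3 \<in> Idl {minor R x 2, minor R x 1}"
    unfolding ids'(6)[unfolded D] by (rule Idl_pair_mem) (use m c in auto)
qed

end

context inj_res
begin

text \<open>
  The ideal \<open>(c, b)\<close> has two generators, so \<open>z = d w\<close> with \<open>w\<close> torsion for it. A power of \<open>y a\<close> kills
  \<open>w\<close>, that is, \<open>y^n w\<close> is \<open>a\<close>-torsion for some \<open>n\<close>.
\<close>

lemma killed_by_cofactor:
  assumes abc: "a \<in> carrier R" "set as = {a, b, c}" and g: "stable_seq [c, b]"
    and y: "y \<in> carrier R" "y \<otimes> a \<in> Idl {c, b}"
    and z: "z \<in> tors as (Suc 2)" "d (Suc 2) z = Z0 (Suc (Suc 2))"
  shows "\<exists>n::nat. sm (Suc 2) (y [^] n) z \<in> coboundary_set as 2"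
proof -
  have cb: "set [c, b] \<subseteq> carrier R" using stable_seq_carr[OF g] .
  have "z \<in> tors [c, b] (Suc 2)" using z(1) abc unfolding tors_def by auto
  then obtain w where w: "w \<in> tors [c, b] 2" "d 2 w = z" using torsion_acyclic[OF g _ z(2)] by auto
  have wc: "w \<in> carrier (E 2)" using tors_carr[OF w(1)] .
  obtain n :: nat where n: "sm 2 ((y \<otimes> a) [^] n) w = Z0 2"
    using nilpotent_on_torsion[OF cb w(1), of "y \<otimes> a"] y(2) by auto
  define v where "v = sm 2 (y [^] n) w"
  have v: "v \<in> tors [c, b] 2" unfolding v_def using tors_smult[OF cb _ w(1)] y by simp
  have "sm 2 (a [^] n) v = sm 2 ((y \<otimes> a) [^] n) w"
    unfolding v_def using y abc wc by (simp add: E.smult_assoc1[symmetric] pow_mult_distrib[of a y] m_comm)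
  then have "v \<in> tors as 2" using v n abc unfolding tors_def by auto
  moreover have "d 2 v = sm (Suc 2) (y [^] n) z" unfolding v_def using w wc y by (simp add: d_smult)
  ultimately show ?thesis unfolding coboundary_set_def by (metis imageI)
qed

lemma killed_by_entries:
  assumes x: "x \<in> {1..6} \<rightarrow> carrier R"
    and g: "stable_seq [minor R x 3, minor R x 2]" "stable_seq [minor R x 3, minor R x 1]" "stable_seq [minor R x 2, minor R x 1]"
    and z: "z \<in> tors (minors R x) (Suc 2)" "d (Suc 2) z = Z0 (Suc (Suc 2))"
    and i: "i \<in> {1..6}"
  shows "\<exists>n::nat. sm (Suc 2) (x i [^] n) z \<in> coboundary_set (minors R x) 2"
proof -
  have c: "x 1 \<in> carrier R" "x 2 \<in> carrier R" "x 3 \<in> carrier R" "x 4 \<in> carrier R" "x 5 \<in> carrier R" "x 6 \<in> carrier R"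
    using x by (auto simp: Pi_def)
  note m = minor_closed[OF x]
  note rel = minor_relations[OF x]
  have 1: "\<exists>n::nat. sm (Suc 2) (y [^] n) z \<in> coboundary_set (minors R x) 2"
    if "y \<in> carrier R" "y \<otimes> minor R x 1 \<in> Idl {minor R x 3, minor R x 2}" for y
    by (rule killed_by_cofactor[OF m _ g(1) that z]) auto
  have 2: "\<exists>n::nat. sm (Suc 2) (y [^] n) z \<in> coboundary_set (minors R x) 2"
    if "y \<in> carrier R" "y \<otimes> minor R x 2 \<in> Idl {minor R x 3, minor R x 1}" for y
    by (rule killed_by_cofactor[OF m _ g(2) that z]) auto
  have 3: "\<exists>n::nat. sm (Suc 2) (y [^] n) z \<in> coboundary_set (minors R x) 2"
    if "y \<in> carrier R" "y \<otimes> minor R x 3 \<in> Idl {minor R x 2, minor R x 1}" for y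
    by (rule killed_by_cofactor[OF m _ g(3) that z]) auto
  have "\<forall>i\<in>{1..6}. \<exists>n::nat. sm (Suc 2) (x i [^] n) z \<in> coboundary_set (minors R x) 2"
    unfolding all_entries
    by (intro conjI 1[OF c(1) rel(1)] 2[OF c(2) rel(3)] 3[OF c(3) rel(5)] 1[OF c(4) rel(2)]
        2[OF c(5) rel(4)] 3[OF c(6) rel(6)])
  then show ?thesis using i by blast
qed

end

section \<open>Power series ring in six indeterminates\<close>

text \<open>
  Two binomials with coprime initial monomials \<open>M2\<close> and \<open>N1\<close> form a regular sequence.
\<close>

lemma powser_binomials_stable_seq:
  fixes K :: "('k, 'b) ring_scheme" and S :: "(nat multiset \<Rightarrow> 'k) ring" and \<sigma> :: "nat \<Rightarrow> nat"
  assumes ps: "powser S K V" and inj: "inj_on \<sigma> V"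
    and V: "set_mset M1 \<subseteq> V" "set_mset M2 \<subseteq> V" "set_mset N1 \<subseteq> V" "set_mset N2 \<subseteq> V"
    and disj: "set_mset M1 \<inter> set_mset M2 = {}" "set_mset N1 \<inter> set_mset M2 = {}" "M1 \<noteq> {#}"
    and key: "image_mset \<sigma> M2 < image_mset \<sigma> M1" "image_mset \<sigma> N1 < image_mset \<sigma> N2"
    and b: "b = powser.mono K M1 \<ominus>\<^bsub>S\<^esub> powser.mono K M2"
    and c: "c = powser.mono K N1 \<ominus>\<^bsub>S\<^esub> powser.mono K N2 \<or> c = powser.mono K N2 \<ominus>\<^bsub>S\<^esub> powser.mono K N1"
  shows "cring.stable_seq S [c, b]"
proof -
  interpret powser S K V by (rule ps)
  have bc: "b \<in> carrier S" unfolding b using mono_closed V by simp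
  have cc: "c \<in> carrier S" using c mono_closed V by auto
  have ini: "initial \<sigma> c N1" using c initial_binomial[OF inj V(4) V(3) key(2)] by auto
  have inib: "initial \<sigma> b M2" unfolding b by (rule initial_binomial(1)[OF inj V(1,2) key(1)])
  show ?thesis
  proof (rule stable_seq_pair[OF bc cc])
    show "s = \<zero>\<^bsub>S\<^esub>" if "s \<in> carrier S" "b \<otimes>\<^bsub>S\<^esub> s = \<zero>\<^bsub>S\<^esub>" for s
    proof (rule integral_S[OF inj bc that])
      show "b \<noteq> \<zero>\<^bsub>S\<^esub>" using inib unfolding initial_def[OF inj] S_zero by auto
    qed
    show "\<exists>s'\<in>carrier S. s = b \<otimes>\<^bsub>S\<^esub> s'" if "s \<in> carrier S" "t \<in> carrier S" "c \<otimes>\<^bsub>S\<^esub> s = b \<otimes>\<^bsub>S\<^esub> t" for s t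
      using binomial_colon[OF inj V(1,2) disj(1,3) key(1) cc ini disj(2) that(1,2)] that(3) unfolding b by simp
  qed
qed

lemma minors_powser_support:
  fixes K :: "('k, 'b) ring_scheme" and E :: "nat \<Rightarrow> (nat multiset \<Rightarrow> 'k, 'm) module"
  assumes K: "field K"
    and res: "injective_resolution (powser_ring K {1..6::nat}) (ring_as_module (powser_ring K {1..6})) E d \<epsilon>"
    and S: "S = powser_ring K {1..6::nat}" and \<xi>: "\<xi> = ring.indexed_var K"
    and H: "H = local_cohomology S (minors_ideal S \<xi>) E d 3"
  shows "module_support S H \<subseteq> {genideal S {\<xi> 1, \<xi> 2, \<xi> 3, \<xi> 4, \<xi> 5, \<xi> 6}} \<and> finite (associated_primes S H)"
proof -
  define V where "V = {1..6::nat}"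
  have "module S (E 0)" using res unfolding injective_resolution_def injective_module_def S by blast
  then have cr: "cring S" by (rule module.axioms(1))
  interpret inj_res S E d \<epsilon>
    by (intro inj_res.intro inj_res_axioms.intro cr) (use res S in simp)
  have ps: "powser S K V" by (intro powser.intro powser_axioms.intro cr K) (simp add: S V_def)
  interpret P: powser S K V by (rule ps)
  have \<xi>m: "\<xi> i = P.mono {#i#}" for i unfolding \<xi> by (rule P.indexed_var_mono)
  have \<xi>c: "\<xi> i \<in> carrier S" if "i \<in> {1..6}" for i unfolding \<xi>m using that by (intro P.mono_closed) (simp add: V_def)
  then have \<xi>P: "\<xi> \<in> {1..6} \<rightarrow> carrier S" by blast
  have \<xi>\<xi>: "\<xi> i \<otimes>\<^bsub>S\<^esub> \<xi> j = P.mono {#i, j#}" if "i \<in> {1..6}" "j \<in> {1..6}" for i j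
    unfolding \<xi>m using P.mono_mono[of "{#i#}" "{#j#}"] that by (simp add: V_def add_mset_commute)
  have D: "minor S \<xi> 1 = P.mono {#2, 6#} \<ominus>\<^bsub>S\<^esub> P.mono {#3, 5#}"
    "minor S \<xi> 2 = P.mono {#1, 6#} \<ominus>\<^bsub>S\<^esub> P.mono {#3, 4#}"
    "minor S \<xi> 3 = P.mono {#1, 5#} \<ominus>\<^bsub>S\<^esub> P.mono {#2, 4#}"
    by (simp_all add: minor_def \<xi>\<xi>)
  have less: "{#a, b#} < {#c, e#}" if "max a b < max c e" for a b c e :: nat
    by (rule ex_gt_imp_less_multiset) (use that in \<open>auto intro!: exI[of _ "max c e"] simp: max_def split: if_splits\<close>)
  \<comment> \<open>the initial monomials are \<open>X\<^sub>3 X\<^sub>4\<close> and \<open>X\<^sub>1 X\<^sub>5\<close>: indices 6 and 2 get the largest labels\<close>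
  have g1: "stable_seq [minor S \<xi> 3, minor S \<xi> 2]"
  proof (rule powser_binomials_stable_seq[OF ps, of "\<lambda>i. if i = 2 then 5 else if i = 5 then 2 else i" "{#1, 6#}" "{#3, 4#}" "{#1, 5#}" "{#2, 4#}"])
    show "inj_on (\<lambda>i. if i = 2 then 5 else if i = 5 then 2 else i) V" by (auto simp: inj_on_def)
  qed (simp_all add: V_def D less del: One_nat_def)
  \<comment> \<open>the initial monomials are \<open>X\<^sub>3 X\<^sub>5\<close> and \<open>X\<^sub>2 X\<^sub>4\<close>: indices 6 and 5 have the largest labels\<close>
  have g2: "stable_seq [minor S \<xi> 3, minor S \<xi> 1]"
  proof (rule powser_binomials_stable_seq[OF ps, of "\<lambda>i. i" "{#2, 6#}" "{#3, 5#}" "{#2, 4#}" "{#1, 5#}"])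
    show "inj_on (\<lambda>i. i) V" by (auto simp: inj_on_def)
  qed (simp_all add: V_def D less del: One_nat_def)
  \<comment> \<open>the initial monomials are \<open>X\<^sub>3 X\<^sub>5\<close> and \<open>X\<^sub>1 X\<^sub>6\<close>: indices 2 and 4 get the largest labels\<close>
  have g3: "stable_seq [minor S \<xi> 2, minor S \<xi> 1]"
  proof (rule powser_binomials_stable_seq[OF ps, of "\<lambda>i. if i = 2 then 10 else if i = 4 then 9 else i" "{#2, 6#}" "{#3, 5#}" "{#1, 6#}" "{#3, 4#}"])
    show "inj_on (\<lambda>i. if i = 2 then 10 else if i = 4 then 9 else i) V" by (auto simp: inj_on_def V_def)
  qed (simp_all add: V_def D less del: One_nat_def)
  have as: "set (minors S \<xi>) \<subseteq> carrier S" using minor_closed[OF \<xi>P] by simp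
  have Heq: "H = local_cohomology S (genideal S (set (minors S \<xi>))) E d (Suc 2)"
    unfolding H minors_ideal_eq by simp
  have kill: "\<exists>n::nat. sm (Suc 2) (\<xi> i [^]\<^bsub>S\<^esub> n) z \<in> coboundary_set (minors S \<xi>) 2"
    if "i \<in> {1..6}" "z \<in> tors (minors S \<xi>) (Suc 2)" "d (Suc 2) z = Z0 (Suc (Suc 2))" for i z
    using killed_by_entries[OF \<xi>P g1 g2 g3 that(2,3,1)] .
  have vars: "(\<lambda>i. P.mono {#i#}) ` V = {\<xi> 1, \<xi> 2, \<xi> 3, \<xi> 4, \<xi> 5, \<xi> 6}"
  proof -
    have "V = {1, 2, 3, 4, 5, 6}" unfolding V_def by auto
    then show ?thesis by (simp add: \<xi>m)
  qed
  have only: "Q = genideal S {\<xi> 1, \<xi> 2, \<xi> 3, \<xi> 4, \<xi> 5, \<xi> 6}"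
    if "primeideal Q S" "\<And>i. i \<in> {1..6} \<Longrightarrow> \<xi> i \<in> Q" for Q
    using P.prime_over_variables[OF _ that(1)] that(2) unfolding vars by (auto simp: V_def \<xi>m)
  have "module_support S H \<subseteq> {genideal S {\<xi> 1, \<xi> 2, \<xi> 3, \<xi> 4, \<xi> 5, \<xi> 6}}"
  proof
    fix Q assume Q: "Q \<in> module_support S H"
    have "\<xi> i \<in> Q" if i: "i \<in> {1..6}" for i
      by (rule module_support_mem[OF as \<xi>c[OF i] Q[unfolded Heq]]) (use kill i in auto)
    moreover have "primeideal Q S" using Q unfolding module_support_def by blast
    ultimately show "Q \<in> {genideal S {\<xi> 1, \<xi> 2, \<xi> 3, \<xi> 4, \<xi> 5, \<xi> 6}}" using only by blast
  qed
  moreover have "associated_primes S H \<subseteq> {genideal S {\<xi> 1, \<xi> 2, \<xi> 3, \<xi> 4, \<xi> 5, \<xi> 6}}"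
  proof
    fix Q assume "Q \<in> associated_primes S H"
    then obtain z where Q: "primeideal Q S" and z: "z \<in> tors (minors S \<xi>) (Suc 2)" "d (Suc 2) z = Z0 (Suc (Suc 2))"
      and Qz: "Q = {s \<in> carrier S. sm (Suc 2) s z \<in> coboundary_set (minors S \<xi>) 2}"
      using associated_prime_cocycle[OF as] unfolding Heq by blast
    have "\<xi> i \<in> Q" if i: "i \<in> {1..6}" for i
    proof -
      obtain n :: nat where "\<xi> i [^]\<^bsub>S\<^esub> n \<in> Q" using kill[OF i z] \<xi>c[OF i] unfolding Qz by auto
      then show ?thesis by (rule prime_pow_mem[OF Q \<xi>c[OF i]])
    qed
    then show "Q \<in> {genideal S {\<xi> 1, \<xi> 2, \<xi> 3, \<xi> 4, \<xi> 5, \<xi> 6}}" using only[OF Q] by blast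
  qed
  ultimately show ?thesis using finite_subset by blast
qed

section \<open>Cohen-Macaulay rings\<close>

lemma (in local_noeth) finite_ass_minors:
  fixes F :: "nat \<Rightarrow> ('a, 'n) module"
  assumes eq: "equicharacteristic R \<mm>"
    and reg: "regular_sequence R [x 1, x 2, x 3, x 4, x 5, x (6::nat)]"
    and res: "injective_resolution R (ring_as_module R) F \<delta> \<eta>"
  shows "finite (associated_primes R (local_cohomology R (minors_ideal R x) F \<delta> 3))"
proof -
  have cr: "cring R" by (rule is_cring)
  interpret inj_res R F \<delta> \<eta> by (intro inj_res.intro inj_res_axioms.intro cr res)
  define xs where "xs = [x 1, x 2, x 3, x 4, x 5, x 6]"
  define V where "V = {..<6::nat}"
  define y where "y i = xs ! i" for i
  have y: "y 0 = x 1" "y 1 = x 2" "y 2 = x 3" "y 3 = x 4" "y 4 = x 5" "y 5 = x 6"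
    unfolding y_def xs_def by simp_all
  have V6: "V = {0, 1, 2, 3, 4, 5}" unfolding V_def by auto
  have take: "set (take i xs) = y ` {..<i}" if "i \<le> 6" for i
    unfolding y_def using nth_image[of i xs] that by (simp add: xs_def lessThan_atLeast0)
  have xsc: "set xs \<subseteq> carrier R" and proper: "Idl (set xs) \<noteq> carrier R"
    using reg unfolding regular_sequence_def xs_def[symmetric] by auto
  have xs_m: "set xs \<subseteq> \<mm>"
    using proper_ideal_le_m[OF genideal_ideal[OF xsc] proper] genideal_self[OF xsc] by blast
  have yset: "y ` V = set xs" using take[of 6] unfolding V_def by (simp add: xs_def)
  have ym: "y i \<in> \<mm>" if "i \<in> V" for i using that yset xs_m by blast
  have yc: "y i \<in> carrier R" if "i \<in> V" for i using ym[OF that] ideal_carr[OF ideal_m] by blast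
  have yreg: "r \<in> Idl (y ` {..<i})" if "i < 6" "r \<in> carrier R" "y i \<otimes> r \<in> Idl (y ` {..<i})" for i r
  proof -
    have "i < length xs" using that(1) by (simp add: xs_def)
    then have "y i \<otimes> r \<in> Idl (set (take i xs)) \<longrightarrow> r \<in> Idl (set (take i xs))"
      using reg that(2) unfolding regular_sequence_def xs_def[symmetric] y_def by blast
    then show ?thesis using take[of i] that(1,3) by simp
  qed
  interpret G: local_graded R \<mm> y V int_multiples
  proof (intro local_graded.intro graded.intro permutable_regular.intro monomials.intro monomials_axioms.intro
      permutable_regular_axioms.intro local_graded_axioms.intro)
    show "local_noeth R \<mm>" by (rule local_noeth_axioms)
    show "cring R" by (rule cr)
    show "finite V" "V \<noteq> {}" unfolding V6 by auto
    show "unit_coeffs R int_multiples" by (rule int_multiples_unit_coeffs[OF eq])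
    show "r \<in> Idl (y ` T)" if "T \<subseteq> V" "i \<in> V - T" "r \<in> carrier R" "y i \<otimes> r \<in> Idl (y ` T)" for T i r
      by (rule regular_sequence_permutable[of 6 y T i r]) (use that ym yreg in \<open>auto simp: V_def\<close>)
  qed (use yc ym in auto)
  have "\<forall>i\<in>{1..6}. x i \<in> carrier R" unfolding all_entries using xsc unfolding xs_def by simp
  then have xc: "x i \<in> carrier R" if "i \<in> {1..6}" for i using that by blast
  then have xP: "x \<in> {1..6} \<rightarrow> carrier R" by blast
  define as where "as = minors R x"
  have asc: "set as \<subseteq> carrier R" unfolding as_def using minor_closed[OF xP] by simp
  have stable_seq: "stable_seq bs" if "set bs \<subseteq> carrier R" for bs using stable_seq_if_noetherian[OF that] .
  have Fm2: "minor R x j \<in> G.forms 2" for j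
  proof -
    have "\<forall>i\<in>V. y i \<in> G.forms 1" using G.forms_var by blast
    then have F1: "x 1 \<in> G.forms 1" "x 2 \<in> G.forms 1" "x 3 \<in> G.forms 1" "x 4 \<in> G.forms 1" "x 5 \<in> G.forms 1" "x 6 \<in> G.forms 1"
      unfolding y[symmetric] V6 by blast+
    have "a \<otimes> b \<ominus> a' \<otimes> b' \<in> G.forms 2"
      if "a \<in> G.forms 1" "b \<in> G.forms 1" "a' \<in> G.forms 1" "b' \<in> G.forms 1" for a b a' b'
      using G.forms_minus[OF G.forms_mult[OF that(2,1)] G.forms_mult[OF that(4,3)]] unfolding one_add_one .
    then show ?thesis unfolding minor_def using F1 by simp
  qed
  have kill: "\<exists>n::nat. sm (Suc 2) (x i [^] n) z \<in> coboundary_set as 2"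
    if "i \<in> {1..6}" "z \<in> tors as (Suc 2)" "\<delta> (Suc 2) z = Z0 (Suc (Suc 2))" for i z
    unfolding as_def
    by (rule killed_by_entries[OF xP stable_seq stable_seq stable_seq]) (use that minor_closed[OF xP] in \<open>auto simp: as_def\<close>)
  have Heq: "local_cohomology R (minors_ideal R x) F \<delta> 3 = local_cohomology R (Idl (set as)) F \<delta> (Suc 2)"
    unfolding minors_ideal_eq as_def by simp
  have "associated_primes R (local_cohomology R (minors_ideal R x) F \<delta> 3) \<subseteq> ass_quot (Idl (y ` V))"
  proof
    fix P assume "P \<in> associated_primes R (local_cohomology R (minors_ideal R x) F \<delta> 3)"
    then obtain z where P: "primeideal P R" and z: "z \<in> tors as (Suc 2)" "\<delta> (Suc 2) z = Z0 (Suc (Suc 2))"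
      and Pz: "P = {s \<in> carrier R. sm (Suc 2) s z \<in> coboundary_set as 2}"
      using associated_prime_cocycle[OF asc] unfolding Heq by blast
    have xiP: "x i \<in> P" if i: "i \<in> {1..6}" for i
    proof -
      obtain n :: nat where "x i [^] n \<in> P" using kill[OF i z] xc[OF i] unfolding Pz by auto
      then show ?thesis by (rule prime_pow_mem[OF P xc[OF i]])
    qed
    have yP: "y ` V \<subseteq> P" unfolding yset xs_def using xiP by simp
    have len: "length as = Suc 2" unfolding as_def by simp
    obtain n r where represents: "represents as n z r" using represents_exists[OF stable_seq[OF asc]] z unfolding len by blast
    have rc: "r \<in> carrier R" using represents_cocycle[OF asc represents] by blast
    define q where "q = prodl as"
    have qc: "q \<in> carrier R" unfolding q_def using asc by simp
    have coboundary: "coboundary as w \<longleftrightarrow> w \<in> coboundary_set as 2" for w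
      unfolding coboundary_set_def as_def by (auto simp: numeral_2_eq_2)
    \<comment> \<open>by \<open>coboundary_iff\<close>, \<open>P\<close> is the union of this ascending chain of ideals\<close>
  define A where "A N = {s \<in> carrier R. s \<otimes> (r \<otimes> q [^] N) \<in> power_ideal as (n + N)}" for N :: nat
    have memP: "s \<in> P \<longleftrightarrow> (\<exists>N. s \<in> A N)" if s: "s \<in> carrier R" for s
    proof -
      have "represents as n (sm (Suc 2) s z) (s \<otimes> r)" using represents_smult[OF asc represents s] unfolding len .
      then have "sm (Suc 2) s z \<in> coboundary_set as 2 \<longleftrightarrow> (\<exists>N. s \<otimes> r \<otimes> q [^] N \<in> power_ideal as (n + N))"
        unfolding coboundary[symmetric] q_def by (rule coboundary_iff[OF stable_seq[OF asc]])
      then show ?thesis unfolding Pz A_def using s rc qc by (simp add: m_assoc)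
    qed
    have Ai: "ideal (A N) R" for N unfolding A_def
      by (rule ideal_colon[OF ideal_power_ideal[OF asc]]) (use rc qc in simp)
    have Amono: "A N \<subseteq> A (Suc N)" for N
    proof
      fix s assume s: "s \<in> A N"
      then have "s \<otimes> (r \<otimes> q [^] N) \<otimes> q [^] (1::nat) \<in> power_ideal as (n + N + 1)"
        unfolding A_def q_def by (intro power_ideal_shift[OF asc]) auto
      moreover have "s \<in> carrier R" using s unfolding A_def by simp
      ultimately show "s \<in> A (Suc N)" unfolding A_def using rc qc by (simp add: m_assoc)
    qed
    obtain N0 where N0: "\<And>N. N0 \<le> N \<Longrightarrow> A N = A N0" using chain_stable[of A, OF Ai Amono] by blast
    have "A N \<subseteq> A N0" for N
    proof (cases "N \<le> N0")
      case True
      then show ?thesis by (rule lift_Suc_mono_le[of A, OF Amono])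
    next
      case False
      then show ?thesis using N0[of N] by simp
    qed
    moreover have "P \<subseteq> carrier R" "A N0 \<subseteq> carrier R" unfolding Pz A_def by auto
    ultimately have PA: "P = A N0" using memP by blast
    define M where "M = n + N0"
    define f where "f = r \<otimes> q [^] N0"
    have Peq: "P = {p \<in> carrier R. p \<otimes> f \<in> Idl ((\<lambda>a. a [^] M) ` set as)}"
      unfolding PA A_def power_ideal_def f_def M_def ..
    show "P \<in> ass_quot (Idl (y ` V))"
    proof (rule G.associated_prime_over_sequence[OF _ _ P _ Peq yP])
      show "finite ((\<lambda>a. a [^] M) ` set as)" by simp
      show "g \<in> G.forms (M * 2)" if "g \<in> (\<lambda>a. a [^] M) ` set as" for g
        using that Fm2 unfolding as_def by (auto intro!: G.forms_pow)
      show "f \<in> carrier R" unfolding f_def using rc qc by simp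
    qed
  qed
  moreover have "finite (ass_quot (Idl (y ` V)))"
    by (rule finite_ass_quot[OF genideal_ideal]) (use yc in auto)
  ultimately show ?thesis using finite_subset by blast
qed

lemma local_noethI: "noetherian_local_ring R \<mm> \<Longrightarrow> local_noeth R \<mm>"
  unfolding noetherian_local_ring_def
  by (intro local_noeth.intro noeth_cring.intro local_noeth_axioms.intro) auto

theorem theorem7:
  fixes K :: "('k, 'b) ring_scheme"
    and E :: "nat \<Rightarrow> (nat multiset \<Rightarrow> 'k, 'm) module"
    and d :: "nat \<Rightarrow> 'm \<Rightarrow> 'm"
    and \<epsilon> :: "(nat multiset \<Rightarrow> 'k) \<Rightarrow> 'm"
    and R :: "('a, 'c) ring_scheme"
    and \<mm> :: "'a set"
    and x :: "nat \<Rightarrow> 'a"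
    and F :: "nat \<Rightarrow> ('a, 'n) module"
    and \<delta> :: "nat \<Rightarrow> 'n \<Rightarrow> 'n"
    and \<eta> :: "'a \<Rightarrow> 'n"
  shows
    "(let S = powser_ring K {1..6::nat};
          \<xi> = ring.indexed_var K;
          H = local_cohomology S (minors_ideal S \<xi>) E d 3
      in field K \<and> injective_resolution S (ring_as_module S) E d \<epsilon> \<longrightarrow>
         module_support S H \<subseteq> {genideal S {\<xi> 1, \<xi> 2, \<xi> 3, \<xi> 4, \<xi> 5, \<xi> 6}} \<and>
         finite (associated_primes S H))
     \<and>
     (let H = local_cohomology R (minors_ideal R x) F \<delta> 3
      in noetherian_local_ring R \<mm> \<and> equicharacteristic R \<mm> \<and> cohen_macaulay R \<mm> \<and>
         regular_sequence R [x 1, x 2, x 3, x 4, x 5, x 6] \<and>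
         injective_resolution R (ring_as_module R) F \<delta> \<eta> \<longrightarrow>
         finite (associated_primes R H))"
  unfolding Let_def
proof (rule conjI; rule impI)
  assume "field K \<and> injective_resolution (powser_ring K {1..6::nat}) (ring_as_module (powser_ring K {1..6})) E d \<epsilon>"
  then show "module_support (powser_ring K {1..6::nat})
      (local_cohomology (powser_ring K {1..6}) (minors_ideal (powser_ring K {1..6}) (ring.indexed_var K)) E d 3)
    \<subseteq> {genideal (powser_ring K {1..6}) {ring.indexed_var K 1, ring.indexed_var K 2, ring.indexed_var K 3,
        ring.indexed_var K 4, ring.indexed_var K 5, ring.indexed_var K 6}} \<and>
    finite (associated_primes (powser_ring K {1..6})
      (local_cohomology (powser_ring K {1..6}) (minors_ideal (powser_ring K {1..6}) (ring.indexed_var K)) E d 3))"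
    by (intro minors_powser_support[OF _ _ refl refl refl]) (elim conjE, assumption)+
next
  assume "noetherian_local_ring R \<mm> \<and> equicharacteristic R \<mm> \<and> cohen_macaulay R \<mm> \<and>
         regular_sequence R [x 1, x 2, x 3, x 4, x 5, x 6] \<and>
         injective_resolution R (ring_as_module R) F \<delta> \<eta>"
  then show "finite (associated_primes R (local_cohomology R (minors_ideal R x) F \<delta> 3))"
    by (elim conjE) (rule local_noeth.finite_ass_minors[OF local_noethI])
qed

end
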